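(* Let $m,n>0$, and let $D$, $\Gamma$ and $(\Gamma,\zeta,\Omega)$ be as described in the context. Assume that $A_1\notin\Omega$, and assume that for any point $p\in\Omega_1$ there is an $\Omega$-proper orbit $(p,p_1,\dots,p_N)$ such that $$p_N\notin\bigcup_{k\ge 0}\zeta_1^{-k}(\Omega_1),$$ that is, $\zeta_1^k(p_N)\in\Omega_1$ for no $k\ge 0$. Then for any $g\in C^2(\partial D)$ there exists a unique generalized solution $u\in C^2(\overline{D})$ of the problem $$(m\partial_x+n\partial_y)\partial_x\partial_y u=0\ \text{ in } D,\qquad u=g\ \text{ on }\partial D.$$
   Context: Let $O=(0,0)$, $A_1=(1,0)$, $A_2=(0,1)$. $\Gamma$ is a $C^2$ curve in $\mathbb{R}^2$ (with a tangent space $T_q(\Gamma)$ at every point $q$) that intersects the axes exactly at $A_1$ and $A_2$, and $\Gamma=\{(\alpha_1(z),\alpha_2(z)): z\in[-1,1]\}$ where $\alpha_1,\alpha_2\in C^2([-1,1])$, $\alpha_1'\ge 0$, $\alpha_2'\le 0$; the parametrization runs from $A_2$ (at $z=-1$) to $A_1$ (at $z=1$). $D$ is the curvilinear triangle $OA_1A_2$ bounded by the segments $OA_1$, $OA_2$ and $\Gamma$. $C^2(\partial D)$ denotes the continuous functions on $\partial D$ whose restrictions to each of the three closed sides $OA_1$, $OA_2$, $\Gamma$ are $C^2$. Generalized solution: $u\in C(\overline{D})$ with $u|_{\partial D}=g$ and $-\int_D u\,(m\partial_x+n\partial_y)\partial_x\partial_y\varphi\,dx\,dy=0$ for every $\varphi\in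 C_0^\infty(D)$. For $p=(x,y)\in\overline{D}$ put $\pi_1p=(x,0)$, $\pi_2p=(0,y)$, and let $\pi_3p$ be the unique point of intersection of $\Gamma$ with the line $\{p+(mt,nt):t\in\mathbb{R}\}$. Define $\zeta_1=\pi_3\circ\pi_1$, $\zeta_2=\pi_3\circ\pi_2$, maps of $\Gamma$ into itself, and $\zeta=(\zeta_1,\zeta_2)$. The guiding sets are $\Omega_1=\{q\in\Gamma:(0,1)\in T_q(\Gamma)\}$ (vertical tangent) and $\Omega_2=\{q\in\Gamma:(1,0)\in T_q(\Gamma)\}$ (horizontal tangent); used as a set, $\Omega=\Omega_1\cup\Omega_2$. An $\Omega$-proper orbit is a finite or infinite sequence $(p_1,p_2,\dots)$ in $\Gamma$ such that for every $j\ge2$ there is $i\in\{1,2\}$ with $p_{j-1}\notin\Omega_i$ and $p_j=\zeta_i(p_{j-1})$. $\zeta_1^k$ denotes the $k$-th iterate of $\zeta_1$. *)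

theory Defs
  imports "HOL-Analysis.Analysis"
begin

type_synonym point = "real \<times> real"

text \<open>The class \<open>C\<^sup>2([a,b])\<close>, with one-sided derivatives at the end points.\<close>

definition C2_interval :: "real \<Rightarrow> real \<Rightarrow> (real \<Rightarrow> 'a::real_normed_vector) \<Rightarrow> bool" where
  "C2_interval a b f \<longleftrightarrow>
     (\<exists>f' f''. (\<forall>t\<in>{a..b}. (f has_vector_derivative f' t) (at t within {a..b})) \<and>
               (\<forall>t\<in>{a..b}. (f' has_vector_derivative f'' t) (at t within {a..b})) \<and>
               continuous_on {a..b} f'')"

definition partial_x :: "(point \<Rightarrow> real) \<Rightarrow> point \<Rightarrow> real" where
  "partial_x f p = frechet_derivative f (at p) (1, 0)"

definition partial_y :: "(point \<Rightarrow> real) \<Rightarrow> point \<Rightarrow> real" where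
  "partial_y f p = frechet_derivative f (at p) (0, 1)"

text \<open>For open \<open>S\<close>, \<open>Ck_closure k S\<close> is \<open>C\<^sup>k\<close> of the closure of \<open>S\<close>: the partial derivatives of
  order at most \<open>k\<close> exist in \<open>S\<close> and each has a continuous extension to the closure of \<open>S\<close>
  (\<open>fx\<close> and \<open>fy\<close> below are the extended first order derivatives). For \<open>S = UNIV\<close> this is
  \<open>C\<^sup>k\<close> of the whole plane. Values of \<open>f\<close> outside the closure of \<open>S\<close> play no role.\<close>

primrec Ck_closure :: "nat \<Rightarrow> point set \<Rightarrow> (point \<Rightarrow> real) \<Rightarrow> bool" where
  "Ck_closure 0 S f \<longleftrightarrow> continuous_on (closure S) f"
| "Ck_closure (Suc k) S f \<longleftrightarrow>
     continuous_on (closure S) f \<and> (\<forall>p\<in>S. f differentiable (at p)) \<and>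
     (\<exists>fx fy. (\<forall>p\<in>S. fx p = partial_x f p \<and> fy p = partial_y f p) \<and>
              Ck_closure k S fx \<and> Ck_closure k S fy)"

text \<open>\<open>C\<^sub>0\<^sup>\<infinity>(S)\<close>, its elements being extended by zero to the plane.\<close>

definition test_function :: "point set \<Rightarrow> (point \<Rightarrow> real) \<Rightarrow> bool" where
  "test_function S \<phi> \<longleftrightarrow>
     (\<forall>k. Ck_closure k UNIV \<phi>) \<and>
     compact (closure {p. \<phi> p \<noteq> 0}) \<and> closure {p. \<phi> p \<noteq> 0} \<subseteq> S"

definition curve :: "(real \<Rightarrow> point) \<Rightarrow> point set" where
  "curve \<gamma> = \<gamma> ` {-1..1}"

definition velocity :: "(real \<Rightarrow> point) \<Rightarrow> real \<Rightarrow> point" where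
  "velocity \<gamma> z = vector_derivative \<gamma> (at z within {-1..1})"

text \<open>\<open>\<gamma> = (\<alpha>\<^sub>1, \<alpha>\<^sub>2)\<close>. The condition \<open>velocity \<gamma> z \<noteq> 0\<close> expresses that the image is a \<open>C\<^sup>2\<close> curve
  having a tangent line at every point.\<close>

definition admissible_curve :: "(real \<Rightarrow> point) \<Rightarrow> bool" where
  "admissible_curve \<gamma> \<longleftrightarrow>
     C2_interval (-1) 1 \<gamma> \<and>
     (\<forall>z\<in>{-1..1}. velocity \<gamma> z \<noteq> 0 \<and> fst (velocity \<gamma> z) \<ge> 0 \<and> snd (velocity \<gamma> z) \<le> 0) \<and>
     \<gamma> (-1) = (0, 1) \<and> \<gamma> 1 = (1, 0) \<and>
     {q \<in> curve \<gamma>. fst q = 0 \<or> snd q = 0} = {(1, 0), (0, 1)}"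

definition curv_triangle :: "(real \<Rightarrow> point) \<Rightarrow> point set" where
  "curv_triangle \<gamma> =
     inside (closed_segment (0, 0) (1, 0) \<union> closed_segment (0, 0) (0, 1) \<union> curve \<gamma>)"

text \<open>Since \<open>\<gamma>\<close> is regular, \<open>g\<close> is \<open>C\<^sup>2\<close> on the curve iff \<open>g \<circ> \<gamma>\<close> is \<open>C\<^sup>2\<close>.\<close>

definition C2_boundary :: "(real \<Rightarrow> point) \<Rightarrow> (point \<Rightarrow> real) \<Rightarrow> bool" where
  "C2_boundary \<gamma> g \<longleftrightarrow>
     continuous_on (frontier (curv_triangle \<gamma>)) g \<and>
     C2_interval 0 1 (\<lambda>x. g (x, 0)) \<and>
     C2_interval 0 1 (\<lambda>y. g (0, y)) \<and>
     C2_interval (-1) 1 (g \<circ> \<gamma>)"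

definition tangent_space :: "(real \<Rightarrow> point) \<Rightarrow> point \<Rightarrow> point set" where
  "tangent_space \<gamma> q = (\<Union>z\<in>{z\<in>{-1..1}. \<gamma> z = q}. span {velocity \<gamma> z})"

definition Omega1 :: "(real \<Rightarrow> point) \<Rightarrow> point set" where
  "Omega1 \<gamma> = {q \<in> curve \<gamma>. (0, 1) \<in> tangent_space \<gamma> q}"

definition Omega2 :: "(real \<Rightarrow> point) \<Rightarrow> point set" where
  "Omega2 \<gamma> = {q \<in> curve \<gamma>. (1, 0) \<in> tangent_space \<gamma> q}"

definition Omega :: "(real \<Rightarrow> point) \<Rightarrow> point set" where
  "Omega \<gamma> = Omega1 \<gamma> \<union> Omega2 \<gamma>"

definition proj1 :: "point \<Rightarrow> point" where
  "proj1 p = (fst p, 0)"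

definition proj2 :: "point \<Rightarrow> point" where
  "proj2 p = (0, snd p)"

definition proj3 :: "real \<Rightarrow> real \<Rightarrow> (real \<Rightarrow> point) \<Rightarrow> point \<Rightarrow> point" where
  "proj3 m n \<gamma> p = (THE q. q \<in> curve \<gamma> \<and> q \<in> {p + (m * t, n * t) | t. True})"

definition zeta1 :: "real \<Rightarrow> real \<Rightarrow> (real \<Rightarrow> point) \<Rightarrow> point \<Rightarrow> point" where
  "zeta1 m n \<gamma> = proj3 m n \<gamma> \<circ> proj1"

definition zeta2 :: "real \<Rightarrow> real \<Rightarrow> (real \<Rightarrow> point) \<Rightarrow> point \<Rightarrow> point" where
  "zeta2 m n \<gamma> = proj3 m n \<gamma> \<circ> proj2"

text \<open>Finite proper orbits, as nonempty lists.\<close>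

definition proper_orbit :: "real \<Rightarrow> real \<Rightarrow> (real \<Rightarrow> point) \<Rightarrow> point list \<Rightarrow> bool" where
  "proper_orbit m n \<gamma> ps \<longleftrightarrow>
     ps \<noteq> [] \<and> set ps \<subseteq> curve \<gamma> \<and>
     successively (\<lambda>p q. p \<notin> Omega1 \<gamma> \<and> q = zeta1 m n \<gamma> p \<or>
                         p \<notin> Omega2 \<gamma> \<and> q = zeta2 m n \<gamma> p) ps"

definition diff_op :: "real \<Rightarrow> real \<Rightarrow> (point \<Rightarrow> real) \<Rightarrow> point \<Rightarrow> real" where
  "diff_op m n \<phi> p =
     m * partial_x (partial_x (partial_y \<phi>)) p + n * partial_y (partial_x (partial_y \<phi>)) p"

definition generalized_solution ::
    "real \<Rightarrow> real \<Rightarrow> (real \<Rightarrow> point) \<Rightarrow> (point \<Rightarrow> real) \<Rightarrow> (point \<Rightarrow> real) \<Rightarrow> bool" where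
  "generalized_solution m n \<gamma> g u \<longleftrightarrow>
     continuous_on (closure (curv_triangle \<gamma>)) u \<and>
     (\<forall>p\<in>frontier (curv_triangle \<gamma>). u p = g p) \<and>
     (\<forall>\<phi>. test_function (curv_triangle \<gamma>) \<phi> \<longrightarrow>
          - (LINT p:curv_triangle \<gamma>|lborel. u p * diff_op m n \<phi> p) = 0)"

end

theory Submission
  imports Defs
begin

text \<open>A \<open>C\<^sup>2\<close> solution is a sum of functions of \<open>x\<close>, of \<open>y\<close> and of the level \<open>s = n x - m y\<close>. The data on the
  two axes eliminate the first two, leaving one function \<open>F\<close> of the level; with \<open>a s = n x\<close> and
  \<open>b s = s - a s = - m y\<close> at the point of \<open>\<Gamma>\<close> of level \<open>s\<close>, the data on \<open>\<Gamma>\<close> become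
  \<open>F s - F (a s) - F (b s) = H s\<close>. The maps \<open>a\<close> and \<open>b\<close> are \<open>\<zeta>\<^sub>1\<close> and \<open>\<zeta>\<^sub>2\<close>, and \<open>\<Omega>\<^sub>1\<close>, \<open>\<Omega>\<^sub>2\<close> are the zero sets
  of \<open>a'\<close> and \<open>b' = 1 - a'\<close>.

  The derivative \<open>\<phi> = F'\<close> solves \<open>\<phi> = T \<phi> + H'\<close>, where \<open>T \<phi> = a' (\<phi> \<circ> a) + b' (\<phi> \<circ> b)\<close> is a Markov operator,
  and \<open>(T \<phi>)' = S \<phi>' + a'' (\<phi> \<circ> a - \<phi> \<circ> b)\<close> with \<open>S \<psi> = a'\<^sup>2 (\<psi> \<circ> a) + b'\<^sup>2 (\<psi> \<circ> b)\<close>. By hypothesis every point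
  has a proper orbit converging to \<open>A\<^sub>1\<close>, which lies outside \<open>\<Omega>\<close>. By compactness a power of \<open>S\<close> is then a
  contraction, and a power of \<open>T\<close> satisfies a Doeblin minorization near \<open>A\<^sub>1\<close>, so it contracts the oscillation
  of functions whose derivative is under control. A combination of \<open>sup \<bar>\<phi>'\<bar>\<close> and the oscillation of \<open>\<phi>\<close>
  decays geometrically along \<open>T\<^sup>k \<phi>\<close>, so \<open>\<phi>\<close> is obtained as a \<open>C\<^sup>1\<close> convergent series, unique up to a
  constant; the terms linear in \<open>F\<close> cancel in the solution.\<close>

section \<open>The functional equation on the interval of levels\<close>

text \<open>The equation \<open>F s - F (a s) - F (b s) = H s\<close> has total weight two and
  offers no contraction. One derivative lowers the weights to \<open>a'\<close> and
  \<open>b'\<close>, of sum one: constants stay fixed, so at best oscillations shrink. A second one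
  squares them, and \<open>a'\<^sup>2 + b'\<^sup>2 < 1\<close> except on the guiding sets, where one
  of the maps has full weight. The orbits serve to leave these sets. The price of the second
  derivative is the term with \<open>a''\<close>, which sees only the oscillation of
  \<open>\<phi>\<close>; hence two quantities are estimated together, with one exponent that serves
  both. The fixed constants leave a defect \<open>c\<close>: the series solves
  \<open>\<phi> - T \<phi> = H' - c\<close>. Integration turns it into \<open>c * s\<close>, and a
  comparison of the two ends, where \<open>H\<close> vanishes, forces \<open>c = 0\<close>.
  Conversely, a \<open>C\<^sup>2\<close> solution need not have third derivatives. That its mixed
  derivative is constant along characteristics is therefore read off from the weak equation, tested
  with products adapted to them.\<close>

lemma eventually_below_uniform:
  fixes f :: "nat \<Rightarrow> 'a::metric_space \<Rightarrow> real"
  assumes K: "compact K" "K \<noteq> {}" and cont: "\<And>k. continuous_on K (f k)"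
    and step: "\<And>k s. s \<in> K \<Longrightarrow> f k s < c \<Longrightarrow> f (Suc k) s < c"
    and ex: "\<And>s. s \<in> K \<Longrightarrow> \<exists>k. f k s < c"
  shows "\<exists>k q. q < c \<and> (\<forall>s\<in>K. f k s \<le> q)"
proof -
  have up: "f k s < c" if "s \<in> K" "f j s < c" "j \<le> k" for s j k
    using that(3) by (induction k rule: dec_induct) (use that step in auto)
  \<comment> \<open>A Dini argument in which only the inequality \<open>< c\<close> has to persist,
    not monotonicity: at a cluster point \<open>y\<close> of violating points it holds for some
    \<open>j\<close>, hence nearby by continuity, hence there for all later indices.\<close>
  have "\<exists>k. \<forall>s\<in>K. f k s < c"
  proof (rule ccontr)
    assume "\<not> ?thesis"
    then have "\<forall>k. \<exists>s\<in>K. f k s \<ge> c" by (auto simp: not_less)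
    then obtain x where x: "\<And>k. x k \<in> K" "\<And>k. f k (x k) \<ge> c" by metis
    obtain y h where y: "y \<in> K" "strict_mono h" "(x \<circ> h) \<longlonglongrightarrow> y"
      using K(1) x(1) unfolding compact_def by metis
    obtain j where j: "f j y < c" using ex y(1) by blast
    have "(\<lambda>i. f j (x (h i))) \<longlonglongrightarrow> f j y"
      using continuous_on_tendsto_compose[OF cont[of j], of "x \<circ> h" y sequentially] y x by auto
    then have "\<forall>\<^sub>F i in sequentially. f j (x (h i)) < c"
      using j by (rule order_tendstoD)
    moreover have "\<forall>\<^sub>F i in sequentially. j \<le> h i"
      using eventually_ge_at_top[of j] by eventually_elim (use seq_suble[OF y(2)] order_trans in blast)
    ultimately obtain i where "f j (x (h i)) < c" "j \<le> h i"
      using eventually_happens'[OF sequentially_bot eventually_conj] by blast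
    then have "f (h i) (x (h i)) < c" using up x(1) by blast
    with x(2)[of "h i"] show False by simp
  qed
  then obtain k where k: "\<forall>s\<in>K. f k s < c" by blast
  \<comment> \<open>The maximum over the compact set turns the strict inequality into a uniform
    margin.\<close>
  obtain t where "t \<in> K" "\<forall>s\<in>K. f k s \<le> f k t"
    using continuous_attains_sup[OF K cont[of k]] by blast
  with k show ?thesis by blast
qed

lemma increment_bound_within:
  fixes f :: "real \<Rightarrow> real"
  assumes f: "\<And>s. s \<in> {l..r} \<Longrightarrow> (f has_real_derivative f' s) (at s within {l..r})"
    and e: "\<And>s. s \<in> {l..r} \<Longrightarrow> \<bar>f' s\<bar> \<le> e" and s: "s \<in> {l..r}" "t \<in> {l..r}"
  shows "\<bar>f s - f t\<bar> \<le> e * \<bar>s - t\<bar>"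
  using field_differentiable_bound[of "{l..r}" f f' e s t] assms by auto

lemma nondecreasing_within:
  fixes f :: "real \<Rightarrow> real"
  assumes f: "\<And>s. s \<in> {l..r} \<Longrightarrow> (f has_real_derivative f' s) (at s within {l..r})"
    and e: "\<And>s. s \<in> {l..r} \<Longrightarrow> 0 \<le> f' s" and s: "s \<in> {l..r}" "t \<in> {l..r}" "s \<le> t"
  shows "f s \<le> f t"
proof (rule DERIV_nonneg_imp_increasing_open[OF s(3)])
  fix x assume x: "s < x" "x < t"
  then have "at x within {l..r} = at x" using s by (auto intro!: at_within_interior)
  with f[of x] e[of x] x s show "\<exists>y. (f has_real_derivative y) (at x) \<and> 0 \<le> y" by auto
next
  show "continuous_on {s..t} f"
    using DERIV_continuous_on[of "{l..r}" f f'] f s by (auto intro: continuous_on_subset)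
qed

lemma within_derivative_unique:
  fixes f :: "real \<Rightarrow> real"
  assumes "l < r" "s \<in> {l..r}" "(f has_real_derivative d) (at s within {l..r})"
    "(f has_real_derivative e) (at s within {l..r})"
  shows "d = e"
  using vector_derivative_unique_within_closed_interval[of l r s f d e] assms
  by (simp add: has_real_derivative_iff_has_vector_derivative)

text \<open>Level coordinates: \<open>l\<close>, 0 and \<open>r\<close> are the levels of
  \<open>A\<^sub>2\<close>, of the origin and of \<open>A\<^sub>1\<close>. The numbers
  \<open>da s\<close> and \<open>1 - da s\<close> act as probabilities of the moves to
  \<open>a s\<close> and \<open>s - a s\<close>, and a move is proper when its probability is not
  zero. The last assumption is the hypothesis on orbits that start in
  \<open>\<Omega>\<^sub>1\<close>.\<close>

locale functional_equation =
  fixes l r :: real and a da dda :: "real \<Rightarrow> real"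
  assumes l: "l < 0" and r: "0 < r"
    and a_deriv: "\<And>s. s \<in> {l..r} \<Longrightarrow> (a has_real_derivative da s) (at s within {l..r})"
    and da_deriv: "\<And>s. s \<in> {l..r} \<Longrightarrow> (da has_real_derivative dda s) (at s within {l..r})"
    and dda_cont: "continuous_on {l..r} dda"
    and da_range: "\<And>s. s \<in> {l..r} \<Longrightarrow> 0 \<le> da s \<and> da s \<le> 1"
    and a_l: "a l = 0" and a_r: "a r = r"
    and a_gt: "\<And>s. l \<le> s \<Longrightarrow> s < r \<Longrightarrow> s < a s"
    and da_r: "0 < da r" "da r < 1"
    and orbits: "\<And>s. s \<in> {l..r} \<Longrightarrow> da s = 0 \<Longrightarrow>
        \<exists>t. (\<lambda>s t. da s \<noteq> 0 \<and> t = a s \<or> da s \<noteq> 1 \<and> t = s - a s)\<^sup>*\<^sup>* s t \<and> (\<forall>k. da ((a ^^ k) t) \<noteq> 0)"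
begin

abbreviation I where "I \<equiv> {l..r}"

definition b where "b s = s - a s"

abbreviation step where "step \<equiv> (\<lambda>s t. da s \<noteq> 0 \<and> t = a s \<or> da s \<noteq> 1 \<and> t = s - a s)"

lemma b_deriv: "s \<in> I \<Longrightarrow> (b has_real_derivative (1 - da s)) (at s within I)"
  unfolding b_def[abs_def] by (auto intro!: derivative_eq_intros a_deriv)

lemma a_mem: assumes "s \<in> I" shows "a s \<in> I"
proof -
  have "a l \<le> a s" "a s \<le> a r"
    using assms l r by (auto intro!: nondecreasing_within[OF a_deriv] simp: da_range)
  then show ?thesis using a_l a_r l by simp
qed

lemma b_mem: assumes "s \<in> I" shows "b s \<in> I"
proof -
  have "b l \<le> b s" "b s \<le> b r"
    using assms l r by (auto intro!: nondecreasing_within[OF b_deriv] simp: da_range)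
  then show ?thesis using a_l a_r r by (simp add: b_def)
qed

lemma a_ge: "s \<in> I \<Longrightarrow> s \<le> a s"
  using a_gt[of s] a_r by (cases "s = r") auto

lemma cont_a: "continuous_on I a" and cont_da: "continuous_on I da" and cont_b: "continuous_on I b"
  by (rule DERIV_continuous_on, erule a_deriv da_deriv b_deriv)+

lemma a_pow_mem: "s \<in> I \<Longrightarrow> (a ^^ k) s \<in> I"
  by (induction k) (auto simp del: atLeastAtMost_iff simp: a_mem)

text \<open>The iterates increase because \<open>a s \<ge> s\<close>, so they converge to a fixed
  point of \<open>a\<close>, and \<open>r\<close> is the only one.\<close>

lemma a_pow_tendsto: assumes s: "s \<in> I" shows "(\<lambda>k. (a ^^ k) s) \<longlonglongrightarrow> r"
proof -
  let ?x = "\<lambda>k. (a ^^ k) s"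
  have mem: "?x k \<in> I" for k using a_pow_mem[OF s] .
  have "incseq ?x" by (rule incseq_SucI, unfold funpow.simps comp_def, rule a_ge, rule mem)
  moreover have "\<forall>k. ?x k \<le> r" using mem by auto
  ultimately obtain L where L: "?x \<longlonglongrightarrow> L" using incseq_convergent by blast
  have LI: "L \<in> I" by (rule closed_sequentially[OF closed_atLeastAtMost _ L]) (rule mem)
  have "(\<lambda>k. a (?x k)) \<longlonglongrightarrow> a L"
    by (rule continuous_on_tendsto_compose[OF cont_a L LI]) (intro always_eventually allI mem)
  moreover have "(\<lambda>k. a (?x k)) \<longlonglongrightarrow> L" using LIMSEQ_Suc[OF L] by simp
  ultimately have "a L = L" using LIMSEQ_unique by blast
  then have "L = r" using a_gt[of L] LI by (cases "L < r") auto
  with L show ?thesis by simp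
qed

text \<open>The single place where the orbits enter: a property that holds near \<open>r\<close> and
  can be pulled back along proper moves holds everywhere. Points whose \<open>a\<close>-orbit avoids
  the zeros of \<open>da\<close> come near \<open>r\<close> by proper moves; a zero of
  \<open>da\<close> is joined to such a point by hypothesis; every other point reaches a zero by
  proper moves.\<close>

lemma chain_induct:
  assumes s: "s \<in> I" and d: "0 < d"
    and near: "\<And>s. s \<in> I \<Longrightarrow> r - d < s \<Longrightarrow> Q s"
    and Qa: "\<And>s. s \<in> I \<Longrightarrow> da s \<noteq> 0 \<Longrightarrow> Q (a s) \<Longrightarrow> Q s"
    and Qb: "\<And>s. s \<in> I \<Longrightarrow> da s \<noteq> 1 \<Longrightarrow> Q (b s) \<Longrightarrow> Q s"
  shows "Q s"
proof -
  have pull: "Q s" if "s \<in> I" "Q ((a ^^ k) s)" "\<And>j. j < k \<Longrightarrow> da ((a ^^ j) s) \<noteq> 0" for s k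
    using that
  proof (induction k)
    case (Suc k)
    have "Q ((a ^^ k) s)"
    proof (rule Qa[OF a_pow_mem[OF Suc.prems(1)]])
      show "da ((a ^^ k) s) \<noteq> 0" by (rule Suc.prems(3)) simp
      show "Q (a ((a ^^ k) s))" using Suc.prems(2) unfolding funpow.simps comp_def .
    qed
    then show ?case
    proof (rule Suc.IH[OF Suc.prems(1)])
      show "da ((a ^^ j) s) \<noteq> 0" if "j < k" for j by (rule Suc.prems(3)) (use that in simp)
    qed
  next
    case 0
    then show ?case by (simp only: funpow.simps id_def)
  qed
  have 1: "Q s" if "s \<in> I" "\<And>k. da ((a ^^ k) s) \<noteq> 0" for s
  proof -
    have "\<forall>\<^sub>F k in sequentially. r - d < (a ^^ k) s"
      by (rule order_tendstoD(1)[OF a_pow_tendsto[OF that(1)]]) (use d in simp)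
    then obtain k where "r - d < (a ^^ k) s" by (auto simp: eventually_sequentially)
    then have "Q ((a ^^ k) s)" using near[OF a_pow_mem[OF that(1)]] by simp
    then show ?thesis by (rule pull[OF that(1)]) (rule that(2))
  qed
  have 2: "Q s" if m: "s \<in> I" and z: "da s = 0" for s
  proof -
    obtain t where t: "step\<^sup>*\<^sup>* s t" "\<And>k. da ((a ^^ k) t) \<noteq> 0"
      using orbits[OF m z] by (elim exE conjE) (rule that, assumption, erule spec)
    from t(1) have "t \<in> I \<and> (Q t \<longrightarrow> Q s)"
    proof (induction rule: rtranclp_induct)
      case base
      show ?case using m by simp
    next
      case (step y z)
      have y: "y \<in> I" "Q y \<Longrightarrow> Q s" using step.IH by simp_all
      from step.hyps(2) have "(da y \<noteq> 0 \<and> z = a y) \<or> (da y \<noteq> 1 \<and> z = b y)"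
        unfolding b_def .
      then show ?case
      proof (elim disjE conjE)
        assume z: "da y \<noteq> 0" "z = a y"
        then show ?thesis using Qa[OF y(1) z(1)] y(2) a_mem[OF y(1)] by simp
      next
        assume z: "da y \<noteq> 1" "z = b y"
        then show ?thesis using Qb[OF y(1) z(1)] y(2) b_mem[OF y(1)] by simp
      qed
    qed
    then have "t \<in> I" "Q t \<Longrightarrow> Q s" by simp_all
    from this(2)[OF 1[OF this(1) t(2)]] show ?thesis .
  qed
  show ?thesis
  proof (cases "\<exists>k. da ((a ^^ k) s) = 0")
    case True
    \<comment> \<open>Before the first zero of \<open>da\<close> all moves along \<open>a\<close>
      are proper, so the property at that zero can be pulled back to \<open>s\<close>.\<close>
    define k where "k = (LEAST k. da ((a ^^ k) s) = 0)"
    have "da ((a ^^ k) s) = 0" using True unfolding k_def by (rule LeastI_ex)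
    moreover have "da ((a ^^ j) s) \<noteq> 0" if "j < k" for j
      using not_less_Least that unfolding k_def by blast
    ultimately show ?thesis using pull[OF s 2[OF a_pow_mem[OF s]]] by simp
  next
    case False
    then have "\<And>k. da ((a ^^ k) s) \<noteq> 0" by blast
    then show ?thesis by (rule 1[OF s])
  qed
qed

section \<open>The Markov operator \<open>T\<close> and the operator \<open>S\<close> that acts on
  derivatives\<close>

definition T :: "(real \<Rightarrow> real) \<Rightarrow> real \<Rightarrow> real" where
  "T \<phi> s = da s * \<phi> (a s) + (1 - da s) * \<phi> (b s)"

definition S :: "(real \<Rightarrow> real) \<Rightarrow> real \<Rightarrow> real" where
  "S \<psi> s = (da s)\<^sup>2 * \<psi> (a s) + (1 - da s)\<^sup>2 * \<psi> (b s)"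

lemma T_mono: "(\<And>s. s \<in> I \<Longrightarrow> \<phi> s \<le> \<eta> s) \<Longrightarrow> s \<in> I \<Longrightarrow> T \<phi> s \<le> T \<eta> s"
  unfolding T_def by (intro add_mono mult_left_mono) (use a_mem b_mem da_range in auto)

lemma S_mono: "(\<And>s. s \<in> I \<Longrightarrow> \<phi> s \<le> \<eta> s) \<Longrightarrow> s \<in> I \<Longrightarrow> S \<phi> s \<le> S \<eta> s"
  unfolding S_def by (intro add_mono mult_left_mono) (use a_mem b_mem da_range in auto)

lemma T_pow_mono: "(\<And>s. s \<in> I \<Longrightarrow> \<phi> s \<le> \<eta> s) \<Longrightarrow> s \<in> I \<Longrightarrow> (T ^^ k) \<phi> s \<le> (T ^^ k) \<eta> s"
proof (induction k arbitrary: s)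
  case (Suc k)
  show ?case unfolding funpow.simps comp_def by (rule T_mono[OF Suc.IH[OF Suc.prems(1)] Suc.prems(2)])
qed simp

lemma S_pow_mono: "(\<And>s. s \<in> I \<Longrightarrow> \<phi> s \<le> \<eta> s) \<Longrightarrow> s \<in> I \<Longrightarrow> (S ^^ k) \<phi> s \<le> (S ^^ k) \<eta> s"
proof (induction k arbitrary: s)
  case (Suc k)
  show ?case unfolding funpow.simps comp_def by (rule S_mono[OF Suc.IH[OF Suc.prems(1)] Suc.prems(2)])
qed simp

lemma T_affine: "T (\<lambda>s. c + d * \<phi> s) = (\<lambda>s. c + d * T \<phi> s)"
  unfolding T_def by (auto simp: algebra_simps)

lemma T_pow_affine: "(T ^^ k) (\<lambda>s. c + d * \<phi> s) = (\<lambda>s. c + d * (T ^^ k) \<phi> s)"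
  by (induction k) (simp_all add: T_affine)

lemma T_pow_const: "(T ^^ k) (\<lambda>s. c) = (\<lambda>s. c)"
  using T_pow_affine[of k c 0 "\<lambda>_. 0"] by simp

lemma cont_T:
  assumes "continuous_on I \<phi>"
  shows "continuous_on I (T \<phi>)"
proof -
  have "continuous_on I (\<lambda>s. \<phi> (a s))" "continuous_on I (\<lambda>s. \<phi> (b s))"
    using continuous_on_compose2[OF assms cont_a] continuous_on_compose2[OF assms cont_b]
      a_mem b_mem by blast+
  then show ?thesis unfolding T_def[abs_def] by (intro continuous_intros cont_da)
qed

lemma cont_S:
  assumes "continuous_on I \<phi>"
  shows "continuous_on I (S \<phi>)"
proof -
  have "continuous_on I (\<lambda>s. \<phi> (a s))" "continuous_on I (\<lambda>s. \<phi> (b s))"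
    using continuous_on_compose2[OF assms cont_a] continuous_on_compose2[OF assms cont_b]
      a_mem b_mem by blast+
  then show ?thesis unfolding S_def[abs_def] by (intro continuous_intros cont_da)
qed

lemma cont_T_pow: "continuous_on I \<phi> \<Longrightarrow> continuous_on I ((T ^^ k) \<phi>)"
  by (induction k) (simp_all add: cont_T)

lemma cont_S_pow: "continuous_on I \<phi> \<Longrightarrow> continuous_on I ((S ^^ k) \<phi>)"
  by (induction k) (simp_all add: cont_S)

lemma square_sum_le_one: assumes "s \<in> I" shows "(da s)\<^sup>2 + (1 - da s)\<^sup>2 \<le> 1"
proof -
  have "0 \<le> da s * (1 - da s)" using da_range[OF assms] by simp
  then show ?thesis by (simp add: power2_eq_square algebra_simps)
qed

lemma S_one_le: "s \<in> I \<Longrightarrow> S (\<lambda>_. 1) s \<le> 1"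
  using square_sum_le_one by (simp add: S_def)

lemma S_pow_one_le: "s \<in> I \<Longrightarrow> (S ^^ k) (\<lambda>_. 1) s \<le> 1"
proof (induction k arbitrary: s)
  case (Suc k)
  have "S ((S ^^ k) (\<lambda>_. 1)) s \<le> S (\<lambda>_. 1) s" by (rule S_mono[OF Suc.IH Suc.prems])
  with S_one_le[OF Suc.prems] show ?case by simp
qed simp

lemma S_pow_one_decreasing: "s \<in> I \<Longrightarrow> (S ^^ Suc k) (\<lambda>_. 1) s \<le> (S ^^ k) (\<lambda>_. 1) s"
proof -
  assume "s \<in> I"
  then have "(S ^^ k) (S (\<lambda>_. 1)) s \<le> (S ^^ k) (\<lambda>_. 1) s"
    by (intro S_pow_mono S_one_le)
  then show ?thesis by (simp add: funpow_swap1)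
qed

lemma I_ne: "I \<noteq> {}" and r_mem: "r \<in> I" and l_mem: "l \<in> I"
  using l r by auto

lemma S_pow_Suc: "(S ^^ Suc k) \<psi> s = (da s)\<^sup>2 * (S ^^ k) \<psi> (a s) + (1 - da s)\<^sup>2 * (S ^^ k) \<psi> (b s)"
  by (simp add: S_def)

lemma T_pow_Suc: "(T ^^ Suc k) \<phi> s = da s * (T ^^ k) \<phi> (a s) + (1 - da s) * (T ^^ k) \<phi> (b s)"
  by (simp add: T_def)

text \<open>Since \<open>S\<close> is positive, its powers are governed by their values on the
  constant 1. Near \<open>r\<close> both weights lie strictly between 0 and 1, so one application is
  already below 1 there. A proper move has positive weight and carries the strict inequality back to
  its starting point, so \<open>chain_induct\<close> yields it everywhere, and compactness makes it
  uniform.\<close>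

lemma S_pow_contracts:
  obtains p q where "0 < p" "0 \<le> q" "q < 1" "\<And>s. s \<in> I \<Longrightarrow> (S ^^ p) (\<lambda>_. 1) s \<le> q"
proof -
  have "(da \<longlongrightarrow> da r) (at r within I)"
    using cont_da r_mem unfolding continuous_on_def by blast
  then have "\<forall>\<^sub>F s in at r within I. 0 < da s \<and> da s < 1"
    using da_r by (intro eventually_conj) (rule order_tendstoD, assumption+)+
  then obtain d where d: "0 < d" "\<And>s. s \<in> I \<Longrightarrow> s \<noteq> r \<Longrightarrow> dist s r < d \<Longrightarrow> 0 < da s \<and> da s < 1"
    unfolding eventually_at by auto
  have dn: "0 < da s \<and> da s < 1" if "s \<in> I" "r - d < s" for s
    using that d(2)[of s] da_r by (cases "s = r") (auto simp: dist_real_def)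
  have ex: "\<exists>k. (S ^^ k) (\<lambda>_. 1) s < 1" if "s \<in> I" for s
    using that d(1)
  proof (rule chain_induct)
    fix s assume s: "s \<in> I" "r - d < s"
    have "0 < da s * (1 - da s)" using dn[OF s] by simp
    then have "(S ^^ 1) (\<lambda>_. 1) s < 1" by (simp add: S_def power2_eq_square algebra_simps)
    then show "\<exists>k. (S ^^ k) (\<lambda>_. 1) s < 1" by blast
  next
    fix s assume s: "s \<in> I" "da s \<noteq> 0" "\<exists>k. (S ^^ k) (\<lambda>_. 1) (a s) < 1"
    then obtain k where k: "(S ^^ k) (\<lambda>_. 1) (a s) < 1" by blast
    have "(S ^^ Suc k) (\<lambda>_. 1) s < (da s)\<^sup>2 * 1 + (1 - da s)\<^sup>2 * 1"
      unfolding S_pow_Suc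
      by (intro add_less_le_mono mult_strict_left_mono mult_left_mono k S_pow_one_le b_mem)
         (use s in auto)
    then show "\<exists>k. (S ^^ k) (\<lambda>_. 1) s < 1" using square_sum_le_one[OF s(1)] by (smt (verit))
  next
    fix s assume s: "s \<in> I" "da s \<noteq> 1" "\<exists>k. (S ^^ k) (\<lambda>_. 1) (b s) < 1"
    then obtain k where k: "(S ^^ k) (\<lambda>_. 1) (b s) < 1" by blast
    have "(S ^^ Suc k) (\<lambda>_. 1) s < (da s)\<^sup>2 * 1 + (1 - da s)\<^sup>2 * 1"
      unfolding S_pow_Suc
      by (intro add_le_less_mono mult_strict_left_mono mult_left_mono k S_pow_one_le a_mem)
         (use s in auto)
    then show "\<exists>k. (S ^^ k) (\<lambda>_. 1) s < 1" using square_sum_le_one[OF s(1)] by (smt (verit))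
  qed
  have "\<exists>p q. q < 1 \<and> (\<forall>s\<in>I. (S ^^ p) (\<lambda>_. 1) s \<le> q)"
  proof (rule eventually_below_uniform)
    show "compact I" by simp
    show "I \<noteq> {}" by (rule I_ne)
    show "continuous_on I ((S ^^ k) (\<lambda>_. 1))" for k by (intro cont_S_pow continuous_intros)
    show "(S ^^ Suc k) (\<lambda>_. 1) s < 1" if "s \<in> I" "(S ^^ k) (\<lambda>_. 1) s < 1" for k s
      using S_pow_one_decreasing[OF that(1), of k] that(2) by linarith
    show "\<exists>k. (S ^^ k) (\<lambda>_. 1) s < 1" if "s \<in> I" for s using ex[OF that] .
  qed
  then obtain p q where pq: "q < 1" "\<forall>s\<in>I. (S ^^ p) (\<lambda>_. 1) s \<le> q" by blast
  have "p \<noteq> 0" using pq r_mem by (cases p) (auto dest: bspec[of _ _ r])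
  moreover have "\<And>s. s \<in> I \<Longrightarrow> (S ^^ p) (\<lambda>_. 1) s \<le> max 0 q" using pq by force
  ultimately show ?thesis using that[of p "max 0 q"] pq by auto
qed

text \<open>The Markov chain with transition operator \<open>T\<close> enters a given neighbourhood of \<open>r\<close> with
  probability bounded below.\<close>

lemma T_pow_minorization:
  assumes d: "0 < d"
  obtains N \<eta> where "\<And>s. s \<in> I \<Longrightarrow> 0 \<le> \<eta> s \<and> \<eta> s \<le> 1"
    "\<And>s. s \<in> I \<Longrightarrow> s \<le> r - d \<Longrightarrow> \<eta> s = 0"
    "\<And>k. N \<le> k \<Longrightarrow> \<exists>\<kappa>>0. \<kappa> \<le> 1 \<and> (\<forall>s\<in>I. \<kappa> \<le> (T ^^ k) \<eta> s)"
proof -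
  have "(da \<longlongrightarrow> da r) (at r within I)"
    using cont_da r_mem unfolding continuous_on_def by blast
  then have "\<forall>\<^sub>F s in at r within I. da r / 2 < da s"
    by (rule order_tendstoD) (use da_r in simp)
  then obtain d' where d': "0 < d'" "\<And>s. s \<in> I \<Longrightarrow> s \<noteq> r \<Longrightarrow> dist s r < d' \<Longrightarrow> da r / 2 < da s"
    unfolding eventually_at by auto
  define e where "e = min d d'"
  have e: "0 < e" "e \<le> d" "e \<le> d'" using d d'(1) by (auto simp: e_def)
  have dn: "da r / 2 \<le> da s" if "s \<in> I" "r - e < s" for s
    using that d'(2)[of s] da_r e by (cases "s = r") (auto simp: dist_real_def)
  \<comment> \<open>A ramp that rises to 1 at \<open>r\<close> and lives where
    \<open>da \<ge> da r / 2\<close>. As \<open>\<eta>\<close> is nondecreasing and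
    \<open>a s \<ge> s\<close>, the move along \<open>a\<close> alone gives
    \<open>T \<eta> \<ge> da r / 2 * \<eta>\<close>; so positivity of an iterate at a point persists
    for all later iterates.\<close>
  define \<eta> where "\<eta> s = max 0 (1 - (r - s) / e)" for s
  have c01: "0 \<le> \<eta> s \<and> \<eta> s \<le> 1" if "s \<in> I" for s using that e by (auto simp: \<eta>_def)
  have c0: "\<eta> s = 0" if "s \<le> r - e" for s using that e by (simp add: \<eta>_def field_simps)
  have cm: "\<eta> s \<le> \<eta> t" if "s \<le> t" for s t
  proof -
    have "(r - t) / e \<le> (r - s) / e" using that e by (intro divide_right_mono) auto
    then show ?thesis by (simp add: \<eta>_def)
  qed
  have contc: "continuous_on I \<eta>" unfolding \<eta>_def by (intro continuous_intros) (use e in auto)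
  have T0: "0 \<le> (T ^^ k) \<eta> s" if "s \<in> I" for s k
    using T_pow_mono[of "\<lambda>_. 0" \<eta> s k] that c01 by (simp add: T_pow_const)
  have T1: "(T ^^ k) \<eta> s \<le> 1" if "s \<in> I" for s k
    using T_pow_mono[of \<eta> "\<lambda>_. 1" s k] that c01 by (simp add: T_pow_const)
  have grow1: "da r / 2 * \<eta> s \<le> T \<eta> s" if s: "s \<in> I" for s
  proof (cases "r - e < s")
    case True
    have "da r / 2 * \<eta> s \<le> da s * \<eta> (a s)"
      by (intro mult_mono dn cm a_ge) (use s True c01 da_range in auto)
    moreover have "0 \<le> (1 - da s) * \<eta> (b s)" using c01[OF b_mem[OF s]] da_range[OF s] by simp
    ultimately show ?thesis unfolding T_def by linarith
  next
    case False
    then show ?thesis using c0 T0[OF s, of 1] by simp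
  qed
  have grow: "da r / 2 * (T ^^ k) \<eta> s \<le> (T ^^ Suc k) \<eta> s" if s: "s \<in> I" for s k
  proof -
    have "(T ^^ k) (\<lambda>s. 0 + da r / 2 * \<eta> s) s \<le> (T ^^ k) (T \<eta>) s"
      using T_pow_mono[of "\<lambda>s. 0 + da r / 2 * \<eta> s" "T \<eta>" s k] grow1 s by simp
    then show ?thesis unfolding T_pow_affine by (simp add: funpow_swap1)
  qed
  have ex: "\<exists>k. 0 < (T ^^ k) \<eta> s" if "s \<in> I" for s
    using that e(1)
  proof (rule chain_induct)
    fix s assume s: "s \<in> I" "r - e < s"
    then have "(r - s) / e < 1" using e by (simp add: field_simps)
    then have "0 < (T ^^ 0) \<eta> s" by (simp add: \<eta>_def)
    then show "\<exists>k. 0 < (T ^^ k) \<eta> s" by blast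
  next
    fix s assume s: "s \<in> I" "da s \<noteq> 0" "\<exists>k. 0 < (T ^^ k) \<eta> (a s)"
    then obtain k where k: "0 < (T ^^ k) \<eta> (a s)" by blast
    have "0 < (T ^^ Suc k) \<eta> s" unfolding T_pow_Suc
      by (intro add_pos_nonneg mult_pos_pos mult_nonneg_nonneg k T0 b_mem)
         (use s da_range[OF s(1)] in auto)
    then show "\<exists>k. 0 < (T ^^ k) \<eta> s" by blast
  next
    fix s assume s: "s \<in> I" "da s \<noteq> 1" "\<exists>k. 0 < (T ^^ k) \<eta> (b s)"
    then obtain k where k: "0 < (T ^^ k) \<eta> (b s)" by blast
    have "0 < (T ^^ Suc k) \<eta> s" unfolding T_pow_Suc
      by (intro add_nonneg_pos mult_pos_pos mult_nonneg_nonneg k T0 a_mem)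
         (use s da_range[OF s(1)] in auto)
    then show "\<exists>k. 0 < (T ^^ k) \<eta> s" by blast
  qed
  have "\<exists>k q. q < 0 \<and> (\<forall>s\<in>I. - (T ^^ k) \<eta> s \<le> q)"
  proof (rule eventually_below_uniform)
    show "compact I" by simp
    show "I \<noteq> {}" by (rule I_ne)
    show "continuous_on I (\<lambda>s. - (T ^^ k) \<eta> s)" for k by (intro continuous_intros cont_T_pow contc)
    show "- (T ^^ Suc k) \<eta> s < 0" if "s \<in> I" "- (T ^^ k) \<eta> s < 0" for k s
    proof -
      have "0 < da r / 2 * (T ^^ k) \<eta> s" using that da_r by simp
      with grow[OF that(1), of k] show ?thesis by linarith
    qed
    show "\<exists>k. - (T ^^ k) \<eta> s < 0" if "s \<in> I" for s using ex[OF that] by simp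
  qed
  then obtain N q where N: "q < 0" "\<forall>s\<in>I. - (T ^^ N) \<eta> s \<le> q" by blast
  \<comment> \<open>A bound for all large \<open>k\<close> is needed, not only for \<open>N\<close>,
    because the exponent used later must also be a multiple of the one that contracts
    \<open>S\<close>.\<close>
  have fin: "\<exists>\<kappa>>0. \<forall>s\<in>I. \<kappa> \<le> (T ^^ k) \<eta> s" if "N \<le> k" for k
    using that
  proof (induction k rule: dec_induct)
    case base
    show ?case using N by (intro exI[of _ "-q"]) force
  next
    case (step k)
    then obtain \<kappa> where \<kappa>: "\<kappa> > 0" "\<And>s. s \<in> I \<Longrightarrow> \<kappa> \<le> (T ^^ k) \<eta> s" by blast
    have "da r / 2 * \<kappa> \<le> (T ^^ Suc k) \<eta> s" if "s \<in> I" for s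
      using order_trans[OF mult_left_mono[OF \<kappa>(2)[OF that], of "da r / 2"] grow[OF that, of k]] da_r by simp
    then show ?case using \<kappa>(1) da_r by (intro exI[of _ "da r / 2 * \<kappa>"]) auto
  qed
  have fin': "\<exists>\<kappa>>0. \<kappa> \<le> 1 \<and> (\<forall>s\<in>I. \<kappa> \<le> (T ^^ k) \<eta> s)" if "N \<le> k" for k
    using fin[OF that] T1[OF r_mem, of k] r_mem by force
  show ?thesis by (rule that[of \<eta> N]) (use c01 c0 e fin' in auto)
qed

end

text \<open>The terms are constant on blocks of length \<open>P\<close>. They are dominated by a
  geometric series whose ratio is the \<open>P\<close>-th root of \<open>\<rho>\<close>; the factor
  \<open>1 / \<rho>\<close> pays for the incomplete last block.\<close>

lemma summable_power_div:
  fixes \<rho> :: real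
  assumes "0 < P" "0 < \<rho>" "\<rho> < 1"
  shows "summable (\<lambda>k. \<rho> ^ (k div P))"
proof -
  define \<sigma> where "\<sigma> = root P \<rho>"
  have \<sigma>: "0 < \<sigma>" "\<sigma> < 1" "\<sigma> ^ P = \<rho>"
    using assms by (auto simp: \<sigma>_def)
  have "\<rho> ^ (k div P) \<le> (1 / \<rho>) * \<sigma> ^ k" for k
  proof -
    have "\<sigma> ^ P \<le> \<sigma> ^ (k mod P)"
      by (rule power_decreasing) (use \<sigma> assms(1) in \<open>auto simp: less_imp_le\<close>)
    then have "\<rho> ^ (k div P) * \<rho> \<le> \<rho> ^ (k div P) * \<sigma> ^ (k mod P)"
      using \<sigma>(3) assms(2) by (intro mult_left_mono) auto
    also have "\<dots> = \<sigma> ^ (P * (k div P) + k mod P)"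
      by (simp only: power_add power_mult \<sigma>(3))
    also have "\<dots> = \<sigma> ^ k" by simp
    finally show ?thesis using assms(2) by (simp add: field_simps)
  qed
  note le = this
  have "summable (\<lambda>k. (1 / \<rho>) * \<sigma> ^ k)"
    by (intro summable_mult summable_geometric) (use \<sigma> in auto)
  then show ?thesis
  proof (rule summable_comparison_test')
    show "norm (\<rho> ^ (k div P)) \<le> (1 / \<rho>) * \<sigma> ^ k" for k using le[of k] assms(2) by simp
  qed
qed

section \<open>Decay of the derivatives of the iterates, and the solution of the functional
  equation\<close>

context functional_equation begin

lemma compose_deriv:
  assumes f: "\<And>s. s \<in> I \<Longrightarrow> (f has_real_derivative f' s) (at s within I)" and s: "s \<in> I"
  shows "((\<lambda>s. f (a s)) has_real_derivative f' (a s) * da s) (at s within I)"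
    and "((\<lambda>s. f (b s)) has_real_derivative f' (b s) * (1 - da s)) (at s within I)"
proof -
  have "a ` I \<subseteq> I" "b ` I \<subseteq> I" using a_mem b_mem by blast+
  then show "((\<lambda>s. f (a s)) has_real_derivative f' (a s) * da s) (at s within I)"
    and "((\<lambda>s. f (b s)) has_real_derivative f' (b s) * (1 - da s)) (at s within I)"
    using DERIV_image_chain[OF DERIV_subset[OF f[OF a_mem[OF s]]] a_deriv[OF s]]
      DERIV_image_chain[OF DERIV_subset[OF f[OF b_mem[OF s]]] b_deriv[OF s]]
    unfolding comp_def by blast+
qed

lemma T_deriv:
  assumes f: "\<And>s. s \<in> I \<Longrightarrow> (\<phi> has_real_derivative \<psi> s) (at s within I)" and s: "s \<in> I"
  shows "(T \<phi> has_real_derivative S \<psi> s + dda s * (\<phi> (a s) - \<phi> (b s))) (at s within I)"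
  unfolding T_def[abs_def]
  by (rule derivative_eq_intros compose_deriv[OF f] da_deriv s refl | assumption)+
     (simp add: S_def power2_eq_square algebra_simps)

text \<open>The derivative of \<open>T^k \<phi>\<close> when \<open>\<psi>\<close> is the derivative
  of \<open>\<phi>\<close>. The explicit recursion gives continuity and bounds without
  differentiating again; it needs \<open>\<phi>\<close> as well as \<open>\<psi>\<close>, because
  the weights of \<open>T\<close> are not constant.\<close>

primrec dT :: "nat \<Rightarrow> (real \<Rightarrow> real) \<Rightarrow> (real \<Rightarrow> real) \<Rightarrow> real \<Rightarrow> real" where
  "dT 0 \<phi> \<psi> = \<psi>"
| "dT (Suc k) \<phi> \<psi> = (\<lambda>s. S (dT k \<phi> \<psi>) s + dda s * ((T ^^ k) \<phi> (a s) - (T ^^ k) \<phi> (b s)))"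

lemma T_pow_deriv:
  assumes f: "\<And>s. s \<in> I \<Longrightarrow> (\<phi> has_real_derivative \<psi> s) (at s within I)" and s: "s \<in> I"
  shows "((T ^^ k) \<phi> has_real_derivative dT k \<phi> \<psi> s) (at s within I)"
  using s
proof (induction k arbitrary: s)
  case (Suc k)
  show ?case unfolding funpow.simps comp_def dT.simps by (rule T_deriv[OF Suc.IH Suc.prems])
qed (simp add: f)

lemma dT_add: "dT (k + i) \<phi> \<psi> = dT i ((T ^^ k) \<phi>) (dT k \<phi> \<psi>)"
proof (induction i)
  case (Suc i)
  have "(T ^^ i) ((T ^^ k) \<phi>) = (T ^^ (k + i)) \<phi>"
    by (subst add.commute) (simp add: funpow_add)
  with Suc show ?case by simp
qed simp

lemma cont_dT:
  assumes \<phi>: "continuous_on I \<phi>" and \<psi>: "continuous_on I \<psi>"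
  shows "continuous_on I (dT k \<phi> \<psi>)"
proof (induction k)
  case (Suc k)
  have c: "continuous_on I ((T ^^ k) \<phi>)" by (rule cont_T_pow[OF \<phi>])
  have "continuous_on I (\<lambda>s. (T ^^ k) \<phi> (a s))" "continuous_on I (\<lambda>s. (T ^^ k) \<phi> (b s))"
    using continuous_on_compose2[OF c cont_a] continuous_on_compose2[OF c cont_b]
      a_mem b_mem by blast+
  then show ?case unfolding dT.simps
    by (intro continuous_on_add continuous_on_mult continuous_on_diff cont_S Suc dda_cont)
qed (simp add: \<psi>)

text \<open>The two sizes followed through the iteration: \<open>e\<close> for the derivative and
  \<open>w\<close> for the oscillation. Upper bounds are used instead of suprema, so that every step
  only has to exhibit new bounds.\<close>

definition controlled where
  "controlled \<phi> \<psi> e w \<longleftrightarrow>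
     (\<forall>s\<in>I. (\<phi> has_real_derivative \<psi> s) (at s within I) \<and> \<bar>\<psi> s\<bar> \<le> e) \<and>
     (\<forall>s\<in>I. \<forall>t\<in>I. \<phi> s - \<phi> t \<le> w)"

lemma controlledI:
  assumes "\<And>s. s \<in> I \<Longrightarrow> (\<phi> has_real_derivative \<psi> s) (at s within I)" "\<And>s. s \<in> I \<Longrightarrow> \<bar>\<psi> s\<bar> \<le> e"
    "\<And>s t. s \<in> I \<Longrightarrow> t \<in> I \<Longrightarrow> \<phi> s - \<phi> t \<le> w"
  shows "controlled \<phi> \<psi> e w"
  unfolding controlled_def using assms by (intro conjI ballI)

lemma controlledD:
  assumes "controlled \<phi> \<psi> e w"
  shows "\<And>s. s \<in> I \<Longrightarrow> (\<phi> has_real_derivative \<psi> s) (at s within I)" "\<And>s. s \<in> I \<Longrightarrow> \<bar>\<psi> s\<bar> \<le> e"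
    "\<And>s t. s \<in> I \<Longrightarrow> t \<in> I \<Longrightarrow> \<phi> s - \<phi> t \<le> w" "0 \<le> e" "0 \<le> w"
proof -
  show 1: "(\<phi> has_real_derivative \<psi> s) (at s within I)" "\<bar>\<psi> s\<bar> \<le> e" if "s \<in> I" for s
    using assms that unfolding controlled_def by blast+
  show 2: "\<phi> s - \<phi> t \<le> w" if "s \<in> I" "t \<in> I" for s t
    using assms that unfolding controlled_def by blast
  show "0 \<le> e" using 1(2)[OF r_mem] by linarith
  show "0 \<le> w" using 2[OF r_mem r_mem] by simp
qed

text \<open>\<open>T^k\<close> is an averaging operator, so its values stay within the range of
  \<open>\<phi>\<close>. The proof compares with constants twice, once at \<open>s\<close> and once
  at \<open>t\<close>.\<close>

lemma oscillation_T_pow: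
  assumes osc: "\<And>s t. s \<in> I \<Longrightarrow> t \<in> I \<Longrightarrow> \<phi> s - \<phi> t \<le> w" and s: "s \<in> I" and t: "t \<in> I"
  shows "(T ^^ k) \<phi> s - (T ^^ k) \<phi> t \<le> w"
proof -
  have 1: "(T ^^ k) \<phi> s - w \<le> \<phi> u" if u: "u \<in> I" for u
  proof -
    have "(T ^^ k) \<phi> s \<le> (T ^^ k) (\<lambda>_. \<phi> u + w) s"
      by (rule T_pow_mono[OF _ s]) (use osc u in \<open>smt (verit)\<close>)
    then show ?thesis by (simp add: T_pow_const)
  qed
  have "(T ^^ k) (\<lambda>_. (T ^^ k) \<phi> s - w) t \<le> (T ^^ k) \<phi> t"
    by (rule T_pow_mono[OF 1 t])
  then show ?thesis by (simp add: T_pow_const)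
qed

lemma S_abs:
  assumes "\<And>s. s \<in> I \<Longrightarrow> \<bar>\<psi> s\<bar> \<le> f s" "s \<in> I"
  shows "\<bar>S \<psi> s\<bar> \<le> S f s"
proof -
  have "S \<psi> s \<le> S f s" by (rule S_mono[OF _ assms(2)]) (use assms(1) in fastforce)
  moreover have "S (\<lambda>s. - \<psi> s) s \<le> S f s" by (rule S_mono[OF _ assms(2)]) (use assms(1) in fastforce)
  ultimately show ?thesis by (simp add: S_def)
qed

definition M where "M = Sup ((\<lambda>s. \<bar>dda s\<bar>) ` I)"

lemma M: "s \<in> I \<Longrightarrow> \<bar>dda s\<bar> \<le> M" and M_nonneg: "0 \<le> M"
proof -
  have "compact ((\<lambda>s. \<bar>dda s\<bar>) ` I)"
    by (intro compact_continuous_image continuous_intros dda_cont) simp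
  then have bdd: "bdd_above ((\<lambda>s. \<bar>dda s\<bar>) ` I)"
    by (intro bounded_imp_bdd_above compact_imp_bounded)
  show *: "\<bar>dda s\<bar> \<le> M" if "s \<in> I" for s
    unfolding M_def by (rule cSUP_upper[OF that bdd])
  show "0 \<le> M" using *[OF r_mem] by simp
qed

text \<open>Each step adds a term with \<open>dda\<close>, of size at most \<open>M * w\<close>
  because the oscillation does not grow, and \<open>S\<close> does not amplify the terms added
  earlier.\<close>

lemma dT_bound:
  assumes c: "controlled \<phi> \<psi> e w" and s: "s \<in> I"
  shows "\<bar>dT i \<phi> \<psi> s\<bar> \<le> e * (S ^^ i) (\<lambda>_. 1) s + i * (M * w)"
  using s
proof (induction i arbitrary: s)
  case 0
  then show ?case using controlledD(2)[OF c] by simp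
next
  case (Suc i)
  note D = controlledD[OF c]
  have osc: "\<bar>(T ^^ i) \<phi> (a s) - (T ^^ i) \<phi> (b s)\<bar> \<le> w"
  proof -
    have "(T ^^ i) \<phi> (a s) - (T ^^ i) \<phi> (b s) \<le> w" "(T ^^ i) \<phi> (b s) - (T ^^ i) \<phi> (a s) \<le> w"
      by (intro oscillation_T_pow[OF D(3)] a_mem b_mem Suc.prems; assumption)+
    then show ?thesis by linarith
  qed
  have Mw: "0 \<le> M * w" using M_nonneg D(5) by simp
  have "\<bar>S (dT i \<phi> \<psi>) s\<bar> \<le> S (\<lambda>s. e * (S ^^ i) (\<lambda>_. 1) s + i * (M * w)) s"
    by (rule S_abs[OF Suc.IH Suc.prems])
  also have "\<dots> = e * (S ^^ Suc i) (\<lambda>_. 1) s + i * (M * w) * ((da s)\<^sup>2 + (1 - da s)\<^sup>2)"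
    unfolding S_pow_Suc S_def[of "\<lambda>s. e * _ s + _"] by (simp add: algebra_simps)
  also have "\<dots> \<le> e * (S ^^ Suc i) (\<lambda>_. 1) s + i * (M * w) * 1"
    by (intro add_left_mono mult_left_mono square_sum_le_one Suc.prems) (use Mw in auto)
  finally have 1: "\<bar>S (dT i \<phi> \<psi>) s\<bar> \<le> e * (S ^^ Suc i) (\<lambda>_. 1) s + i * (M * w)" by simp
  have 2: "\<bar>dda s * ((T ^^ i) \<phi> (a s) - (T ^^ i) \<phi> (b s))\<bar> \<le> M * w"
    unfolding abs_mult using M[OF Suc.prems] osc M_nonneg by (intro mult_mono) auto
  have "\<bar>dT (Suc i) \<phi> \<psi> s\<bar> \<le> \<bar>S (dT i \<phi> \<psi>) s\<bar> + \<bar>dda s * ((T ^^ i) \<phi> (a s) - (T ^^ i) \<phi> (b s))\<bar>"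
    unfolding dT.simps by (rule abs_triangle_ineq)
  also have "\<dots> \<le> e * (S ^^ Suc i) (\<lambda>_. 1) s + i * (M * w) + M * w" using 1 2 by linarith
  also have "\<dots> = e * (S ^^ Suc i) (\<lambda>_. 1) s + Suc i * (M * w)" by (simp add: distrib_right)
  finally show ?case .
qed

lemma controlled_iterate:
  assumes c: "controlled \<phi> \<psi> e w"
  shows "controlled ((T ^^ i) \<phi>) (dT i \<phi> \<psi>) (e + i * (M * w)) w"
proof -
  note D = controlledD[OF c]
  have "\<bar>dT i \<phi> \<psi> s\<bar> \<le> e + i * (M * w)" if "s \<in> I" for s
    using dT_bound[OF c that, of i] mult_left_mono[OF S_pow_one_le[OF that, of i] D(4)] by simp
  then show ?thesis by (intro controlledI T_pow_deriv[OF D(1)] oscillation_T_pow[OF D(3)])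
qed

text \<open>Blocks of length \<open>p\<close> are composed. The bound \<open>q * e + C * w\<close>
  reached after one block reproduces itself in the next, as \<open>q * C + p * M \<le> C\<close>. It
  thus holds for all multiples of \<open>p\<close> with the same \<open>C\<close>. This prevents a
  circle: \<open>d\<close> is chosen from \<open>C\<close>, the exponent of the minorization depends
  on \<open>d\<close>, and \<open>C\<close> must not depend on that exponent.\<close>

lemma dT_bound_multiple:
  assumes p: "\<And>s. s \<in> I \<Longrightarrow> (S ^^ p) (\<lambda>_. 1) s \<le> q" and q: "0 \<le> q" "q < 1"
    and C: "p * M \<le> (1 - q) * C" and c: "controlled \<phi> \<psi> e w" and s: "s \<in> I"
  shows "\<bar>dT (Suc j * p) \<phi> \<psi> s\<bar> \<le> q * e + C * w"
  using s
proof (induction j arbitrary: s)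
  case (Suc j)
  note D = controlledD[OF c]
  have c': "controlled ((T ^^ (Suc j * p)) \<phi>) (dT (Suc j * p) \<phi> \<psi>) (q * e + C * w) w"
    by (intro controlledI T_pow_deriv[OF D(1)] oscillation_T_pow[OF D(3)] Suc.IH)
  have "\<bar>dT (Suc (Suc j) * p) \<phi> \<psi> s\<bar> = \<bar>dT p ((T ^^ (Suc j * p)) \<phi>) (dT (Suc j * p) \<phi> \<psi>) s\<bar>"
    by (simp only: dT_add[symmetric] mult_Suc[of "Suc j"] add.commute)
  also have "\<dots> \<le> (q * e + C * w) * (S ^^ p) (\<lambda>_. 1) s + p * (M * w)"
    by (rule dT_bound[OF c' Suc.prems])
  also have "\<dots> \<le> (q * e + C * w) * q + p * (M * w)"
    using controlledD(4)[OF c'] p[OF Suc.prems] by (intro add_right_mono mult_left_mono) auto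
  also have "\<dots> \<le> (q * e) * 1 + C * w * q + (1 - q) * C * w"
  proof -
    have "q * e * q \<le> q * e * 1" using q D(4) by (intro mult_left_mono) auto
    moreover have "p * M * w \<le> (1 - q) * C * w" using C D(5) by (intro mult_right_mono) auto
    ultimately show ?thesis by (simp add: algebra_simps)
  qed
  also have "\<dots> = q * e + C * w" by (simp add: algebra_simps)
  finally show ?case .
next
  case 0
  note D = controlledD[OF c]
  have "\<bar>dT p \<phi> \<psi> s\<bar> \<le> e * (S ^^ p) (\<lambda>_. 1) s + p * (M * w)" by (rule dT_bound[OF c 0])
  also have "\<dots> \<le> e * q + p * M * w"
    using D(4) p[OF 0] by (simp add: mult_left_mono mult.assoc)
  also have "p * M * w \<le> C * w"
  proof -
    have "0 \<le> real p * M" using M_nonneg by simp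
    with C have "0 \<le> (1 - q) * C" by linarith
    then have "0 \<le> C" using q by (simp add: zero_le_mult_iff)
    then have "(1 - q) * C \<le> C" using q by (simp add: mult_left_le_one_le)
    then show ?thesis using C D(5) by (intro mult_right_mono) auto
  qed
  finally show ?case by (simp add: mult.commute)
qed

text \<open>The function lies above the interpolation \<open>lo + (m - lo) * \<eta>\<close>, whose
  image under \<open>T^k\<close> is at least \<open>lo + (m - lo) * \<kappa>\<close>. If
  \<open>m < lo\<close>, the constant \<open>lo\<close> is already the better bound.\<close>

lemma T_pow_lower:
  assumes \<eta>: "\<And>s. s \<in> I \<Longrightarrow> 0 \<le> \<eta> s \<and> \<eta> s \<le> 1" "\<And>s. s \<in> I \<Longrightarrow> s \<le> r - d \<Longrightarrow> \<eta> s = 0"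
    and \<kappa>: "0 < \<kappa>" "\<And>s. s \<in> I \<Longrightarrow> \<kappa> \<le> (T ^^ k) \<eta> s"
    and lo: "\<And>s. s \<in> I \<Longrightarrow> lo \<le> \<phi> s" and near: "\<And>s. s \<in> I \<Longrightarrow> r - d < s \<Longrightarrow> m \<le> \<phi> s"
    and s: "s \<in> I"
  shows "(1 - \<kappa>) * lo + \<kappa> * m \<le> (T ^^ k) \<phi> s"
proof (cases "lo \<le> m")
  case True
  have "(T ^^ k) (\<lambda>s. lo + (m - lo) * \<eta> s) s \<le> (T ^^ k) \<phi> s"
  proof (rule T_pow_mono[OF _ s])
    fix u assume u: "u \<in> I"
    show "lo + (m - lo) * \<eta> u \<le> \<phi> u"
    proof (cases "u \<le> r - d")
      case False
      have "(m - lo) * \<eta> u \<le> m - lo" using True \<eta>(1)[OF u] by (simp add: mult_left_le)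
      with near[OF u] False show ?thesis by simp
    qed (use \<eta>(2)[OF u] lo[OF u] in simp)
  qed
  moreover have "(m - lo) * \<kappa> \<le> (m - lo) * (T ^^ k) \<eta> s"
    using True \<kappa>(2)[OF s] by (intro mult_left_mono) auto
  ultimately show ?thesis unfolding T_pow_affine by (simp add: algebra_simps)
next
  case False
  have "(T ^^ k) (\<lambda>_. lo) s \<le> (T ^^ k) \<phi> s" by (rule T_pow_mono[OF lo s])
  moreover have "\<kappa> * m \<le> \<kappa> * lo" using False \<kappa>(1) by (intro mult_left_mono) auto
  ultimately show ?thesis unfolding T_pow_const by (simp add: algebra_simps)
qed

text \<open>Doeblin's argument: within distance \<open>d\<close> of \<open>r\<close> the function
  differs from \<open>\<phi> r\<close> by at most \<open>d * e\<close>, and from every starting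
  point a mass of at least \<open>\<kappa>\<close> arrives there. The lower bounds for
  \<open>\<phi>\<close> at \<open>t\<close> and for its negative at \<open>s\<close> both contain
  \<open>\<phi> r\<close> with weight \<open>\<kappa>\<close>, which cancels.\<close>

lemma oscillation_contracts:
  assumes \<eta>: "\<And>s. s \<in> I \<Longrightarrow> 0 \<le> \<eta> s \<and> \<eta> s \<le> 1" "\<And>s. s \<in> I \<Longrightarrow> s \<le> r - d \<Longrightarrow> \<eta> s = 0"
    and \<kappa>: "0 < \<kappa>" "\<kappa> \<le> 1" "\<And>s. s \<in> I \<Longrightarrow> \<kappa> \<le> (T ^^ k) \<eta> s" and d: "0 < d"
    and c: "controlled \<phi> \<psi> e w" and st: "s \<in> I" "t \<in> I"
  shows "(T ^^ k) \<phi> s - (T ^^ k) \<phi> t \<le> (1 - \<kappa>) * w + 2 * \<kappa> * d * e"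
proof -
  note D = controlledD[OF c]
  have cont: "continuous_on I \<phi>" by (rule DERIV_continuous_on[OF D(1)])
  obtain x where x: "x \<in> I" "\<And>u. u \<in> I \<Longrightarrow> \<phi> x \<le> \<phi> u"
    using continuous_attains_inf[OF _ I_ne cont] by auto
  obtain y where y: "y \<in> I" "\<And>u. u \<in> I \<Longrightarrow> \<phi> u \<le> \<phi> y"
    using continuous_attains_sup[OF _ I_ne cont] by auto
  have near: "\<bar>\<phi> u - \<phi> r\<bar> \<le> d * e" if "u \<in> I" "r - d < u" for u
  proof -
    have "\<bar>\<phi> u - \<phi> r\<bar> \<le> e * \<bar>u - r\<bar>" by (rule increment_bound_within[OF D(1,2) that(1) r_mem])
    also have "\<dots> \<le> e * d" using that D(4) by (intro mult_left_mono) auto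
    finally show ?thesis by (simp add: mult.commute)
  qed
  have "(1 - \<kappa>) * \<phi> x + \<kappa> * (\<phi> r - d * e) \<le> (T ^^ k) \<phi> t"
    by (rule T_pow_lower[OF \<eta> \<kappa>(1,3) x(2) _ st(2)]) (use near in \<open>force simp: abs_le_iff\<close>)+
  \<comment> \<open>The negative is written as \<open>0 + -1 * \<phi> s\<close>, so that
    \<open>T_pow_affine\<close> leads back to \<open>\<phi>\<close>.\<close>
  moreover have "(1 - \<kappa>) * - \<phi> y + \<kappa> * (- \<phi> r - d * e) \<le> (T ^^ k) (\<lambda>s. 0 + -1 * \<phi> s) s"
    by (rule T_pow_lower[OF \<eta> \<kappa>(1,3) _ _ st(1)]) (use near y(2) in \<open>force simp: abs_le_iff\<close>)+
  moreover have "(1 - \<kappa>) * (\<phi> y - \<phi> x) \<le> (1 - \<kappa>) * w"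
    using D(3)[OF y(1) x(1)] \<kappa> by (intro mult_left_mono) auto
  ultimately show ?thesis unfolding T_pow_affine by (simp add: algebra_simps)
qed

text \<open>One block replaces \<open>e\<close> by \<open>q * e + C * w\<close> and \<open>w\<close>
  by \<open>(1 - \<kappa>) * w + 2 * \<kappa> * d * e\<close>. In \<open>e + \<Lambda> * w\<close>
  the relation \<open>\<Lambda> * \<kappa> = 2 * C\<close> absorbs \<open>C * w\<close> and leaves
  the factor \<open>1 - \<kappa> / 2\<close> for \<open>\<Lambda> * w\<close>, while
  \<open>C * d = (1 - q) / 8\<close> makes the feedback
  \<open>2 * \<Lambda> * \<kappa> * d * e\<close> equal to \<open>(1 - q) / 2 * e\<close>, which
  leaves \<open>(1 + q) / 2\<close> for \<open>e\<close>.\<close>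

lemma contraction:
  obtains P \<rho> \<Lambda> where "0 < P" "0 < \<rho>" "\<rho> < 1" "M \<le> \<Lambda>"
    "\<And>\<phi> \<psi> e w. controlled \<phi> \<psi> e w \<Longrightarrow>
       \<exists>e' w'. controlled ((T ^^ P) \<phi>) (dT P \<phi> \<psi>) e' w' \<and> e' + \<Lambda> * w' \<le> \<rho> * (e + \<Lambda> * w)"
proof -
  obtain p q where p: "0 < p" and q: "0 \<le> q" "q < 1"
    and pq: "\<And>s. s \<in> I \<Longrightarrow> (S ^^ p) (\<lambda>_. 1) s \<le> q"
    using S_pow_contracts by metis
  \<comment> \<open>The first summand gives \<open>p * M \<le> (1 - q) * C\<close>; the others make
    \<open>C\<close> positive and at least \<open>M\<close>, which yields
    \<open>M \<le> \<Lambda>\<close> below.\<close>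
  define C where "C = p * M / (1 - q) + M + 1"
  have "(1 - q) * C = p * M + (1 - q) * (M + 1)"
    using q by (simp add: C_def distrib_left add.assoc)
  then have C1: "p * M \<le> (1 - q) * C" using q M_nonneg by simp
  have C2: "0 < C" "M \<le> C" using q M_nonneg by (auto simp: C_def intro!: add_nonneg_pos add_nonneg_nonneg)
  define d where "d = (1 - q) / (8 * C)"
  have d: "0 < d" using q C2 by (simp add: d_def)
  obtain N \<eta> where \<eta>: "\<And>s. s \<in> I \<Longrightarrow> 0 \<le> \<eta> s \<and> \<eta> s \<le> 1" "\<And>s. s \<in> I \<Longrightarrow> s \<le> r - d \<Longrightarrow> \<eta> s = 0"
    and N: "\<And>k. N \<le> k \<Longrightarrow> \<exists>\<kappa>>0. \<kappa> \<le> 1 \<and> (\<forall>s\<in>I. \<kappa> \<le> (T ^^ k) \<eta> s)"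
    using T_pow_minorization[OF d] by metis
  \<comment> \<open>A multiple of \<open>p\<close>, so that the derivative bound applies, and at
    least \<open>N\<close>, so that the minorization applies.\<close>
  define P where "P = Suc N * p"
  have "N \<le> P" using p by (cases p) (auto simp: P_def)
  with N obtain \<kappa> where \<kappa>: "0 < \<kappa>" "\<kappa> \<le> 1" "\<And>s. s \<in> I \<Longrightarrow> \<kappa> \<le> (T ^^ P) \<eta> s" by metis
  define \<Lambda> where "\<Lambda> = 2 * C / \<kappa>"
  have \<Lambda>: "\<Lambda> * \<kappa> = 2 * C" using \<kappa> by (simp add: \<Lambda>_def)
  have "2 * C \<le> \<Lambda>" using \<kappa> C2 by (simp add: \<Lambda>_def field_simps)
  then have M\<Lambda>: "M \<le> \<Lambda>" "0 < \<Lambda>" using C2 by auto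
  define \<rho> where "\<rho> = max ((1 + q) / 2) (1 - \<kappa> / 2)"
  show ?thesis
  proof (rule that[of P \<rho> \<Lambda>])
    show "0 < P" using p by (simp add: P_def)
    show "0 < \<rho>" "\<rho> < 1" using q \<kappa> by (auto simp: \<rho>_def less_max_iff_disj)
    show "M \<le> \<Lambda>" by fact
    fix \<phi> \<psi> e w assume c: "controlled \<phi> \<psi> e w"
    note D = controlledD[OF c]
    have "controlled ((T ^^ P) \<phi>) (dT P \<phi> \<psi>) (q * e + C * w) ((1 - \<kappa>) * w + 2 * \<kappa> * d * e)"
    proof (rule controlledI)
      show "((T ^^ P) \<phi> has_real_derivative dT P \<phi> \<psi> s) (at s within I)" if "s \<in> I" for s
        by (rule T_pow_deriv[OF D(1) that])
      show "\<bar>dT P \<phi> \<psi> s\<bar> \<le> q * e + C * w" if "s \<in> I" for s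
        unfolding P_def by (rule dT_bound_multiple[OF pq q C1 c that])
      show "(T ^^ P) \<phi> s - (T ^^ P) \<phi> t \<le> (1 - \<kappa>) * w + 2 * \<kappa> * d * e" if "s \<in> I" "t \<in> I" for s t
        by (rule oscillation_contracts[OF \<eta> \<kappa> d c that])
    qed
    moreover have "q * e + C * w + \<Lambda> * ((1 - \<kappa>) * w + 2 * \<kappa> * d * e) \<le> \<rho> * (e + \<Lambda> * w)"
    proof -
      have "C * d = (1 - q) / 8" using C2 by (simp add: d_def)
      then have "q * e + C * w + \<Lambda> * ((1 - \<kappa>) * w + 2 * \<kappa> * d * e) = (1 + q) / 2 * e + (\<Lambda> - \<Lambda> * \<kappa> / 2) * w"
        using \<Lambda> by (simp add: algebra_simps) algebra
      also have "\<dots> = (1 + q) / 2 * e + (1 - \<kappa> / 2) * (\<Lambda> * w)" by (simp add: algebra_simps)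
      also have "\<dots> \<le> \<rho> * e + \<rho> * (\<Lambda> * w)"
        using D(4,5) M\<Lambda> by (intro add_mono mult_right_mono) (auto simp: \<rho>_def)
      finally show ?thesis by (simp add: algebra_simps)
    qed
    ultimately show "\<exists>e' w'. controlled ((T ^^ P) \<phi>) (dT P \<phi> \<psi>) e' w' \<and>
        e' + \<Lambda> * w' \<le> \<rho> * (e + \<Lambda> * w)" by blast
  qed
qed

text \<open>The weighted sum contracts once per block of \<open>P\<close> iterations. The fewer than
  \<open>P\<close> iterations left over add at most \<open>M * w'\<close> each, and
  \<open>M \<le> \<Lambda>\<close> lets the weighted sum of the last full block pay for
  them.\<close>

lemma derivative_decay:
  assumes c: "controlled \<phi> \<psi> e w"
  obtains B where "summable B" "\<And>k s. s \<in> I \<Longrightarrow> \<bar>dT k \<phi> \<psi> s\<bar> \<le> B k"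
proof -
  obtain P \<rho> \<Lambda> where P: "0 < P" and \<rho>: "0 < \<rho>" "\<rho> < 1" and \<Lambda>: "M \<le> \<Lambda>"
    and con: "\<And>\<phi> \<psi> e w. controlled \<phi> \<psi> e w \<Longrightarrow>
       \<exists>e' w'. controlled ((T ^^ P) \<phi>) (dT P \<phi> \<psi>) e' w' \<and> e' + \<Lambda> * w' \<le> \<rho> * (e + \<Lambda> * w)"
    using contraction by metis
  define V where "V = e + \<Lambda> * w"
  have blocks: "\<exists>e' w'. controlled ((T ^^ (P * j)) \<phi>) (dT (P * j) \<phi> \<psi>) e' w' \<and> e' + \<Lambda> * w' \<le> \<rho> ^ j * V" for j
  proof (induction j)
    case 0
    then show ?case using c by (auto simp: V_def)
  next
    case (Suc j)
    then obtain e' w' where 1: "controlled ((T ^^ (P * j)) \<phi>) (dT (P * j) \<phi> \<psi>) e' w'"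
      and 2: "e' + \<Lambda> * w' \<le> \<rho> ^ j * V" by blast
    from con[OF 1] obtain e'' w'' where
      3: "controlled ((T ^^ P) ((T ^^ (P * j)) \<phi>)) (dT P ((T ^^ (P * j)) \<phi>) (dT (P * j) \<phi> \<psi>)) e'' w''"
      and 4: "e'' + \<Lambda> * w'' \<le> \<rho> * (e' + \<Lambda> * w')" by blast
    have eq: "(T ^^ P) ((T ^^ (P * j)) \<phi>) = (T ^^ (P * Suc j)) \<phi>"
      by (simp add: funpow_add)
    have "dT P ((T ^^ (P * j)) \<phi>) (dT (P * j) \<phi> \<psi>) = dT (P * Suc j) \<phi> \<psi>"
      by (simp add: dT_add[symmetric] add.commute)
    moreover have "\<rho> * (e' + \<Lambda> * w') \<le> \<rho> * (\<rho> ^ j * V)" using 2 \<rho> by (intro mult_left_mono) auto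
    ultimately show ?case using 3 4 eq by (intro exI[of _ e''] exI[of _ w'']) (simp add: mult.assoc)
  qed
  have "\<bar>dT k \<phi> \<psi> s\<bar> \<le> P * V * \<rho> ^ (k div P)" if s: "s \<in> I" for k s
  proof -
    obtain e' w' where 1: "controlled ((T ^^ (P * (k div P))) \<phi>) (dT (P * (k div P)) \<phi> \<psi>) e' w'"
      and 2: "e' + \<Lambda> * w' \<le> \<rho> ^ (k div P) * V" using blocks by blast
    note D = controlledD[OF 1]
    have "dT k \<phi> \<psi> = dT (k mod P) ((T ^^ (P * (k div P))) \<phi>) (dT (P * (k div P)) \<phi> \<psi>)"
      by (simp flip: dT_add)
    then have "\<bar>dT k \<phi> \<psi> s\<bar> \<le> e' + (k mod P) * (M * w')"
      using controlledD(2)[OF controlled_iterate[OF 1] s] by simp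
    also have "\<dots> \<le> P * e' + P * (\<Lambda> * w')"
    proof (intro add_mono mult_mono)
      have "1 * e' \<le> P * e'" using P D(4) by (intro mult_right_mono) auto
      then show "e' \<le> P * e'" by simp
    qed (use P D \<Lambda> M_nonneg in \<open>auto simp: less_imp_le\<close>)
    also have "\<dots> = P * (e' + \<Lambda> * w')" by (simp add: algebra_simps)
    also have "\<dots> \<le> P * (\<rho> ^ (k div P) * V)" using 2 by (intro mult_left_mono) auto
    finally show ?thesis by (simp add: algebra_simps)
  qed
  then show ?thesis
    using that[of "\<lambda>k. P * V * \<rho> ^ (k div P)"] summable_mult[OF summable_power_div[OF P \<rho>]] by blast
qed

lemma controlled_exists:
  assumes d: "\<And>s. s \<in> I \<Longrightarrow> (\<phi> has_real_derivative \<psi> s) (at s within I)" and c: "continuous_on I \<psi>"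
  obtains e w where "controlled \<phi> \<psi> e w"
proof -
  have "compact (\<psi> ` I)" by (rule compact_continuous_image[OF c]) simp
  then have "bounded (\<psi> ` I)" by (rule compact_imp_bounded)
  then obtain e where "\<forall>s\<in>I. \<bar>\<psi> s\<bar> \<le> e" unfolding bounded_iff by auto
  then have e: "\<bar>\<psi> s\<bar> \<le> e" if "s \<in> I" for s using that by blast
  have e0: "0 \<le> e" using e[OF r_mem] by linarith
  have "\<phi> s - \<phi> t \<le> e * (r - l)" if "s \<in> I" "t \<in> I" for s t
  proof -
    have "\<bar>\<phi> s - \<phi> t\<bar> \<le> e * \<bar>s - t\<bar>" by (rule increment_bound_within[OF d e that])
    also have "\<dots> \<le> e * (r - l)" using that e0 by (intro mult_left_mono) auto
    finally show ?thesis by linarith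
  qed
  then show ?thesis by (intro that[of e "e * (r - l)"] controlledI d e)
qed

text \<open>\<open>F1\<close> is a fixed point of \<open>T\<close>, so its derivative
  \<open>F2\<close> equals \<open>dT k F1 F2\<close> for every \<open>k\<close>, and these tend to
  0.\<close>

theorem homogeneous_solution_affine:
  assumes F: "\<And>s. s \<in> I \<Longrightarrow> (F has_real_derivative F1 s) (at s within I)"
    and F1: "\<And>s. s \<in> I \<Longrightarrow> (F1 has_real_derivative F2 s) (at s within I)"
    and F2: "continuous_on I F2"
    and eq: "\<And>s. s \<in> I \<Longrightarrow> F s = F (a s) + F (b s)" and s: "s \<in> I"
  shows "F2 s = 0"
proof -
  have lr: "l < r" using l r by simp
  have T1: "T F1 s = F1 s" if s: "s \<in> I" for s
  proof -
    have "((\<lambda>s. F (a s) + F (b s)) has_real_derivative F1 (a s) * da s + F1 (b s) * (1 - da s)) (at s within I)"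
      by (intro DERIV_add compose_deriv[OF F] s)
    then have "(F has_real_derivative F1 (a s) * da s + F1 (b s) * (1 - da s)) (at s within I)"
      by (rule has_field_derivative_transform_within[OF _ zero_less_one s]) (simp add: eq)
    from within_derivative_unique[OF lr s F[OF s] this] show ?thesis by (simp add: T_def mult.commute)
  qed
  have T2: "S F2 s + dda s * (F1 (a s) - F1 (b s)) = F2 s" if s: "s \<in> I" for s
  proof -
    have "(F1 has_real_derivative S F2 s + dda s * (F1 (a s) - F1 (b s))) (at s within I)"
      by (rule has_field_derivative_transform_within[OF T_deriv[OF F1 s] zero_less_one s]) (assumption, rule T1)
    from within_derivative_unique[OF lr s this F1[OF s]] show ?thesis .
  qed
  have Tk: "(T ^^ k) F1 s = F1 s" if "s \<in> I" for k s
    using that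
  proof (induction k arbitrary: s)
    case (Suc k)
    show ?case
      unfolding T_pow_Suc Suc.IH[OF a_mem[OF Suc.prems]] Suc.IH[OF b_mem[OF Suc.prems]]
      by (rule T1[OF Suc.prems, unfolded T_def])
  qed simp
  have dk: "dT k F1 F2 s = F2 s" if "s \<in> I" for k s
    using that
  proof (induction k arbitrary: s)
    case (Suc k)
    have "dT (Suc k) F1 F2 s = S F2 s + dda s * (F1 (a s) - F1 (b s))"
      unfolding dT.simps S_def Tk[OF a_mem[OF Suc.prems]] Tk[OF b_mem[OF Suc.prems]]
        Suc.IH[OF a_mem[OF Suc.prems]] Suc.IH[OF b_mem[OF Suc.prems]] ..
    then show ?case using T2[OF Suc.prems] by simp
  qed simp
  obtain e w where "controlled F1 F2 e w" using controlled_exists[OF F1 F2] by metis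
  then obtain B where B: "summable B" "\<And>k s. s \<in> I \<Longrightarrow> \<bar>dT k F1 F2 s\<bar> \<le> B k"
    using derivative_decay by metis
  have "\<bar>F2 s\<bar> \<le> 0"
    by (rule LIMSEQ_le_const[OF summable_LIMSEQ_zero[OF B(1)]]) (use B(2)[OF s] dk[OF s] in auto)
  then show ?thesis by simp
qed

text \<open>The iterates \<open>T^k h0\<close> tend to a constant that is not yet known to be 0, so
  the series is formed from their increments against the point \<open>r\<close>, whose derivatives
  are summable. It solves the differentiated equation up to this constant, and the boundary values
  of \<open>H\<close> show that the constant is 0.\<close>

theorem solution_exists:
  assumes H: "\<And>s. s \<in> I \<Longrightarrow> (H has_real_derivative h0 s) (at s within I)"
    and h0: "\<And>s. s \<in> I \<Longrightarrow> (h0 has_real_derivative h1 s) (at s within I)"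
    and h1: "continuous_on I h1" and Hl: "H l = 0" and Hr: "H r = 0"
  obtains F F1 F2 where "\<And>s. s \<in> I \<Longrightarrow> (F has_real_derivative F1 s) (at s within I)"
    "\<And>s. s \<in> I \<Longrightarrow> (F1 has_real_derivative F2 s) (at s within I)" "continuous_on I F2" "F 0 = 0"
    "\<And>s. s \<in> I \<Longrightarrow> F s - F (a s) - F (b s) = H s"
proof -
  obtain e w where "controlled h0 h1 e w" using controlled_exists[OF h0 h1] by metis
  then obtain B where B: "summable B" "\<And>k s. s \<in> I \<Longrightarrow> \<bar>dT k h0 h1 s\<bar> \<le> B k"
    using derivative_decay by metis
  define F2 where "F2 s = (\<Sum>k. dT k h0 h1 s)" for s
  have unif: "uniform_limit I (\<lambda>n s. \<Sum>k<n. dT k h0 h1 s) F2 sequentially"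
    unfolding F2_def by (rule Weierstrass_m_test[OF _ B(1)]) (use B(2) in simp)
  have c0: "continuous_on I h0" by (rule DERIV_continuous_on[OF h0])
  have F2: "continuous_on I F2"
    by (rule uniform_limit_theorem[OF _ unif])
       (auto intro!: always_eventually continuous_on_sum cont_dT c0 h1)
  have "\<exists>g. \<forall>s\<in>I. (\<lambda>k. (T ^^ k) h0 s - (T ^^ k) h0 r) sums g s \<and> (g has_field_derivative F2 s) (at s within I)"
  proof (rule has_field_derivative_series[OF _ _ unif r_mem])
    fix n s assume "s \<in> I"
    then show "((\<lambda>s. (T ^^ n) h0 s - (T ^^ n) h0 r) has_real_derivative dT n h0 h1 s) (at s within I)"
      using DERIV_diff[OF T_pow_deriv[OF h0] DERIV_const] by simp
  qed auto
  then obtain F1 where F1: "\<And>s. s \<in> I \<Longrightarrow> (\<lambda>k. (T ^^ k) h0 s - (T ^^ k) h0 r) sums F1 s"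
    and F1d: "\<And>s. s \<in> I \<Longrightarrow> (F1 has_real_derivative F2 s) (at s within I)" by blast
  \<comment> \<open>Applying \<open>T\<close> to the series advances the iterates by one and keeps
    the subtracted constants. The difference of the two series telescopes, which yields the limit of
    \<open>T^k h0\<close>.\<close>
  have lim: "(\<lambda>k. (T ^^ k) h0 s) \<longlonglongrightarrow> h0 s - (F1 s - T F1 s)" if s: "s \<in> I" for s
  proof -
    have "(\<lambda>k. da s * ((T ^^ k) h0 (a s) - (T ^^ k) h0 r) + (1 - da s) * ((T ^^ k) h0 (b s) - (T ^^ k) h0 r))
        sums T F1 s"
      unfolding T_def[of F1] by (intro sums_add sums_mult F1 a_mem b_mem s)
    then have "(\<lambda>k. (T ^^ Suc k) h0 s - (T ^^ k) h0 r) sums T F1 s"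
      by (simp only: T_pow_Suc) (simp add: algebra_simps)
    from sums_diff[OF F1[OF s] this]
    have "(\<lambda>k. (T ^^ k) h0 s - (T ^^ Suc k) h0 s) sums (F1 s - T F1 s)" by (simp del: funpow.simps)
    then have "(\<lambda>n. \<Sum>k<n. (T ^^ k) h0 s - (T ^^ Suc k) h0 s) \<longlonglongrightarrow> F1 s - T F1 s"
      unfolding sums_def .
    moreover have "(\<Sum>k<n. (T ^^ k) h0 s - (T ^^ Suc k) h0 s) = h0 s - (T ^^ n) h0 s" for n
      using sum_lessThan_telescope'[of "\<lambda>k. (T ^^ k) h0 s" n] by simp
    ultimately have "(\<lambda>n. h0 s - (T ^^ n) h0 s) \<longlonglongrightarrow> F1 s - T F1 s" by simp
    from tendsto_diff[OF tendsto_const[of "h0 s"] this] show ?thesis by simp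
  qed
  define c where "c = h0 r - (F1 r - T F1 r)"
  have F1T: "F1 s - T F1 s = h0 s - c" if s: "s \<in> I" for s
  proof -
    have "(\<lambda>k. (T ^^ k) h0 s - (T ^^ k) h0 r) \<longlonglongrightarrow> h0 s - (F1 s - T F1 s) - c"
      unfolding c_def by (intro tendsto_diff[OF lim[OF s] lim[OF r_mem]])
    moreover have "(\<lambda>k. (T ^^ k) h0 s - (T ^^ k) h0 r) \<longlonglongrightarrow> 0"
      by (rule summable_LIMSEQ_zero[OF sums_summable[OF F1[OF s]]])
    ultimately have "h0 s - (F1 s - T F1 s) - c = 0" by (rule LIMSEQ_unique)
    then show ?thesis by simp
  qed
  obtain G where G: "\<And>s. s \<in> I \<Longrightarrow> (G has_real_derivative F1 s) (at s within I)"
    using antiderivative_continuous[OF DERIV_continuous_on[OF F1d]]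
    unfolding has_real_derivative_iff_has_vector_derivative by metis
  define F where "F s = G s - G 0" for s
  have Fd: "(F has_real_derivative F1 s) (at s within I)" if "s \<in> I" for s
    unfolding F_def[abs_def] using DERIV_diff[OF G[OF that] DERIV_const] by simp
  \<comment> \<open>The term \<open>c * s\<close> compensates the defect, so \<open>E\<close> is
    constant. As \<open>a l = 0\<close>, \<open>b l = l\<close>, \<open>a r = r\<close> and
    \<open>b r = 0\<close>, its end values are \<open>c * l\<close> and \<open>c * r\<close>, and
    their equality gives \<open>c = 0\<close>.\<close>
  define E where "E s = F s - F (a s) - F (b s) - H s + c * s" for s
  have "(E has_real_derivative 0) (at s within I)" if s: "s \<in> I" for s
  proof -
    have "(E has_real_derivative F1 s - F1 (a s) * da s - F1 (b s) * (1 - da s) - h0 s + c * 1) (at s within I)"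
      unfolding E_def[abs_def]
      by (intro DERIV_add DERIV_diff Fd s compose_deriv[OF Fd] H DERIV_cmult DERIV_ident)
    moreover have "F1 s - F1 (a s) * da s - F1 (b s) * (1 - da s) - h0 s + c * 1 = 0"
      using F1T[OF s] unfolding T_def by (simp add: algebra_simps)
    ultimately show ?thesis by simp
  qed
  then have "\<exists>k. \<forall>s\<in>I. E s = k"
    by (intro has_field_derivative_zero_constant) auto
  then have const: "E s = E l" if "s \<in> I" for s using that l_mem by metis
  have F0: "F 0 = 0" by (simp add: F_def)
  have El: "E l = c * l" using Hl a_l F0 by (simp add: E_def b_def)
  moreover have "E r = c * r" using Hr a_r F0 by (simp add: E_def b_def)
  ultimately have "c * l = c * r" using const[OF r_mem] by simp
  then have "c = 0" using l r by simp
  then have "F s - F (a s) - F (b s) = H s" if "s \<in> I" for s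
    using const[OF that] El by (simp add: E_def)
  then show ?thesis using that Fd F1d F2 F0 by metis
qed

end

section \<open>Geometry of the curvilinear triangle\<close>

lemma C2_intervalI:
  fixes f :: "real \<Rightarrow> real"
  assumes "\<And>t. t \<in> {a..b} \<Longrightarrow> (f has_real_derivative f' t) (at t within {a..b})"
    "\<And>t. t \<in> {a..b} \<Longrightarrow> (f' has_real_derivative f'' t) (at t within {a..b})"
    "continuous_on {a..b} f''"
  shows "C2_interval a b f"
  unfolding C2_interval_def has_real_derivative_iff_has_vector_derivative[symmetric]
  using assms by blast

lemma C2_intervalE:
  fixes f :: "real \<Rightarrow> real"
  assumes "C2_interval a b f"
  obtains f' f'' where "\<And>t. t \<in> {a..b} \<Longrightarrow> (f has_real_derivative f' t) (at t within {a..b})"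
    "\<And>t. t \<in> {a..b} \<Longrightarrow> (f' has_real_derivative f'' t) (at t within {a..b})"
    "continuous_on {a..b} f''"
  using assms unfolding C2_interval_def has_real_derivative_iff_has_vector_derivative[symmetric]
  by blast

lemma C2_interval_const [simp]: "C2_interval a b (\<lambda>_. c :: real)"
  by (rule C2_intervalI[where f' = "\<lambda>_. 0" and f'' = "\<lambda>_. 0"]) auto

lemma C2_interval_ident [simp]: "C2_interval a b (\<lambda>t. t :: real)"
  by (rule C2_intervalI[where f' = "\<lambda>_. 1" and f'' = "\<lambda>_. 0"]) auto

lemma C2_interval_add:
  fixes f g :: "real \<Rightarrow> real"
  assumes "C2_interval a b f" "C2_interval a b g"
  shows "C2_interval a b (\<lambda>t. f t + g t)"
proof -
  obtain f' f'' g' g'' where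
    f: "\<And>t. t \<in> {a..b} \<Longrightarrow> (f has_real_derivative f' t) (at t within {a..b})"
    "\<And>t. t \<in> {a..b} \<Longrightarrow> (f' has_real_derivative f'' t) (at t within {a..b})" "continuous_on {a..b} f''"
    and g: "\<And>t. t \<in> {a..b} \<Longrightarrow> (g has_real_derivative g' t) (at t within {a..b})"
    "\<And>t. t \<in> {a..b} \<Longrightarrow> (g' has_real_derivative g'' t) (at t within {a..b})" "continuous_on {a..b} g''"
    using assms by (elim C2_intervalE) blast
  show ?thesis
    by (rule C2_intervalI[where f' = "\<lambda>t. f' t + g' t" and f'' = "\<lambda>t. f'' t + g'' t"])
       (intro DERIV_add f g continuous_intros; assumption)+
qed

lemma C2_interval_cmult:
  fixes f :: "real \<Rightarrow> real"
  assumes "C2_interval a b f"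
  shows "C2_interval a b (\<lambda>t. c * f t)"
proof -
  obtain f' f'' where
    f: "\<And>t. t \<in> {a..b} \<Longrightarrow> (f has_real_derivative f' t) (at t within {a..b})"
    "\<And>t. t \<in> {a..b} \<Longrightarrow> (f' has_real_derivative f'' t) (at t within {a..b})" "continuous_on {a..b} f''"
    using assms by (elim C2_intervalE) blast
  show ?thesis
    by (rule C2_intervalI[where f' = "\<lambda>t. c * f' t" and f'' = "\<lambda>t. c * f'' t"])
       (intro DERIV_cmult f continuous_intros; assumption)+
qed

lemma C2_interval_diff:
  fixes f g :: "real \<Rightarrow> real"
  assumes "C2_interval a b f" "C2_interval a b g"
  shows "C2_interval a b (\<lambda>t. f t - g t)"
  using C2_interval_add[OF assms(1) C2_interval_cmult[OF assms(2), of "-1"]] by simp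

lemma C2_interval_compose:
  fixes f h :: "real \<Rightarrow> real"
  assumes "C2_interval c d f" "C2_interval a b h" and im: "h ` {a..b} \<subseteq> {c..d}"
  shows "C2_interval a b (\<lambda>t. f (h t))"
proof -
  obtain f' f'' h' h'' where
    f: "\<And>t. t \<in> {c..d} \<Longrightarrow> (f has_real_derivative f' t) (at t within {c..d})"
    "\<And>t. t \<in> {c..d} \<Longrightarrow> (f' has_real_derivative f'' t) (at t within {c..d})" "continuous_on {c..d} f''"
    and h: "\<And>t. t \<in> {a..b} \<Longrightarrow> (h has_real_derivative h' t) (at t within {a..b})"
    "\<And>t. t \<in> {a..b} \<Longrightarrow> (h' has_real_derivative h'' t) (at t within {a..b})" "continuous_on {a..b} h''"
    using assms by (elim C2_intervalE) blast
  have mem: "h t \<in> {c..d}" if "t \<in> {a..b}" for t using that im by blast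
  have chain: "((\<lambda>t. k (h t)) has_real_derivative k' (h t) * h' t) (at t within {a..b})"
    if "\<And>t. t \<in> {c..d} \<Longrightarrow> (k has_real_derivative k' t) (at t within {c..d})" "t \<in> {a..b}" for k k' t
    using DERIV_image_chain[OF DERIV_subset[OF that(1)[OF mem[OF that(2)]] im] h(1)[OF that(2)]]
    unfolding comp_def .
  have ch: "continuous_on {a..b} h" "continuous_on {a..b} h'" "continuous_on {c..d} f'"
    by (rule DERIV_continuous_on, erule f h)+
  show ?thesis
  proof (rule C2_intervalI)
    show "((\<lambda>t. f (h t)) has_real_derivative f' (h t) * h' t) (at t within {a..b})" if "t \<in> {a..b}" for t
      by (rule chain[OF f(1) that])
    show "((\<lambda>t. f' (h t) * h' t) has_real_derivative f'' (h t) * h' t * h' t + h'' t * f' (h t)) (at t within {a..b})"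
      if "t \<in> {a..b}" for t
      by (rule DERIV_cong[OF DERIV_mult'[OF chain[OF f(2) that] h(2)[OF that]]]) simp_all
    show "continuous_on {a..b} (\<lambda>t. f'' (h t) * h' t * h' t + h'' t * f' (h t))"
      by (intro continuous_on_add continuous_on_mult ch h(3) continuous_on_compose2[OF f(3) ch(1) im]
          continuous_on_compose2[OF ch(3) ch(1) im])
  qed
qed

lemma increasing_within:
  fixes f :: "real \<Rightarrow> real"
  assumes f: "\<And>s. s \<in> {l..r} \<Longrightarrow> (f has_real_derivative f' s) (at s within {l..r})"
    and e: "\<And>s. s \<in> {l..r} \<Longrightarrow> 0 < f' s" and s: "s \<in> {l..r}" "t \<in> {l..r}" "s < t"
  shows "f s < f t"
proof (rule DERIV_pos_imp_increasing_open[OF s(3)])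
  fix x assume x: "s < x" "x < t"
  then have "at x within {l..r} = at x" using s by (auto intro!: at_within_interior)
  with f[of x] e[of x] x s show "\<exists>y. (f has_real_derivative y) (at x) \<and> 0 < y" by auto
next
  show "continuous_on {s..t} f"
    using DERIV_continuous_on[of "{l..r}" f f'] f s by (auto intro: continuous_on_subset)
qed

text \<open>\<open>C2_interval\<close> hides the derivatives behind an existential, so positivity is
  required of every derivative value of \<open>h\<close>. The derivative of the inverse is
  \<open>1 / h' (g s)\<close>, which is differentiable with a continuous derivative because
  \<open>h'\<close> has no zero.\<close>

lemma C2_interval_inverse:
  fixes h g :: "real \<Rightarrow> real"
  assumes h: "C2_interval c d h"
    and pos: "\<And>z y. z \<in> {c..d} \<Longrightarrow> (h has_real_derivative y) (at z within {c..d}) \<Longrightarrow> 0 < y"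
    and g: "\<And>z. z \<in> {c..d} \<Longrightarrow> g (h z) = z" and im: "h ` {c..d} = {a..b}"
  shows "C2_interval a b g"
    and "\<And>z y. z \<in> {c..d} \<Longrightarrow> (h has_real_derivative y) (at z within {c..d}) \<Longrightarrow>
       (g has_real_derivative 1 / y) (at (h z) within {a..b})"
proof -
  obtain h' h'' where
    h: "\<And>t. t \<in> {c..d} \<Longrightarrow> (h has_real_derivative h' t) (at t within {c..d})"
    "\<And>t. t \<in> {c..d} \<Longrightarrow> (h' has_real_derivative h'' t) (at t within {c..d})" "continuous_on {c..d} h''"
    using assms(1) by (elim C2_intervalE) blast
  have p: "0 < h' z" if "z \<in> {c..d}" for z using pos[OF that h(1)[OF that]] .
  have ch: "continuous_on {c..d} h" "continuous_on {c..d} h'"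
    by (rule DERIV_continuous_on, erule h)+
  have cg: "continuous_on {a..b} g"
    using continuous_on_inv[OF ch(1)] g im by auto
  have mem: "h z \<in> {a..b}" if "z \<in> {c..d}" for z using im that by blast
  have deriv: "(g has_real_derivative 1 / y) (at (h z) within {a..b})"
    if z: "z \<in> {c..d}" and y: "(h has_real_derivative y) (at z within {c..d})" for z y
  proof -
    have "y \<noteq> 0" using pos[OF z y] by simp
    have "(g has_derivative (\<lambda>x. x / y)) (at (h z) within h ` {c..d})"
    proof (rule has_derivative_inverse_within)
      show "(h has_derivative (*) y) (at z within {c..d})"
        using y by (simp add: has_field_derivative_def)
      show "continuous (at (h z) within h ` {c..d}) g"
        using cg mem[OF z] unfolding im continuous_on_eq_continuous_within by blast
      show "linear (\<lambda>x. x / y)" by (intro linearI) (simp_all add: add_divide_distrib)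
    qed (use z g \<open>y \<noteq> 0\<close> in auto)
    moreover have "(\<lambda>x. x / y) = (*) (1 / y)" by auto
    ultimately show ?thesis unfolding im has_field_derivative_def by simp
  qed
  show "\<And>z y. z \<in> {c..d} \<Longrightarrow> (h has_real_derivative y) (at z within {c..d}) \<Longrightarrow>
       (g has_real_derivative 1 / y) (at (h z) within {a..b})" by (rule deriv)
  have inv: "g s \<in> {c..d} \<and> h (g s) = s" if "s \<in> {a..b}" for s
  proof -
    from that have "s \<in> h ` {c..d}" unfolding im .
    then obtain z where z: "z \<in> {c..d}" "s = h z" by (elim imageE) simp
    then show ?thesis using g[OF z(1)] by simp
  qed
  have d1: "(g has_real_derivative 1 / h' (g s)) (at s within {a..b})" if s: "s \<in> {a..b}" for s
    using deriv[of "g s"] inv[OF s] h(1) by metis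
  have gi: "g ` {a..b} \<subseteq> {c..d}" using inv by blast
  have d2: "((\<lambda>s. h' (g s)) has_real_derivative h'' (g s) * (1 / h' (g s))) (at s within {a..b})"
    if s: "s \<in> {a..b}" for s
    using DERIV_image_chain[OF DERIV_subset[OF h(2)[of "g s"] gi] d1[OF s]] inv[OF s]
    unfolding comp_def by blast
  show "C2_interval a b g"
  proof (rule C2_intervalI)
    show "(g has_real_derivative 1 / h' (g s)) (at s within {a..b})" if "s \<in> {a..b}" for s
      by (rule d1[OF that])
    show "((\<lambda>s. 1 / h' (g s)) has_real_derivative - (h'' (g s) * (1 / h' (g s))) / (h' (g s))\<^sup>2) (at s within {a..b})"
      if s: "s \<in> {a..b}" for s
    proof -
      have "h' (g s) \<noteq> 0" using p[of "g s"] inv[OF s] by simp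
      from DERIV_inverse_fun[OF d2[OF s] this] show ?thesis
        by (simp add: inverse_eq_divide power2_eq_square)
    qed
    have "continuous_on {a..b} (\<lambda>s. h'' (g s))" "continuous_on {a..b} (\<lambda>s. h' (g s))"
      by (rule continuous_on_compose2[OF h(3) cg gi], rule continuous_on_compose2[OF ch(2) cg gi])
    moreover have "\<forall>s\<in>{a..b}. h' (g s) \<noteq> 0" using p inv by fastforce
    ultimately show "continuous_on {a..b} (\<lambda>s. - (h'' (g s) * (1 / h' (g s))) / (h' (g s))\<^sup>2)"
      by (intro continuous_on_divide continuous_on_minus continuous_on_mult continuous_on_power continuous_on_const) auto
  qed
qed

text \<open>A connected subset of the union that meets \<open>D\<close> stays in \<open>D\<close>,
  which is bounded, while each point of \<open>E\<close> lies in an unbounded connected subset of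
  \<open>E\<close>. This identifies the inside of a boundary from explicit descriptions of both
  sides, without the Jordan curve theorem.\<close>

lemma inside_complement_of_separated:
  fixes D E :: "'a::real_normed_vector set"
  assumes op: "open D" "open E" "D \<inter> E = {}" and bd: "bounded D"
    and ub: "\<And>p. p \<in> E \<Longrightarrow> \<exists>C. connected C \<and> p \<in> C \<and> C \<subseteq> E \<and> \<not> bounded C"
  shows "inside (- (D \<union> E)) = D"
proof (intro set_eqI iffI)
  fix p assume p: "p \<in> D"
  let ?C = "connected_component_set (D \<union> E) p"
  have "?C \<subseteq> D"
  proof (rule ccontr)
    assume "\<not> ?C \<subseteq> D"
    moreover have "?C \<subseteq> D \<union> E" by (rule connected_component_subset)
    moreover have "p \<in> ?C" using p by simp
    ultimately have "D \<inter> ?C \<noteq> {}" "E \<inter> ?C \<noteq> {}" using p by auto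
    with \<open>?C \<subseteq> D \<union> E\<close> op connected_connected_component[of "D \<union> E" p] show False
      unfolding connected_def by blast
  qed
  then have "bounded ?C" using bd bounded_subset by blast
  with p show "p \<in> inside (- (D \<union> E))" by (simp add: inside_def)
next
  fix p assume p: "p \<in> inside (- (D \<union> E))"
  show "p \<in> D"
  proof (rule ccontr)
    assume "p \<notin> D"
    with p have "p \<in> E" by (auto simp: inside_def)
    then obtain C where C: "connected C" "p \<in> C" "C \<subseteq> E" "\<not> bounded C" using ub by blast
    then have "C \<subseteq> connected_component_set (D \<union> E) p" by (intro connected_component_maximal) auto
    with C(4) p show False by (auto simp: inside_def dest: bounded_subset)
  qed
qed

lemma unbounded_ray:
  fixes p v :: "'a::real_normed_vector"
  assumes "v \<noteq> 0" "\<And>t. 0 \<le> t \<Longrightarrow> p + t *\<^sub>R v \<in> E"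
  shows "\<exists>C. connected C \<and> p \<in> C \<and> C \<subseteq> E \<and> \<not> bounded C"
proof (intro exI conjI)
  let ?C = "(\<lambda>t. p + t *\<^sub>R v) ` {0..}"
  show "connected ?C" by (intro connected_continuous_image continuous_intros convex_connected) simp
  show "p \<in> ?C" by (rule image_eqI[of _ _ 0]) auto
  show "?C \<subseteq> E" using assms(2) by auto
  show "\<not> bounded ?C"
  proof
    assume "bounded ?C"
    then obtain B where B: "\<And>t. 0 \<le> t \<Longrightarrow> norm (p + t *\<^sub>R v) \<le> B" unfolding bounded_iff by auto
    define t where "t = (\<bar>B\<bar> + norm p + 1) / norm v"
    have t: "0 \<le> t" "t * norm v = \<bar>B\<bar> + norm p + 1" using assms(1) by (auto simp: t_def)
    have "norm (t *\<^sub>R v) \<le> norm (p + t *\<^sub>R v) + norm p"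
      using norm_triangle_ineq4[of "p + t *\<^sub>R v" p] by simp
    with B[OF t(1)] t show False by simp
  qed
qed

section \<open>The curve parametrised by the level of its points\<close>

locale characteristic_curve =
  fixes m n :: real and \<gamma> :: "real \<Rightarrow> real \<times> real"
  assumes m: "0 < m" and n: "0 < n" and admissible: "admissible_curve \<gamma>"
begin

abbreviation J where "J \<equiv> {-1..1::real}"
abbreviation I where "I \<equiv> {-m..n}"

definition lev :: "real \<times> real \<Rightarrow> real" where "lev p = n * fst p - m * snd p"

lemma bounded_linear_lev: "bounded_linear lev"
  unfolding lev_def[abs_def]
  by (intro bounded_linear_sub bounded_linear_const_mult bounded_linear_fst bounded_linear_snd)

lemma continuous_lev: "continuous_on A lev"
  using bounded_linear_lev by (rule linear_continuous_on)

lemma velocity_deriv: "z \<in> J \<Longrightarrow> (\<gamma> has_vector_derivative velocity \<gamma> z) (at z within J)"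
  and velocity_C1: "\<exists>\<gamma>''. (\<forall>z\<in>J. (velocity \<gamma> has_vector_derivative \<gamma>'' z) (at z within J)) \<and> continuous_on J \<gamma>''"
proof -
  obtain \<gamma>' \<gamma>'' where d: "\<forall>t\<in>J. (\<gamma> has_vector_derivative \<gamma>' t) (at t within J)"
      "\<forall>t\<in>J. (\<gamma>' has_vector_derivative \<gamma>'' t) (at t within J)" "continuous_on J \<gamma>''"
    using admissible unfolding admissible_curve_def C2_interval_def by blast
  have v: "velocity \<gamma> z = \<gamma>' z" if "z \<in> J" for z
    unfolding velocity_def using d(1) that
    by (intro vector_derivative_within_cbox[of "-1" 1, unfolded cbox_interval]) auto
  then show "(\<gamma> has_vector_derivative velocity \<gamma> z) (at z within J)" if "z \<in> J" for z
    using d(1) that by simp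
  have "(velocity \<gamma> has_vector_derivative \<gamma>'' z) (at z within J)" if "z \<in> J" for z
    by (rule has_vector_derivative_transform[OF that v d(2)[rule_format, OF that]])
  with d(3) show "\<exists>\<gamma>''. (\<forall>z\<in>J. (velocity \<gamma> has_vector_derivative \<gamma>'' z) (at z within J)) \<and> continuous_on J \<gamma>''"
    by blast
qed

lemma linear_image_deriv:
  assumes "bounded_linear f" "z \<in> J"
  shows "((\<lambda>z. f (\<gamma> z)) has_real_derivative f (velocity \<gamma> z)) (at z within J)"
  using bounded_linear.has_vector_derivative[OF assms(1) velocity_deriv[OF assms(2)]]
  by (simp add: has_real_derivative_iff_has_vector_derivative)

lemma linear_image_C2:
  assumes f: "bounded_linear (f :: real \<times> real \<Rightarrow> real)"
  shows "C2_interval (-1) 1 (\<lambda>z. f (\<gamma> z))"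
proof -
  obtain \<gamma>'' where d: "\<forall>z\<in>J. (velocity \<gamma> has_vector_derivative \<gamma>'' z) (at z within J)" "continuous_on J \<gamma>''"
    using velocity_C1 by blast
  show ?thesis
  proof (rule C2_intervalI[OF linear_image_deriv[OF f]])
    show "((\<lambda>z. f (velocity \<gamma> z)) has_real_derivative f (\<gamma>'' z)) (at z within J)" if "z \<in> J" for z
      using bounded_linear.has_vector_derivative[OF f d(1)[rule_format, OF that]]
      by (simp add: has_real_derivative_iff_has_vector_derivative)
    show "continuous_on J (\<lambda>z. f (\<gamma>'' z))"
      by (rule bounded_linear.continuous_on[OF f d(2)])
  qed
qed

text \<open>The characteristics are nowhere tangent to the curve: \<open>n x'\<close> and
  \<open>- m y'\<close> are nonnegative and cannot both vanish, so the level strictly increases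
  along \<Gamma>.\<close>

lemma velocity_signs:
  assumes "z \<in> J"
  shows "0 \<le> fst (velocity \<gamma> z)" "snd (velocity \<gamma> z) \<le> 0" "0 < lev (velocity \<gamma> z)"
proof -
  have v: "velocity \<gamma> z \<noteq> 0" "0 \<le> fst (velocity \<gamma> z)" "snd (velocity \<gamma> z) \<le> 0"
    using admissible assms unfolding admissible_curve_def by auto
  then show "0 \<le> fst (velocity \<gamma> z)" "snd (velocity \<gamma> z) \<le> 0" by auto
  have "0 \<le> n * fst (velocity \<gamma> z)" "0 \<le> m * (- snd (velocity \<gamma> z))"
    by (rule mult_nonneg_nonneg; use v m n in simp)+
  moreover have "n * fst (velocity \<gamma> z) \<noteq> 0 \<or> m * (- snd (velocity \<gamma> z)) \<noteq> 0"
    using v(1) m n by (auto simp: prod_eq_iff)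
  ultimately show "0 < lev (velocity \<gamma> z)" unfolding lev_def by linarith
qed

lemma ends: "\<gamma> (-1) = (0, 1)" "\<gamma> 1 = (1, 0)"
  using admissible unfolding admissible_curve_def by auto

lemma lev_strict: "z \<in> J \<Longrightarrow> y \<in> J \<Longrightarrow> z < y \<Longrightarrow> lev (\<gamma> z) < lev (\<gamma> y)"
  using increasing_within[OF linear_image_deriv[OF bounded_linear_lev] velocity_signs(3)] .

lemma lev_inj: "z \<in> J \<Longrightarrow> y \<in> J \<Longrightarrow> lev (\<gamma> z) = lev (\<gamma> y) \<Longrightarrow> z = y"
  using lev_strict[of z y] lev_strict[of y z] by (metis less_irrefl linorder_neqE_linordered_idom)

lemma lev_ends: "lev (\<gamma> (-1)) = -m" "lev (\<gamma> 1) = n"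
  by (simp_all add: ends lev_def)

lemma lev_image: "(\<lambda>z. lev (\<gamma> z)) ` J = I"
proof -
  have le: "lev (\<gamma> z) \<le> lev (\<gamma> y)" if "z \<in> J" "y \<in> J" "z \<le> y" for z y
    using lev_strict[OF that(1,2)] that(3) by (cases "z = y") auto
  have c: "continuous_on J (\<lambda>z. lev (\<gamma> z))"
    by (rule DERIV_continuous_on) (rule linear_image_deriv[OF bounded_linear_lev])
  show ?thesis
  proof (intro equalityI subsetI)
    fix s assume "s \<in> (\<lambda>z. lev (\<gamma> z)) ` J"
    then obtain z where "z \<in> J" "s = lev (\<gamma> z)" by blast
    then show "s \<in> I" using le[of "-1" z] le[of z 1] lev_ends by auto
  next
    fix s assume "s \<in> I"
    then have "\<exists>z\<ge>-1. z \<le> 1 \<and> lev (\<gamma> z) = s"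
      using c by (intro IVT') (auto simp: lev_ends)
    then show "s \<in> (\<lambda>z. lev (\<gamma> z)) ` J" by force
  qed
qed

text \<open>The points of the curve are parametrised by their level \<open>s = n x - m y\<close>, which is constant
  along the characteristics of \<open>m \<partial>\<^sub>x + n \<partial>\<^sub>y\<close>. The clamping makes everything total and continuous
  on the whole line.\<close>

definition clamp :: "real \<Rightarrow> real" where "clamp s = max (-m) (min n s)"

definition \<sigma> :: "real \<Rightarrow> real" where "\<sigma> s = the_inv_into J (\<lambda>z. lev (\<gamma> z)) (clamp s)"

definition q :: "real \<Rightarrow> real \<times> real" where "q s = \<gamma> (\<sigma> s)"

definition a :: "real \<Rightarrow> real" where "a s = n * fst (q s)"

text \<open>The horizontal share of the growth of the level: as
  \<open>lev v = n v\<^sub>1 - m v\<^sub>2\<close> is a sum of two nonnegative terms, this quotient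
  lies in [0, 1]. It is 0 at vertical and 1 at horizontal tangents.\<close>

definition da :: "real \<Rightarrow> real" where
  "da s = n * fst (velocity \<gamma> (\<sigma> s)) / lev (velocity \<gamma> (\<sigma> s))"

lemma clamp_mem: "clamp s \<in> I" and clamp_id: "s \<in> I \<Longrightarrow> clamp s = s" and clamp_clamp: "clamp (clamp s) = clamp s"
  using m n by (auto simp: clamp_def)

lemma inj_lev: "inj_on (\<lambda>z. lev (\<gamma> z)) J"
  by (rule inj_onI) (rule lev_inj)

lemma \<sigma>_mem: "\<sigma> s \<in> J"
  unfolding \<sigma>_def using the_inv_into_into[OF inj_lev _ subset_refl] clamp_mem[of s] lev_image by blast

lemma lev_\<sigma>: "lev (\<gamma> (\<sigma> s)) = clamp s"
  unfolding \<sigma>_def using f_the_inv_into_f[OF inj_lev] clamp_mem[of s] lev_image by blast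

lemma \<sigma>_lev: "z \<in> J \<Longrightarrow> \<sigma> (lev (\<gamma> z)) = z"
proof -
  assume z: "z \<in> J"
  then have "lev (\<gamma> z) \<in> I" using lev_image by blast
  then have "lev (\<gamma> (\<sigma> (lev (\<gamma> z)))) = lev (\<gamma> z)" unfolding lev_\<sigma> by (rule clamp_id)
  then show ?thesis by (rule lev_inj[OF \<sigma>_mem z])
qed

lemma \<sigma>_C2: "C2_interval (-m) n \<sigma>"
  and \<sigma>_deriv: "s \<in> I \<Longrightarrow> (\<sigma> has_real_derivative 1 / lev (velocity \<gamma> (\<sigma> s))) (at s within I)"
proof -
  have pos: "0 < y" if "z \<in> J" "((\<lambda>z. lev (\<gamma> z)) has_real_derivative y) (at z within J)" for z y
    using within_derivative_unique[OF _ that linear_image_deriv[OF bounded_linear_lev that(1)]]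
      velocity_signs(3)[OF that(1)] by simp
  show "C2_interval (-m) n \<sigma>"
    by (rule C2_interval_inverse(1)[OF linear_image_C2[OF bounded_linear_lev] _ _ lev_image])
       (rule pos, assumption+, rule \<sigma>_lev, assumption)
  assume s: "s \<in> I"
  have "(\<sigma> has_real_derivative 1 / lev (velocity \<gamma> (\<sigma> s))) (at (lev (\<gamma> (\<sigma> s))) within I)"
    by (rule C2_interval_inverse(2)[OF linear_image_C2[OF bounded_linear_lev] _ _ lev_image \<sigma>_mem
          linear_image_deriv[OF bounded_linear_lev \<sigma>_mem]])
       (rule pos, assumption+, rule \<sigma>_lev, assumption)
  then show "(\<sigma> has_real_derivative 1 / lev (velocity \<gamma> (\<sigma> s))) (at s within I)"
    unfolding lev_\<sigma> clamp_id[OF s] .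
qed

lemma \<sigma>_image: "\<sigma> ` A \<subseteq> J" using \<sigma>_mem by blast

lemma C2_along_curve:
  fixes f :: "real \<Rightarrow> real"
  assumes "C2_interval (-1) 1 f"
  shows "C2_interval (-m) n (\<lambda>s. f (\<sigma> s))"
  by (rule C2_interval_compose[OF assms \<sigma>_C2 \<sigma>_image])

lemma lev_q: "lev (q s) = clamp s" by (simp add: q_def lev_\<sigma>)

lemma q_clamp: "q (clamp s) = q s" by (simp add: q_def \<sigma>_def clamp_clamp)

lemma snd_q: "m * snd (q s) = a s - clamp s"
  using lev_q[of s] by (simp add: lev_def a_def)

lemma curve_q: "curve \<gamma> = q ` I"
proof (intro equalityI subsetI)
  fix p assume "p \<in> curve \<gamma>"
  then obtain z where z: "z \<in> J" "p = \<gamma> z" by (auto simp: curve_def)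
  then have "lev (\<gamma> z) \<in> I" "p = q (lev (\<gamma> z))" using lev_image by (auto simp: q_def \<sigma>_lev)
  then show "p \<in> q ` I" by blast
next
  fix p assume "p \<in> q ` I"
  then show "p \<in> curve \<gamma>" using \<sigma>_mem by (auto simp: curve_def q_def)
qed

lemma q_curve: "q s \<in> curve \<gamma>" using \<sigma>_mem by (auto simp: curve_def q_def)

lemma q_ends: "q (-m) = (0, 1)" "q n = (1, 0)"
  using \<sigma>_lev[of "-1"] \<sigma>_lev[of 1] lev_ends ends by (simp_all add: q_def)

lemma a_ends: "a (-m) = 0" "a n = n" by (simp_all add: a_def q_ends)

lemma a_C2: "C2_interval (-m) n a"
  unfolding a_def[abs_def] q_def
  by (rule C2_along_curve[OF C2_interval_cmult[OF linear_image_C2[OF bounded_linear_fst]]])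

lemma a_deriv: assumes s: "s \<in> I" shows "(a has_real_derivative da s) (at s within I)"
proof -
  have "((\<lambda>s. fst (\<gamma> (\<sigma> s))) has_real_derivative fst (velocity \<gamma> (\<sigma> s)) * (1 / lev (velocity \<gamma> (\<sigma> s)))) (at s within I)"
    using DERIV_image_chain[OF DERIV_subset[OF linear_image_deriv[OF bounded_linear_fst \<sigma>_mem] \<sigma>_image] \<sigma>_deriv[OF s]]
    unfolding comp_def .
  from DERIV_cmult[OF this, of n] show ?thesis
    unfolding a_def[abs_def] q_def da_def by simp
qed

lemma da_range: "0 \<le> da s" "da s \<le> 1"
proof -
  note v = velocity_signs[OF \<sigma>_mem[of s]]
  have "0 \<le> n * fst (velocity \<gamma> (\<sigma> s))" using v n by simp
  then show "0 \<le> da s" using v unfolding da_def by (intro divide_nonneg_pos)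
  have "0 \<le> m * (- snd (velocity \<gamma> (\<sigma> s)))" using v m by (intro mult_nonneg_nonneg) auto
  then show "da s \<le> 1" using v(3) unfolding da_def by (simp add: lev_def)
qed

lemma da_eq_0_iff: "da s = 0 \<longleftrightarrow> fst (velocity \<gamma> (\<sigma> s)) = 0"
  using velocity_signs[OF \<sigma>_mem[of s]] n by (auto simp: da_def)

lemma da_eq_1_iff: "da s = 1 \<longleftrightarrow> snd (velocity \<gamma> (\<sigma> s)) = 0"
  using velocity_signs[OF \<sigma>_mem[of s]] m by (auto simp: da_def lev_def)

lemma da_C1: "\<exists>dda. (\<forall>s\<in>I. (da has_real_derivative dda s) (at s within I)) \<and> continuous_on I dda"
proof -
  obtain f' f'' where f: "\<And>t. t \<in> I \<Longrightarrow> (a has_real_derivative f' t) (at t within I)"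
    "\<And>t. t \<in> I \<Longrightarrow> (f' has_real_derivative f'' t) (at t within I)" "continuous_on I f''"
    using a_C2 by (elim C2_intervalE) blast
  have "f' t = da t" if "t \<in> I" for t
    using within_derivative_unique[OF _ that f(1)[OF that] a_deriv[OF that]] m n by simp
  then have "(da has_real_derivative f'' t) (at t within I)" if "t \<in> I" for t
    using has_field_derivative_transform_within[OF f(2)[OF that] zero_less_one that] by simp
  with f(3) show ?thesis by blast
qed

lemma a_mono: "s \<in> I \<Longrightarrow> t \<in> I \<Longrightarrow> s \<le> t \<Longrightarrow> a s \<le> a t"
  using nondecreasing_within[OF a_deriv da_range(1)] .

lemma b_mono: assumes "s \<in> I" "t \<in> I" "s \<le> t" shows "s - a s \<le> t - a t"
  by (rule nondecreasing_within[OF DERIV_diff[OF DERIV_ident a_deriv] _ assms])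
     (use da_range in auto)

lemma fst_q_mono: "s \<le> t \<Longrightarrow> fst (q s) \<le> fst (q t)"
proof -
  assume "s \<le> t"
  then have "a (clamp s) \<le> a (clamp t)" by (intro a_mono clamp_mem) (auto simp: clamp_def)
  then show ?thesis using n by (simp add: a_def q_clamp)
qed

lemma snd_q_antimono: "s \<le> t \<Longrightarrow> snd (q t) \<le> snd (q s)"
proof -
  assume "s \<le> t"
  then have "clamp s - a (clamp s) \<le> clamp t - a (clamp t)" by (intro b_mono clamp_mem) (auto simp: clamp_def)
  then have "m * snd (q t) \<le> m * snd (q s)" unfolding snd_q by (simp add: a_def q_clamp)
  then show ?thesis using m by simp
qed

lemma q_bounds: "0 \<le> fst (q s)" "fst (q s) \<le> 1" "0 \<le> snd (q s)" "snd (q s) \<le> 1"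
proof -
  have c: "-m \<le> clamp s" "clamp s \<le> n" using clamp_mem[of s] by auto
  show "0 \<le> fst (q s)" "fst (q s) \<le> 1" "0 \<le> snd (q s)" "snd (q s) \<le> 1"
    using fst_q_mono[OF c(1)] fst_q_mono[OF c(2)] snd_q_antimono[OF c(1)] snd_q_antimono[OF c(2)]
    by (simp_all add: q_clamp q_ends)
qed

lemma q_axes: assumes "fst (q s) = 0 \<or> snd (q s) = 0" shows "q s = (0, 1) \<or> q s = (1, 0)"
proof -
  have "q s \<in> {p \<in> curve \<gamma>. fst p = 0 \<or> snd p = 0}" using assms q_curve by blast
  then show ?thesis using admissible unfolding admissible_curve_def by auto
qed

lemma fst_q_pos: assumes "s \<in> I" "-m < s" shows "0 < fst (q s)"
proof (rule ccontr)
  assume "\<not> 0 < fst (q s)"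
  then have z: "fst (q s) = 0" using q_bounds(1)[of s] by simp
  with q_axes[of s] have "q s = (0, 1)" by auto
  then show False using lev_q[of s] clamp_id[OF assms(1)] assms(2) by (simp add: lev_def)
qed

lemma snd_q_pos: assumes "s \<in> I" "s < n" shows "0 < snd (q s)"
proof (rule ccontr)
  assume "\<not> 0 < snd (q s)"
  then have z: "snd (q s) = 0" using q_bounds(3)[of s] by simp
  with q_axes[of s] have "q s = (1, 0)" by auto
  then show False using lev_q[of s] clamp_id[OF assms(1)] assms(2) by (simp add: lev_def)
qed

text \<open>By \<open>snd_q\<close>, \<open>a s - s\<close> is \<open>m\<close> times the height of
  the curve, and the height is positive before \<open>A\<^sub>1\<close> because \<Gamma> meets the
  horizontal axis only there.\<close>

lemma a_gt: assumes "s \<in> I" "s < n" shows "s < a s"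
proof -
  have "0 < m * snd (q s)" using snd_q_pos[OF assms] m by simp
  then show ?thesis unfolding snd_q clamp_id[OF assms(1)] by simp
qed

lemma a_mem: "a s \<in> I" and b_mem: "s \<in> I \<Longrightarrow> s - a s \<in> I"
proof -
  have "0 \<le> a s" "a s \<le> n" using q_bounds[of s] n by (auto simp: a_def mult_left_le)
  then show "a s \<in> I" using m by auto
  assume s: "s \<in> I"
  have "0 \<le> m * snd (q s)" "m * snd (q s) \<le> m" using q_bounds[of s] m by (auto simp: mult_left_le)
  then show "s - a s \<in> I" unfolding snd_q clamp_id[OF s] using n by auto
qed

lemma continuous_q: "continuous_on A q"
proof -
  have "continuous_on I \<sigma>" by (rule DERIV_continuous_on[OF \<sigma>_deriv])
  moreover have "continuous_on J \<gamma>"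
    unfolding continuous_on_eq_continuous_within
    using velocity_deriv has_vector_derivative_continuous by blast
  ultimately have 1: "continuous_on I q"
    unfolding q_def[abs_def] by (intro continuous_on_compose2[of J \<gamma> I \<sigma>] \<sigma>_image)
  have "continuous_on A clamp" unfolding clamp_def[abs_def] by (intro continuous_intros)
  from continuous_on_compose2[OF 1 this] have "continuous_on A (\<lambda>s. q (clamp s))"
    using clamp_mem by blast
  then show ?thesis by (simp add: q_clamp)
qed

section \<open>The curvilinear triangle, its closure and its boundary in level coordinates\<close>

lemma continuous_q_lev: "continuous_on A (\<lambda>p. q (lev p))"
  by (rule continuous_on_compose2[OF continuous_q continuous_lev]) (rule subset_UNIV)

text \<open>Points of the open quadrant that lie before the point where their characteristic meets
  \<Gamma>. Since \<open>q\<close> and \<open>lev\<close> are continuous on all of their domains,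
  this form makes \<open>D\<close> open, and that of \<open>Dbar\<close> closed, at once.\<close>

definition D :: "(real \<times> real) set" where
  "D = {p. 0 < fst p \<and> 0 < snd p \<and> fst p < fst (q (lev p)) \<and> snd p < snd (q (lev p))}"

definition Dbar :: "(real \<times> real) set" where
  "Dbar = {p. 0 \<le> fst p \<and> 0 \<le> snd p \<and> fst p \<le> fst (q (lev p)) \<and> snd p \<le> snd (q (lev p))}"

lemma open_D: "open D"
  unfolding D_def
  by (intro open_Collect_conj open_Collect_less continuous_intros continuous_on_fst[OF continuous_q_lev]
      continuous_on_snd[OF continuous_q_lev])

lemma closed_Dbar: "closed Dbar"
  unfolding Dbar_def
  by (intro closed_Collect_conj closed_Collect_le continuous_intros continuous_on_fst[OF continuous_q_lev]
      continuous_on_snd[OF continuous_q_lev])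

lemma D_subset_Dbar: "D \<subseteq> Dbar" by (auto simp: D_def Dbar_def)

lemma Dbar_bounds:
  assumes "p \<in> Dbar"
  shows "0 \<le> fst p" "fst p \<le> 1" "0 \<le> snd p" "snd p \<le> 1" "lev p \<in> I" "n * fst p \<in> I" "- m * snd p \<in> I"
proof -
  show p: "0 \<le> fst p" "fst p \<le> 1" "0 \<le> snd p" "snd p \<le> 1"
    using assms q_bounds[of "lev p"] by (auto simp: Dbar_def)
  have *: "0 \<le> n * fst p" "n * fst p \<le> n" "0 \<le> m * snd p" "m * snd p \<le> m"
    using p m n by (auto simp: mult_left_le)
  show "lev p \<in> I" "n * fst p \<in> I" "- m * snd p \<in> I"
    using * m n unfolding lev_def atLeastAtMost_iff mult_minus_left by linarith+
qed

text \<open>The difference \<open>q (lev p) - p\<close> has level 0, hence is a multiple of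
  \<open>(m, n)\<close>, and its two coordinates have the same sign.\<close>

lemma below_curve_iff:
  assumes "lev p \<in> I"
  shows "fst p < fst (q (lev p)) \<longleftrightarrow> snd p < snd (q (lev p))"
    and "fst p \<le> fst (q (lev p)) \<longleftrightarrow> snd p \<le> snd (q (lev p))"
    and "fst p = fst (q (lev p)) \<longleftrightarrow> snd p = snd (q (lev p))"
proof -
  have "lev (q (lev p)) = lev p" using assms by (simp only: lev_q clamp_id)
  then have *: "n * (fst (q (lev p)) - fst p) = m * (snd (q (lev p)) - snd p)"
    by (simp add: lev_def algebra_simps)
  have "0 < n * (fst (q (lev p)) - fst p) \<longleftrightarrow> 0 < fst (q (lev p)) - fst p"
    "0 < m * (snd (q (lev p)) - snd p) \<longleftrightarrow> 0 < snd (q (lev p)) - snd p"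
    "0 \<le> n * (fst (q (lev p)) - fst p) \<longleftrightarrow> 0 \<le> fst (q (lev p)) - fst p"
    "0 \<le> m * (snd (q (lev p)) - snd p) \<longleftrightarrow> 0 \<le> snd (q (lev p)) - snd p"
    using m n by (simp_all add: zero_less_mult_iff zero_le_mult_iff)
  then show "fst p < fst (q (lev p)) \<longleftrightarrow> snd p < snd (q (lev p))"
    and "fst p \<le> fst (q (lev p)) \<longleftrightarrow> snd p \<le> snd (q (lev p))"
    and "fst p = fst (q (lev p)) \<longleftrightarrow> snd p = snd (q (lev p))"
    using * by linarith+
qed

lemma D_I: "lev p \<in> I \<Longrightarrow> 0 < fst p \<Longrightarrow> 0 < snd p \<Longrightarrow> fst p < fst (q (lev p)) \<Longrightarrow> p \<in> D"
  "lev p \<in> I \<Longrightarrow> 0 < fst p \<Longrightarrow> 0 < snd p \<Longrightarrow> snd p < snd (q (lev p)) \<Longrightarrow> p \<in> D"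
  using below_curve_iff(1)[of p] unfolding D_def by blast+

lemma Dbar_I: "lev p \<in> I \<Longrightarrow> 0 \<le> fst p \<Longrightarrow> 0 \<le> snd p \<Longrightarrow> fst p \<le> fst (q (lev p)) \<Longrightarrow> p \<in> Dbar"
  "lev p \<in> I \<Longrightarrow> 0 \<le> fst p \<Longrightarrow> 0 \<le> snd p \<Longrightarrow> snd p \<le> snd (q (lev p)) \<Longrightarrow> p \<in> Dbar"
  using below_curve_iff(2)[of p] unfolding Dbar_def by blast+

text \<open>A move to the left lowers the level, where the curve is at least as high; a move down
  raises the level, where the curve is at least as far to the right. So the triangle contains the
  rectangles over which mixed derivatives are integrated later.\<close>

lemma D_rectangle:
  assumes p: "(x, y) \<in> D" and x': "0 < x'" "x' \<le> x" and y': "0 < y'" "y' \<le> y"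
  shows "(x', y') \<in> D"
proof -
  have 1: "(x', y) \<in> D"
  proof (rule D_I(2))
    have le: "lev (x', y) \<le> lev (x, y)" using x' n by (simp add: lev_def)
    have "- m * y \<in> I" "lev (x, y) \<in> I" using Dbar_bounds[of "(x, y)"] p D_subset_Dbar by auto
    moreover have "- m * y \<le> lev (x', y)" using x' n by (simp add: lev_def)
    ultimately show "lev (x', y) \<in> I" using le by auto
    show "snd (x', y) < snd (q (lev (x', y)))"
      using p snd_q_antimono[OF le] by (auto simp: D_def)
  qed (use p x' in \<open>auto simp: D_def\<close>)
  show ?thesis
  proof (rule D_I(1))
    have le: "lev (x', y) \<le> lev (x', y')" using y' m by (simp add: lev_def)
    have "n * x' \<in> I" "lev (x', y) \<in> I" using Dbar_bounds[of "(x', y)"] 1 D_subset_Dbar by auto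
    moreover have "lev (x', y') \<le> n * x'" using y' m by (simp add: lev_def)
    ultimately show "lev (x', y') \<in> I" using le by auto
    show "fst (x', y') < fst (q (lev (x', y')))"
      using 1 fst_q_mono[OF le] by (auto simp: D_def)
  qed (use x' y' in auto)
qed

lemma x_axis_Dbar: "0 \<le> x \<Longrightarrow> x \<le> 1 \<Longrightarrow> (x, 0) \<in> Dbar"
  using q_bounds(3) m n by (intro Dbar_I(2)) (auto simp: lev_def mult_left_le intro: order_trans[of _ 0])

lemma y_axis_Dbar: "0 \<le> y \<Longrightarrow> y \<le> 1 \<Longrightarrow> (0, y) \<in> Dbar"
  using q_bounds(1) m n by (intro Dbar_I(1)) (auto simp: lev_def mult_left_le intro: order_trans[of _ 0])

lemma q_Dbar: "q s \<in> Dbar"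
proof -
  have "lev (q s) = clamp s" by (rule lev_q)
  then show ?thesis using q_bounds[of s] clamp_mem[of s]
    by (intro Dbar_I(1)) (simp_all only: q_clamp order_refl)
qed

lemma Dbar_minus_D:
  "Dbar - D = closed_segment (0, 0) (1, 0) \<union> closed_segment (0, 0) (0, 1) \<union> curve \<gamma>"
proof (intro equalityI subsetI)
  fix p assume p: "p \<in> Dbar - D"
  note b = Dbar_bounds[of p]
  have "fst p = 0 \<or> snd p = 0 \<or> fst p = fst (q (lev p)) \<or> snd p = snd (q (lev p))"
    using p unfolding D_def Dbar_def by auto
  then consider "fst p = 0" | "snd p = 0" | "p = q (lev p)"
    using below_curve_iff(3)[of p] b(5) p by (auto simp: prod_eq_iff)
  then show "p \<in> closed_segment (0, 0) (1, 0) \<union> closed_segment (0, 0) (0, 1) \<union> curve \<gamma>"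
  proof cases
    case 1
    then have "p = (1 - snd p) *\<^sub>R (0, 0) + snd p *\<^sub>R (0, 1)" by (simp add: prod_eq_iff)
    then have "p \<in> closed_segment (0, 0) (0, 1)" using b p unfolding in_segment by blast
    then show ?thesis by blast
  next
    case 2
    then have "p = (1 - fst p) *\<^sub>R (0, 0) + fst p *\<^sub>R (1, 0)" by (simp add: prod_eq_iff)
    then have "p \<in> closed_segment (0, 0) (1, 0)" using b p unfolding in_segment by blast
    then show ?thesis by blast
  next
    case 3
    then show ?thesis using q_curve by (metis UnI2)
  qed
next
  fix p assume "p \<in> closed_segment (0, 0) (1, 0) \<union> closed_segment (0, 0) (0, 1) \<union> curve \<gamma>"
  then have "(\<exists>x\<ge>0. x \<le> 1 \<and> p = (x, 0)) \<or> (\<exists>y\<ge>0. y \<le> 1 \<and> p = (0, y)) \<or> (\<exists>s\<in>I. p = q s)"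
    unfolding curve_q by (elim UnE imageE) (auto simp: in_segment)
  then consider x where "0 \<le> x" "x \<le> 1" "p = (x, 0)" | y where "0 \<le> y" "y \<le> 1" "p = (0, y)"
    | s where "s \<in> I" "p = q s"
    by blast
  then show "p \<in> Dbar - D"
  proof cases
    case 1
    then show ?thesis using x_axis_Dbar by (auto simp: D_def)
  next
    case 2
    then show ?thesis using y_axis_Dbar by (auto simp: D_def)
  next
    case 3
    then show ?thesis using q_Dbar by (auto simp: D_def lev_q clamp_id)
  qed
qed

text \<open>The boundary is the complement of \<open>D\<close> and the exterior of
  \<open>Dbar\<close>. An exterior point escapes to infinity along a ray: to the left, downwards, or
  beyond \<Gamma> in the direction \<open>(m, n)\<close>, which keeps the level.\<close>

lemma curv_triangle_eq: "curv_triangle \<gamma> = D"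
proof -
  have "inside (- (D \<union> - Dbar)) = D"
  proof (rule inside_complement_of_separated)
    show "open D" by (rule open_D)
    show "open (- Dbar)" using closed_Dbar by (simp add: open_closed)
    show "D \<inter> - Dbar = {}" using D_subset_Dbar by blast
    have "D \<subseteq> cbox (0, 0) (1, 1)"
    proof
      fix p assume "p \<in> D"
      then have "p \<in> Dbar" using D_subset_Dbar by blast
      from Dbar_bounds[OF this] show "p \<in> cbox (0, 0) (1, 1)"
        by (cases p) (simp add: cbox_Pair_eq)
    qed
    then show "bounded D" using bounded_cbox bounded_subset by blast
    fix p assume p: "p \<in> - Dbar"
    then consider "fst p < 0" | "snd p < 0" | "fst (q (lev p)) < fst p" | "snd (q (lev p)) < snd p"
      unfolding Dbar_def by fastforce
    then show "\<exists>C. connected C \<and> p \<in> C \<and> C \<subseteq> - Dbar \<and> \<not> bounded C"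
    proof cases
      case 1
      then show ?thesis by (intro unbounded_ray[of "(-1, 0)"]) (auto simp: Dbar_def zero_prod_def)
    next
      case 2
      then show ?thesis by (intro unbounded_ray[of "(0, -1)"]) (auto simp: Dbar_def zero_prod_def)
    next
      case 3
      show ?thesis
      proof (rule unbounded_ray[of "(m, n)"])
        fix t :: real assume "0 \<le> t"
        then have "fst p \<le> fst (p + t *\<^sub>R (m, n))" using m by simp
        moreover have "lev (p + t *\<^sub>R (m, n)) = lev p" by (simp add: lev_def algebra_simps)
        ultimately have "fst (q (lev (p + t *\<^sub>R (m, n)))) < fst (p + t *\<^sub>R (m, n))"
          using 3 by simp
        then show "p + t *\<^sub>R (m, n) \<in> - Dbar" unfolding Dbar_def by (simp del: fst_add snd_add)
      qed (use m in \<open>simp add: zero_prod_def\<close>)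
    next
      case 4
      show ?thesis
      proof (rule unbounded_ray[of "(m, n)"])
        fix t :: real assume "0 \<le> t"
        then have "snd p \<le> snd (p + t *\<^sub>R (m, n))" using n by simp
        moreover have "lev (p + t *\<^sub>R (m, n)) = lev p" by (simp add: lev_def algebra_simps)
        ultimately have "snd (q (lev (p + t *\<^sub>R (m, n)))) < snd (p + t *\<^sub>R (m, n))"
          using 4 by simp
        then show "p + t *\<^sub>R (m, n) \<in> - Dbar" unfolding Dbar_def by (simp del: fst_add snd_add)
      qed (use m in \<open>simp add: zero_prod_def\<close>)
    qed
  qed
  moreover have "- (D \<union> - Dbar) = Dbar - D" by blast
  ultimately show ?thesis unfolding curv_triangle_def Dbar_minus_D by simp
qed

lemma in_closure_at_right:
  fixes p :: "real \<times> real"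
  assumes "((\<lambda>t. f t) \<longlongrightarrow> p) (at_right (0::real))" "\<forall>\<^sub>F t in at_right 0. f t \<in> closure A"
  shows "p \<in> closure A"
  using Lim_in_closed_set[OF closed_closure assms(2) trivial_limit_at_right_real assms(1)] .

text \<open>The axes are included: a small shift in the direction \<open>(1, 1)\<close> makes both
  coordinates positive and, by continuity, stays before the curve.\<close>

lemma D_near_bottom:
  assumes "0 \<le> fst p" "0 \<le> snd p" "fst p < fst (q (lev p))" "snd p < snd (q (lev p))"
  shows "p \<in> closure D"
proof (rule in_closure_at_right)
  let ?f = "\<lambda>t::real. p + t *\<^sub>R (1, 1)"
  have c: "(?f \<longlongrightarrow> p + 0 *\<^sub>R (1, 1)) (at_right 0)" by (intro tendsto_intros)
  then show f: "(?f \<longlongrightarrow> p) (at_right 0)" by (simp flip: zero_prod_def)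
  have g: "((\<lambda>t. q (lev (?f t))) \<longlongrightarrow> q (lev p)) (at_right 0)"
    by (rule continuous_on_tendsto_compose[OF continuous_q_lev[of UNIV] f]) auto
  have "\<forall>\<^sub>F t in at_right 0. 0 < fst (q (lev (?f t))) - fst (?f t)"
    "\<forall>\<^sub>F t in at_right 0. 0 < snd (q (lev (?f t))) - snd (?f t)"
    using order_tendstoD(1)[OF tendsto_diff[OF tendsto_fst[OF g] tendsto_fst[OF f]], of 0]
      order_tendstoD(1)[OF tendsto_diff[OF tendsto_snd[OF g] tendsto_snd[OF f]], of 0] assms(3,4)
    by (simp_all only: diff_gt_0_iff_gt)
  then show "\<forall>\<^sub>F t in at_right 0. ?f t \<in> closure D"
    using eventually_at_right_less
  proof eventually_elim
    case (elim t)
    then have "?f t \<in> D" using assms by (simp add: D_def)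
    then show ?case using closure_subset by blast
  qed
qed

text \<open>Inner points of \<Gamma> are approached backwards along their characteristic. At
  \<open>A\<^sub>1\<close> and \<open>A\<^sub>2\<close> this path leaves the quadrant, so these two
  points are approached along the axes.\<close>

lemma closure_D: "closure D = Dbar"
proof (intro equalityI subsetI)
  fix p assume p: "p \<in> closure D"
  then show "p \<in> Dbar" using closure_minimal[OF D_subset_Dbar closed_Dbar] by blast
next
  fix p assume p: "p \<in> Dbar"
  note b = Dbar_bounds[OF p]
  show "p \<in> closure D"
  proof (cases "fst p < fst (q (lev p))")
    case True
    then show ?thesis using b below_curve_iff(1)[OF b(5)] by (intro D_near_bottom) auto
  next
    case False
    with p have "fst p = fst (q (lev p))" by (simp add: Dbar_def)
    then have pq: "p = q (lev p)" using below_curve_iff(3)[OF b(5)] by (simp add: prod_eq_iff)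
    consider "lev p = -m" | "lev p = n" | "-m < lev p" "lev p < n" using b(5) by fastforce
    then show ?thesis
    proof cases
      case 1
      then have p01: "p = (0, 1)" using pq q_ends by simp
      show ?thesis
      proof (rule in_closure_at_right)
        have "((\<lambda>t::real. (0, 1 - t)) \<longlongrightarrow> (0, 1 - 0)) (at_right 0)" by (intro tendsto_intros)
        then show "((\<lambda>t::real. (0, 1 - t)) \<longlongrightarrow> p) (at_right 0)" by (simp add: p01)
        have "\<forall>\<^sub>F t in at_right (0::real). t < 1" "\<forall>\<^sub>F t in at_right (0::real). 0 < t"
          by (rule order_tendstoD(2)[OF tendsto_ident_at], simp, rule eventually_at_right_less)
        then show "\<forall>\<^sub>F t in at_right (0::real). (0, 1 - t) \<in> closure D"
        proof eventually_elim
          case (elim t)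
          have "0 < m * t" "m * t < m" using elim m by auto
          then have l: "lev (0, 1 - t) \<in> I" "-m < lev (0, 1 - t)"
            using n by (auto simp: lev_def algebra_simps)
          show ?case using elim fst_q_pos[OF l] below_curve_iff(1)[OF l(1)] by (intro D_near_bottom) auto
        qed
      qed
    next
      case 2
      then have p10: "p = (1, 0)" using pq q_ends by simp
      show ?thesis
      proof (rule in_closure_at_right)
        have "((\<lambda>t::real. (1 - t, 0)) \<longlongrightarrow> (1 - 0, 0)) (at_right 0)" by (intro tendsto_intros)
        then show "((\<lambda>t::real. (1 - t, 0)) \<longlongrightarrow> p) (at_right 0)" by (simp add: p10)
        have "\<forall>\<^sub>F t in at_right (0::real). t < 1" "\<forall>\<^sub>F t in at_right (0::real). 0 < t"
          by (rule order_tendstoD(2)[OF tendsto_ident_at], simp, rule eventually_at_right_less)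
        then show "\<forall>\<^sub>F t in at_right (0::real). (1 - t, 0) \<in> closure D"
        proof eventually_elim
          case (elim t)
          have "0 < n * t" "n * t < n" using elim n by auto
          then have l: "lev (1 - t, 0) \<in> I" "lev (1 - t, 0) < n"
            using m by (auto simp: lev_def algebra_simps)
          show ?case using elim snd_q_pos[OF l] below_curve_iff(1)[OF l(1)] by (intro D_near_bottom) auto
        qed
      qed
    next
      case 3
      have pos: "0 < fst p" "0 < snd p"
        using fst_q_pos[OF b(5) 3(1)] snd_q_pos[OF b(5) 3(2)] pq by auto
      show ?thesis
      proof (rule in_closure_at_right)
        let ?f = "\<lambda>t::real. p - t *\<^sub>R (m, n)"
        have "(?f \<longlongrightarrow> p - 0 *\<^sub>R (m, n)) (at_right 0)" by (intro tendsto_intros)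
        then show f: "(?f \<longlongrightarrow> p) (at_right 0)" by (simp flip: zero_prod_def)
        have "\<forall>\<^sub>F t in at_right 0. 0 < fst (?f t)" "\<forall>\<^sub>F t in at_right 0. 0 < snd (?f t)"
          using order_tendstoD(1)[OF tendsto_fst[OF f] pos(1)] order_tendstoD(1)[OF tendsto_snd[OF f] pos(2)] .
        then show "\<forall>\<^sub>F t in at_right 0. ?f t \<in> closure D"
          using eventually_at_right_less
        proof eventually_elim
          case (elim t)
          have "lev (?f t) = lev p" by (simp add: lev_def algebra_simps)
          moreover have "fst (?f t) < fst p" "snd (?f t) < snd p" using elim m n by auto
          ultimately show ?case using elim pq by (intro D_near_bottom) auto
        qed
      qed
    qed
  qed
qed

lemma frontier_D: "frontier D = Dbar - D"
  by (simp add: frontier_def closure_D interior_open open_D)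

section \<open>The maps \<open>\<zeta>\<^sub>1\<close>, \<open>\<zeta>\<^sub>2\<close> and the
  guiding sets in level coordinates\<close>

lemma proj3_eq:
  assumes p: "lev p \<in> I"
  shows "proj3 m n \<gamma> p = q (lev p)"
  unfolding proj3_def
proof (rule the_equality)
  define t where "t = (fst (q (lev p)) - fst p) / m"
  have "lev (q (lev p)) = lev p" using p by (simp only: lev_q clamp_id)
  then have "n * (fst (q (lev p)) - fst p) = m * (snd (q (lev p)) - snd p)"
    by (simp add: lev_def algebra_simps)
  then have "q (lev p) = p + (m * t, n * t)" using m by (simp add: t_def prod_eq_iff field_simps)
  then show "q (lev p) \<in> curve \<gamma> \<and> q (lev p) \<in> {p + (m * t, n * t) | t. True}" using q_curve by blast
next
  \<comment> \<open>Uniqueness: the level is constant on the line and determines a point of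
    \<Gamma>.\<close>
  fix r assume r: "r \<in> curve \<gamma> \<and> r \<in> {p + (m * t, n * t) | t. True}"
  then obtain t where "r = p + (m * t, n * t)" by blast
  then have "lev r = lev p" by (simp add: lev_def algebra_simps)
  moreover obtain s where "s \<in> I" "r = q s" using r curve_q by blast
  ultimately show "r = q (lev p)" by (simp add: lev_q clamp_id)
qed

lemma zeta1_q: "s \<in> I \<Longrightarrow> zeta1 m n \<gamma> (q s) = q (a s)"
  using proj3_eq[of "proj1 (q s)"] a_mem[of s] by (simp add: zeta1_def proj1_def lev_def a_def)

text \<open>The projection to the vertical axis has level \<open>- m y\<close>, and
  \<open>m y = a s - s\<close> at the point of level \<open>s\<close>.\<close>

lemma zeta2_q: assumes "s \<in> I" shows "zeta2 m n \<gamma> (q s) = q (s - a s)"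
proof -
  have "lev (proj2 (q s)) = s - a s" using snd_q[of s] clamp_id[OF assms] by (simp add: proj2_def lev_def)
  then show ?thesis using proj3_eq[of "proj2 (q s)"] b_mem[OF assms] by (simp add: zeta2_def)
qed

text \<open>The curve is injective, as its level is, so the union over parameters reduces to one
  line.\<close>

lemma tangent_space_q: assumes "s \<in> I" shows "tangent_space \<gamma> (q s) = span {velocity \<gamma> (\<sigma> s)}"
proof -
  have "{z \<in> J. \<gamma> z = q s} = {\<sigma> s}"
  proof (intro equalityI subsetI)
    fix z assume "z \<in> {z \<in> J. \<gamma> z = q s}"
    then show "z \<in> {\<sigma> s}" using lev_inj[of z "\<sigma> s"] \<sigma>_mem[of s] by (simp add: q_def)
  qed (use \<sigma>_mem[of s] in \<open>simp add: q_def\<close>)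
  then show ?thesis unfolding tangent_space_def by simp
qed

lemma Omega1_q: assumes "s \<in> I" shows "q s \<in> Omega1 \<gamma> \<longleftrightarrow> da s = 0"
proof -
  let ?v = "velocity \<gamma> (\<sigma> s)"
  have "(0, 1) \<in> span {?v} \<longleftrightarrow> fst ?v = 0"
  proof
    assume "(0, 1) \<in> span {?v}"
    then obtain k where "(0, 1) = k *\<^sub>R ?v" by (auto simp: span_singleton)
    then show "fst ?v = 0" by (auto simp: prod_eq_iff)
  next
    assume "fst ?v = 0"
    moreover from this have "snd ?v \<noteq> 0" using velocity_signs(3)[OF \<sigma>_mem[of s]] by (auto simp: lev_def)
    ultimately have "(0, 1) = (1 / snd ?v) *\<^sub>R ?v" by (simp add: prod_eq_iff)
    then show "(0, 1) \<in> span {?v}" unfolding span_singleton by blast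
  qed
  then show ?thesis using q_curve by (simp add: Omega1_def tangent_space_q[OF assms] da_eq_0_iff)
qed

lemma Omega2_q: assumes "s \<in> I" shows "q s \<in> Omega2 \<gamma> \<longleftrightarrow> da s = 1"
proof -
  let ?v = "velocity \<gamma> (\<sigma> s)"
  have "(1, 0) \<in> span {?v} \<longleftrightarrow> snd ?v = 0"
  proof
    assume "(1, 0) \<in> span {?v}"
    then obtain k where "(1, 0) = k *\<^sub>R ?v" by (auto simp: span_singleton)
    then show "snd ?v = 0" by (auto simp: prod_eq_iff)
  next
    assume "snd ?v = 0"
    moreover from this have "fst ?v \<noteq> 0" using velocity_signs(3)[OF \<sigma>_mem[of s]] by (auto simp: lev_def)
    ultimately have "(1, 0) = (1 / fst ?v) *\<^sub>R ?v" by (simp add: prod_eq_iff)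
    then show "(1, 0) \<in> span {?v}" unfolding span_singleton by blast
  qed
  then show ?thesis using q_curve by (simp add: Omega2_def tangent_space_q[OF assms] da_eq_1_iff)
qed

lemma zeta1_pow_q: "s \<in> I \<Longrightarrow> (zeta1 m n \<gamma> ^^ k) (q s) = q ((a ^^ k) s) \<and> (a ^^ k) s \<in> I"
  by (induction k) (auto simp del: atLeastAtMost_iff simp: zeta1_q a_mem)

lemma proper_orbit_q:
  assumes "proper_orbit m n \<gamma> (q s # ps)" "s \<in> I"
  shows "\<exists>t\<in>I. last (q s # ps) = q t \<and> (\<lambda>s t. da s \<noteq> 0 \<and> t = a s \<or> da s \<noteq> 1 \<and> t = s - a s)\<^sup>*\<^sup>* s t"
  using assms
proof (induction ps arbitrary: s)
  case Nil
  then show ?case by auto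
next
  case (Cons p ps)
  have orbit: "proper_orbit m n \<gamma> (p # ps)" using Cons.prems(1) by (auto simp: proper_orbit_def)
  have "q s \<notin> Omega1 \<gamma> \<and> p = zeta1 m n \<gamma> (q s) \<or> q s \<notin> Omega2 \<gamma> \<and> p = zeta2 m n \<gamma> (q s)"
    using Cons.prems(1) by (simp add: proper_orbit_def)
  then obtain u where u: "u \<in> I" "p = q u" "da s \<noteq> 0 \<and> u = a s \<or> da s \<noteq> 1 \<and> u = s - a s"
    using Omega1_q[OF Cons.prems(2)] Omega2_q[OF Cons.prems(2)] zeta1_q[OF Cons.prems(2)]
      zeta2_q[OF Cons.prems(2)] a_mem[of s] b_mem[OF Cons.prems(2)] by metis
  obtain t where t: "t \<in> I" "last (q u # ps) = q t"
    "(\<lambda>s t. da s \<noteq> 0 \<and> t = a s \<or> da s \<noteq> 1 \<and> t = s - a s)\<^sup>*\<^sup>* u t"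
    using Cons.IH[OF orbit[unfolded u(2)] u(1)] by blast
  show ?case
  proof (intro bexI[OF _ t(1)] conjI)
    show "last (q s # p # ps) = q t" using t(2) u(2) by simp
    show "(\<lambda>s t. da s \<noteq> 0 \<and> t = a s \<or> da s \<noteq> 1 \<and> t = s - a s)\<^sup>*\<^sup>* s t"
      by (rule converse_rtranclp_into_rtranclp[OF u(3) t(3)])
  qed
qed

lemma functional_equation_from_orbits:
  assumes A1: "(1, 0) \<notin> Omega \<gamma>"
    and orbits: "\<forall>p\<in>Omega1 \<gamma>. \<exists>ps. proper_orbit m n \<gamma> (p # ps) \<and>
           (\<forall>k. (zeta1 m n \<gamma> ^^ k) (last (p # ps)) \<notin> Omega1 \<gamma>)"
  shows "\<exists>dda. functional_equation (-m) n a da dda"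
proof -
  obtain dda where dda: "\<forall>s\<in>I. (da has_real_derivative dda s) (at s within I)" "continuous_on I dda"
    using da_C1 by blast
  have nI: "n \<in> I" using m n by simp
  have "q n \<notin> Omega1 \<gamma>" "q n \<notin> Omega2 \<gamma>" using A1 by (simp_all add: q_ends Omega_def)
  then have "da n \<noteq> 0" "da n \<noteq> 1" using Omega1_q[OF nI] Omega2_q[OF nI] by auto
  then have dan: "0 < da n" "da n < 1" using da_range[of n] by auto
  have "functional_equation (-m) n a da dda"
  proof
    show "\<exists>t. (\<lambda>s t. da s \<noteq> 0 \<and> t = a s \<or> da s \<noteq> 1 \<and> t = s - a s)\<^sup>*\<^sup>* s t \<and> (\<forall>k. da ((a ^^ k) t) \<noteq> 0)"
      if s: "s \<in> I" "da s = 0" for s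
    proof -
      obtain ps where ps: "proper_orbit m n \<gamma> (q s # ps)"
        "\<And>k. (zeta1 m n \<gamma> ^^ k) (last (q s # ps)) \<notin> Omega1 \<gamma>"
        using orbits Omega1_q[OF s(1)] s(2) by blast
      obtain t where t: "t \<in> I" "last (q s # ps) = q t"
        "(\<lambda>s t. da s \<noteq> 0 \<and> t = a s \<or> da s \<noteq> 1 \<and> t = s - a s)\<^sup>*\<^sup>* s t"
        using proper_orbit_q[OF ps(1) s(1)] by blast
      have "da ((a ^^ k) t) \<noteq> 0" for k
        using ps(2)[of k] zeta1_pow_q[OF t(1), of k] Omega1_q unfolding t(2) by metis
      with t(3) show ?thesis by blast
    qed
  qed (use m n dda da_range dan a_ends a_deriv a_gt in auto)
  then show ?thesis by blast
qed

end

section \<open>Smooth functions of one and two variables\<close>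

lemma partial_eqI:
  assumes "(f has_derivative f') (at p)"
  shows "partial_x f p = f' (1, 0)" "partial_y f p = f' (0, 1)"
  using frechet_derivative_at[OF assms] unfolding partial_x_def partial_y_def by simp_all

lemma has_derivative_partials:
  assumes "f differentiable (at p)"
  shows "(f has_derivative (\<lambda>v. fst v * partial_x f p + snd v * partial_y f p)) (at p)"
proof -
  have d: "(f has_derivative frechet_derivative f (at p)) (at p)"
    using assms by (simp add: frechet_derivative_works)
  have lin: "linear (frechet_derivative f (at p))" by (rule has_derivative_linear[OF d])
  have "frechet_derivative f (at p) v = fst v * partial_x f p + snd v * partial_y f p" for v
  proof -
    have "v = fst v *\<^sub>R (1, 0) + snd v *\<^sub>R (0, 1)" by (simp add: prod_eq_iff)
    then have "frechet_derivative f (at p) v = frechet_derivative f (at p) (fst v *\<^sub>R (1, 0) + snd v *\<^sub>R (0, 1))"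
      by simp
    then show ?thesis unfolding linear_add[OF lin] linear_scale[OF lin] partial_x_def partial_y_def by simp
  qed
  then have "frechet_derivative f (at p) = (\<lambda>v. fst v * partial_x f p + snd v * partial_y f p)" by auto
  with d show ?thesis by simp
qed

lemma slice_derivs:
  assumes "f differentiable (at (x, y))"
  shows "((\<lambda>t. f (t, y)) has_real_derivative partial_x f (x, y)) (at x)"
    "((\<lambda>t. f (x, t)) has_real_derivative partial_y f (x, y)) (at y)"
proof -
  note d = has_derivative_partials[OF assms]
  have "((\<lambda>t. (t, y)) has_derivative (\<lambda>h. (h, 0))) (at x)" "((\<lambda>t. (x, t)) has_derivative (\<lambda>h. (0, h))) (at y)"
    by (auto intro!: derivative_eq_intros)
  from has_derivative_compose[OF this(1) d] has_derivative_compose[OF this(2) d]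
  have "((\<lambda>t. f (t, y)) has_derivative (\<lambda>h. h * partial_x f (x, y))) (at x)"
    "((\<lambda>t. f (x, t)) has_derivative (\<lambda>h. h * partial_y f (x, y))) (at y)" by simp_all
  moreover have "(\<lambda>h. h * c) = (*) c" for c :: real by auto
  ultimately show "((\<lambda>t. f (t, y)) has_real_derivative partial_x f (x, y)) (at x)"
    "((\<lambda>t. f (x, t)) has_real_derivative partial_y f (x, y)) (at y)"
    by (simp_all add: has_field_derivative_def)
qed

lemma partial_add:
  assumes "f differentiable (at p)" "g differentiable (at p)"
  shows "partial_x (\<lambda>p. f p + g p) p = partial_x f p + partial_x g p"
    "partial_y (\<lambda>p. f p + g p) p = partial_y f p + partial_y g p"
  using partial_eqI[OF has_derivative_add[OF has_derivative_partials[OF assms(1)] has_derivative_partials[OF assms(2)]]]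
  by simp_all

lemma partial_mult:
  assumes "f differentiable (at p)" "g differentiable (at p)"
  shows "partial_x (\<lambda>p. f p * g p) p = partial_x f p * g p + f p * partial_x g p"
    "partial_y (\<lambda>p. f p * g p) p = partial_y f p * g p + f p * partial_y g p"
  using partial_eqI[OF has_derivative_mult[OF has_derivative_partials[OF assms(1)] has_derivative_partials[OF assms(2)]]]
  by simp_all

lemma Ck_closure_add:
  "Ck_closure k S f \<Longrightarrow> Ck_closure k S g \<Longrightarrow> Ck_closure k S (\<lambda>p. f p + g p)"
proof (induction k arbitrary: f g)
  case 0
  then show ?case by (simp add: continuous_on_add)
next
  case (Suc k)
  obtain fx fy where f: "\<forall>p\<in>S. fx p = partial_x f p \<and> fy p = partial_y f p" "Ck_closure k S fx" "Ck_closure k S fy"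
    using Suc.prems(1) by auto
  obtain gx gy where g: "\<forall>p\<in>S. gx p = partial_x g p \<and> gy p = partial_y g p" "Ck_closure k S gx" "Ck_closure k S gy"
    using Suc.prems(2) by auto
  have d: "\<forall>p\<in>S. f differentiable (at p) \<and> g differentiable (at p)" using Suc.prems by simp
  show ?case unfolding Ck_closure.simps
  proof (intro conjI ballI exI)
    show "continuous_on (closure S) (\<lambda>p. f p + g p)"
      using Suc.prems by (simp add: continuous_on_add)
    show "(\<lambda>p. f p + g p) differentiable (at p)" if "p \<in> S" for p
      using d that by (simp add: differentiable_add)
    show "fx p + gx p = partial_x (\<lambda>p. f p + g p) p" "fy p + gy p = partial_y (\<lambda>p. f p + g p) p" if "p \<in> S" for p
      using d f g that by (simp_all add: partial_add)
  qed (intro Suc.IH f g)+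
qed

lemma Ck_closure_Suc: "Ck_closure (Suc k) S f \<Longrightarrow> Ck_closure k S f"
proof (induction k arbitrary: f)
  case (Suc k)
  obtain fx fy where f: "\<forall>p\<in>S. fx p = partial_x f p \<and> fy p = partial_y f p"
    "Ck_closure (Suc k) S fx" "Ck_closure (Suc k) S fy"
    using Suc.prems by (simp del: Ck_closure.simps add: Ck_closure.simps(2)[of "Suc k"]) blast
  have "continuous_on (closure S) f" "\<forall>p\<in>S. f differentiable (at p)" using Suc.prems by simp_all
  with f(1) Suc.IH[OF f(2)] Suc.IH[OF f(3)] show ?case unfolding Ck_closure.simps by blast
qed simp

lemma Ck_closure_mult:
  "Ck_closure k S f \<Longrightarrow> Ck_closure k S g \<Longrightarrow> Ck_closure k S (\<lambda>p. f p * g p)"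
proof (induction k arbitrary: f g)
  case 0
  then show ?case by (simp add: continuous_on_mult)
next
  case (Suc k)
  obtain fx fy where f: "\<forall>p\<in>S. fx p = partial_x f p \<and> fy p = partial_y f p" "Ck_closure k S fx" "Ck_closure k S fy"
    using Suc.prems(1) by auto
  obtain gx gy where g: "\<forall>p\<in>S. gx p = partial_x g p \<and> gy p = partial_y g p" "Ck_closure k S gx" "Ck_closure k S gy"
    using Suc.prems(2) by auto
  have d: "\<forall>p\<in>S. f differentiable (at p) \<and> g differentiable (at p)" using Suc.prems by simp
  show ?case unfolding Ck_closure.simps
  proof (intro conjI ballI exI)
    show "continuous_on (closure S) (\<lambda>p. f p * g p)"
      using Suc.prems by (simp add: continuous_on_mult)
    show "(\<lambda>p. f p * g p) differentiable (at p)" if "p \<in> S" for p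
      using d that by (simp add: differentiable_mult)
    show "fx p * g p + f p * gx p = partial_x (\<lambda>p. f p * g p) p" "fy p * g p + f p * gy p = partial_y (\<lambda>p. f p * g p) p"
      if "p \<in> S" for p
      using d f g that by (simp_all add: partial_mult)
  qed (intro Ck_closure_add Suc.IH f g Ck_closure_Suc[OF Suc.prems(1)] Ck_closure_Suc[OF Suc.prems(2)])+
qed

lemma Ck_closure_const: "Ck_closure k S (\<lambda>_. c)"
proof (induction k arbitrary: c)
  case (Suc k)
  have "partial_x (\<lambda>_. c) p = 0" "partial_y (\<lambda>_. c) p = 0" for p
    using partial_eqI[OF has_derivative_const] by auto
  then show ?case using Suc[of 0] unfolding Ck_closure.simps
    by (intro conjI exI[of _ "\<lambda>_. 0"]) auto
qed simp

lemma Ck_closure_cmult: "Ck_closure k S f \<Longrightarrow> Ck_closure k S (\<lambda>p. c * f p)"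
  by (intro Ck_closure_mult Ck_closure_const)

lemma ridge_has_derivative:
  assumes "bounded_linear l" "(h has_real_derivative h') (at (l p))"
  shows "((\<lambda>p. h (l p)) has_derivative (\<lambda>v. h' * l v)) (at p)"
  using has_derivative_compose[OF bounded_linear_imp_has_derivative[OF assms(1)] assms(2)[unfolded has_field_derivative_def]]
  by simp

text \<open>The partial derivatives of \<open>h (l p)\<close> are constant multiples of
  \<open>h' (l p)\<close>, again of this form, so differentiability classes pass from one variable
  to two by induction.\<close>

lemma Ck_closure_ridge_Suc:
  assumes l: "bounded_linear l" and h: "\<And>p. p \<in> S \<Longrightarrow> (h has_real_derivative h' (l p)) (at (l p))"
    and c: "continuous_on (l ` closure S) h" and h': "Ck_closure k S (\<lambda>p. h' (l p))"
  shows "Ck_closure (Suc k) S (\<lambda>p. h (l p))"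
  unfolding Ck_closure.simps
proof (intro conjI exI ballI)
  show "continuous_on (closure S) (\<lambda>p. h (l p))"
    by (rule continuous_on_compose2[OF c linear_continuous_on[OF l] subset_refl])
  show "(\<lambda>p. h (l p)) differentiable (at p)" if "p \<in> S" for p
    using ridge_has_derivative[OF l h[OF that]] by (rule differentiableI)
  show "l (1, 0) * h' (l p) = partial_x (\<lambda>p. h (l p)) p" "l (0, 1) * h' (l p) = partial_y (\<lambda>p. h (l p)) p"
    if "p \<in> S" for p
    using partial_eqI[OF ridge_has_derivative[OF l h[OF that]]] by simp_all
qed (intro Ck_closure_cmult h')+

lemma Ck_closure_2_ridge:
  assumes l: "bounded_linear l" and h: "C2_interval c d h"
    and S: "l ` S \<subseteq> {c<..<d}" "l ` closure S \<subseteq> {c..d}"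
  shows "Ck_closure 2 S (\<lambda>p. h (l p))"
proof -
  obtain h' h'' where h: "\<And>t. t \<in> {c..d} \<Longrightarrow> (h has_real_derivative h' t) (at t within {c..d})"
    "\<And>t. t \<in> {c..d} \<Longrightarrow> (h' has_real_derivative h'' t) (at t within {c..d})" "continuous_on {c..d} h''"
    using h by (elim C2_intervalE) blast
  have int: "at (l p) within {c..d} = at (l p)" "l p \<in> {c..d}" if "p \<in> S" for p
    using S(1) that by (auto intro!: at_within_interior)
  have d: "(h has_real_derivative h' (l p)) (at (l p))" "(h' has_real_derivative h'' (l p)) (at (l p))" if "p \<in> S" for p
    using h(1,2)[OF int(2)[OF that]] int(1)[OF that] by simp_all
  have c: "continuous_on {c..d} h" "continuous_on {c..d} h'" by (rule DERIV_continuous_on, erule h)+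
  have "Ck_closure 0 S (\<lambda>p. h'' (l p))"
    using continuous_on_compose2[OF h(3) linear_continuous_on[OF l] S(2)] by simp
  then have "Ck_closure (Suc (Suc 0)) S (\<lambda>p. h (l p))"
    by (intro Ck_closure_ridge_Suc[OF l d(1) continuous_on_subset[OF c(1) S(2)]]
        Ck_closure_ridge_Suc[OF l d(2) continuous_on_subset[OF c(2) S(2)]])
  then show ?thesis unfolding numeral_2_eq_2 .
qed

definition smooth :: "(real \<times> real \<Rightarrow> real) \<Rightarrow> bool" where
  "smooth \<phi> \<longleftrightarrow> (\<forall>k. Ck_closure k UNIV \<phi>)"

text \<open>On the whole plane the existential in \<open>Ck_closure\<close> leaves no choice: the
  extended derivatives are the partial derivatives themselves.\<close>

lemma smooth_Suc: "Ck_closure (Suc k) UNIV \<phi> \<longleftrightarrow>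
    (\<forall>p. \<phi> differentiable (at p)) \<and> Ck_closure k UNIV (partial_x \<phi>) \<and> Ck_closure k UNIV (partial_y \<phi>)"
proof
  assume *: "Ck_closure (Suc k) UNIV \<phi>"
  then obtain fx fy where f: "\<forall>p. fx p = partial_x \<phi> p \<and> fy p = partial_y \<phi> p"
    "Ck_closure k UNIV fx" "Ck_closure k UNIV fy" unfolding Ck_closure.simps by blast
  from f(1) have "fx = partial_x \<phi>" "fy = partial_y \<phi>" by (simp_all add: fun_eq_iff)
  with * f(2,3) show "(\<forall>p. \<phi> differentiable (at p)) \<and> Ck_closure k UNIV (partial_x \<phi>) \<and> Ck_closure k UNIV (partial_y \<phi>)"
    by simp
next
  assume *: "(\<forall>p. \<phi> differentiable (at p)) \<and> Ck_closure k UNIV (partial_x \<phi>) \<and> Ck_closure k UNIV (partial_y \<phi>)"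
  then have "continuous_on UNIV \<phi>"
    by (intro differentiable_imp_continuous_on) (simp add: differentiable_on_def)
  with * show "Ck_closure (Suc k) UNIV \<phi>" unfolding Ck_closure.simps closure_UNIV by blast
qed

lemma smoothD:
  assumes "smooth \<phi>"
  shows "\<phi> differentiable (at p)" "continuous_on A \<phi>" "smooth (partial_x \<phi>)" "smooth (partial_y \<phi>)"
proof -
  have 1: "Ck_closure (Suc k) UNIV \<phi>" for k using assms unfolding smooth_def by blast
  show "\<phi> differentiable (at p)" "smooth (partial_x \<phi>)" "smooth (partial_y \<phi>)"
    using 1 unfolding smooth_Suc smooth_def by blast+
  have "Ck_closure 0 UNIV \<phi>" using assms unfolding smooth_def by blast
  then show "continuous_on A \<phi>" by (auto intro: continuous_on_subset)
qed

section \<open>Smooth functions of one variable, the factors of the test functions\<close>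

primrec Ck_line :: "nat \<Rightarrow> (real \<Rightarrow> real) \<Rightarrow> bool" where
  "Ck_line 0 f \<longleftrightarrow> continuous_on UNIV f"
| "Ck_line (Suc k) f \<longleftrightarrow> (\<exists>f'. (\<forall>x. (f has_real_derivative f' x) (at x)) \<and> Ck_line k f')"

lemma Ck_line_continuous: "Ck_line k f \<Longrightarrow> continuous_on UNIV f"
proof (cases k)
  case (Suc j)
  moreover assume "Ck_line k f"
  ultimately obtain f' where "\<And>x. (f has_real_derivative f' x) (at x)" by auto
  then show ?thesis by (rule DERIV_continuous_on)
qed simp

lemma Ck_line_Suc: "Ck_line (Suc k) f \<Longrightarrow> Ck_line k f"
proof (induction k arbitrary: f)
  case 0
  from Ck_line_continuous[OF this] show ?case by simp
next
  case (Suc k)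
  then obtain f' where f': "\<forall>x. (f has_real_derivative f' x) (at x)" "Ck_line (Suc k) f'"
    unfolding Ck_line.simps(2)[of "Suc k"] by blast
  with Suc.IH[OF f'(2)] show ?case unfolding Ck_line.simps(2)[of k f] by blast
qed

lemma Ck_line_add: "Ck_line k f \<Longrightarrow> Ck_line k g \<Longrightarrow> Ck_line k (\<lambda>x. f x + g x)"
proof (induction k arbitrary: f g)
  case 0
  then show ?case by (simp add: continuous_on_add)
next
  case (Suc k)
  then obtain f' g' where d: "\<forall>x. (f has_real_derivative f' x) (at x)" "Ck_line k f'"
    "\<forall>x. (g has_real_derivative g' x) (at x)" "Ck_line k g'" by auto
  then show ?case unfolding Ck_line.simps
    by (intro exI[of _ "\<lambda>x. f' x + g' x"] conjI allI Suc.IH DERIV_add) auto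
qed

lemma Ck_line_mult: "Ck_line k f \<Longrightarrow> Ck_line k g \<Longrightarrow> Ck_line k (\<lambda>x. f x * g x)"
proof (induction k arbitrary: f g)
  case 0
  then show ?case by (simp add: continuous_on_mult)
next
  case (Suc k)
  then obtain f' g' where d: "\<forall>x. (f has_real_derivative f' x) (at x)" "Ck_line k f'"
    "\<forall>x. (g has_real_derivative g' x) (at x)" "Ck_line k g'" by auto
  then show ?case unfolding Ck_line.simps
    by (intro exI[of _ "\<lambda>x. f x * g' x + f' x * g x"] conjI allI Suc.IH Ck_line_add DERIV_mult'
        Ck_line_Suc[OF Suc.prems(1)] Ck_line_Suc[OF Suc.prems(2)]) auto
qed

lemma Ck_line_const: "Ck_line k (\<lambda>_. c)"
proof (induction k arbitrary: c)
  case (Suc k)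
  then show ?case unfolding Ck_line.simps by (intro exI[of _ "\<lambda>_. 0"]) auto
qed simp

lemma Ck_line_affine: "Ck_line k f \<Longrightarrow> Ck_line k (\<lambda>x. f (c * x + d))"
proof (induction k arbitrary: f)
  case 0
  then show ?case by (auto intro!: continuous_on_compose2[of UNIV f] continuous_intros)
next
  case (Suc k)
  then obtain f' where d: "\<And>x. (f has_real_derivative f' x) (at x)" "Ck_line k f'" by auto
  have "((\<lambda>x. f (c * x + d)) has_real_derivative f' (c * x + d) * c) (at x)" for x
    by (rule DERIV_chain2[OF d(1)]) (auto intro!: derivative_eq_intros)
  moreover have "Ck_line k (\<lambda>x. f' (c * x + d) * c)" by (rule Ck_line_mult[OF Suc.IH[OF d(2)] Ck_line_const])
  ultimately show ?case unfolding Ck_line.simps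
    by (intro exI[of _ "\<lambda>x. f' (c * x + d) * c"] conjI allI)
qed

lemma Ck_line_diff: "Ck_line k f \<Longrightarrow> Ck_line k g \<Longrightarrow> Ck_line k (\<lambda>x. f x - g x)"
  using Ck_line_add[of k f "\<lambda>x. -1 * g x"] Ck_line_mult[OF Ck_line_const, of k g "-1"] by simp

lemma Ck_closure_ridge_line:
  assumes l: "bounded_linear l"
  shows "Ck_line k h \<Longrightarrow> Ck_closure k UNIV (\<lambda>p. h (l p))"
proof (induction k arbitrary: h)
  case 0
  then show ?case
    using continuous_on_compose2[OF _ linear_continuous_on[OF l], of UNIV h UNIV] by simp
next
  case (Suc k)
  then obtain h' where "\<And>x. (h has_real_derivative h' x) (at x)" "Ck_line k h'" by auto
  then show ?case
    by (intro Ck_closure_ridge_Suc[OF l] Suc.IH continuous_on_subset[OF Ck_line_continuous[OF Suc.prems]]) auto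
qed

lemma smooth_ridge_product:
  assumes "bounded_linear l1" "bounded_linear l2" "\<And>k. Ck_line k A" "\<And>k. Ck_line k B"
  shows "smooth (\<lambda>p. A (l1 p) * B (l2 p))"
  unfolding smooth_def using assms by (intro allI Ck_closure_mult Ck_closure_ridge_line)

text \<open>The polynomial parameter closes the family under differentiation: with
  \<open>t = 1 / x\<close>, the derivative of \<open>p(t) exp(-t)\<close> is
  \<open>t\<^sup>2 (p(t) - p'(t)) exp(-t)\<close>. All derivatives are thus obtained from a single
  lemma.\<close>

definition flat :: "real poly \<Rightarrow> real \<Rightarrow> real" where
  "flat p x = (if 0 < x then poly p (1 / x) * exp (- (1 / x)) else 0)"

lemma poly_div_exp_tendsto_0: "((\<lambda>t. poly p t / exp t) \<longlongrightarrow> (0::real)) at_top"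
proof -
  have "((\<lambda>t. \<Sum>i\<le>degree p. coeff p i * (t ^ i / exp t)) \<longlongrightarrow> (\<Sum>i\<le>degree p. coeff p i * 0)) at_top"
    by (intro tendsto_sum tendsto_mult tendsto_const tendsto_power_div_exp_0)
  then show ?thesis by (simp add: poly_altdef sum_divide_distrib)
qed

lemma flat_deriv: "(flat p has_real_derivative flat ([:0, 0, 1:] * (p - pderiv p)) x) (at x)"
proof -
  consider "0 < x" | "x < 0" | "x = 0" by linarith
  then show ?thesis
  proof cases
    case 1
    have "((\<lambda>x. poly p (1 / x) * exp (- (1 / x))) has_real_derivative
        poly (pderiv p) (1 / x) * (- 1 / x\<^sup>2) * exp (- (1 / x)) + exp (- (1 / x)) * (1 / x\<^sup>2) * poly p (1 / x)) (at x)"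
      using 1 by (auto intro!: derivative_eq_intros simp: power2_eq_square)
    moreover have "poly (pderiv p) (1 / x) * (- 1 / x\<^sup>2) * exp (- (1 / x)) + exp (- (1 / x)) * (1 / x\<^sup>2) * poly p (1 / x)
        = flat ([:0, 0, 1:] * (p - pderiv p)) x"
      using 1 by (simp add: flat_def power2_eq_square algebra_simps)
    ultimately have d: "((\<lambda>x. poly p (1 / x) * exp (- (1 / x))) has_real_derivative flat ([:0, 0, 1:] * (p - pderiv p)) x) (at x)"
      by simp
    show ?thesis
      by (rule has_field_derivative_transform_within_open[OF d, of "{0<..}"]) (use 1 in \<open>auto simp: flat_def\<close>)
  next
    case 2
    have "flat ([:0, 0, 1:] * (p - pderiv p)) x = 0" using 2 by (simp add: flat_def)
    moreover have "(flat p has_real_derivative 0) (at x)"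
      by (rule has_field_derivative_transform_within_open[OF DERIV_const[of 0], of "{..<0}"]) (use 2 in \<open>auto simp: flat_def\<close>)
    ultimately show ?thesis by simp
  next
    case 3
    have "((\<lambda>y. flat p y / y) \<longlongrightarrow> 0) (at (0::real))"
    proof (rule filterlim_split_at)
      show "((\<lambda>y. flat p y / y) \<longlongrightarrow> 0) (at_left (0::real))"
        by (rule tendsto_eventually) (auto simp: flat_def eventually_at_left_field intro: exI[of _ "-1"])
      \<comment> \<open>The quotient by \<open>y\<close> is absorbed by the additional factor
        \<open>1 / y\<close>, which is what \<open>pCons 0 p\<close> contributes.\<close>
      have "((\<lambda>y. poly (pCons 0 p) (inverse y) / exp (inverse y)) \<longlongrightarrow> 0) (at_right (0::real))"
        by (rule filterlim_compose[OF poly_div_exp_tendsto_0 filterlim_inverse_at_top_right])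
      moreover have "\<forall>\<^sub>F y in at_right (0::real). poly (pCons 0 p) (inverse y) / exp (inverse y) = flat p y / y"
        using eventually_at_right_less
        by eventually_elim (simp add: flat_def exp_minus inverse_eq_divide)
      ultimately show "((\<lambda>y. flat p y / y) \<longlongrightarrow> 0) (at_right (0::real))"
        by (rule Lim_transform_eventually)
    qed
    then show ?thesis using 3 by (simp add: has_field_derivative_iff flat_def)
  qed
qed

lemma Ck_line_flat: "Ck_line k (flat p)"
proof (induction k arbitrary: p)
  case 0
  have "continuous_on UNIV (flat p)" by (rule DERIV_continuous_on) (rule flat_deriv)
  then show ?case by simp
next
  case (Suc k)
  then show ?case using flat_deriv unfolding Ck_line.simps by blast
qed

text \<open>Positive on (-1, 1) and zero elsewhere. The arguments have the form
  \<open>c * t + d\<close> expected by \<open>Ck_line_affine\<close>.\<close>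

definition bump :: "real \<Rightarrow> real" where "bump t = flat 1 (1 * t + 1) * flat 1 (-1 * t + 1)"

lemma Ck_line_bump: "Ck_line k bump"
  unfolding bump_def[abs_def] by (intro Ck_line_mult Ck_line_affine Ck_line_flat)

lemma bump_nonneg: "0 \<le> bump t" and bump_0: "0 < bump 0" and bump_outside: "1 \<le> \<bar>t\<bar> \<Longrightarrow> bump t = 0"
  by (auto simp: bump_def flat_def)

text \<open>Constant on either side of the support of the bump, so a difference of two translates
  has compact support. Such a difference is a test factor whose derivative is a difference of two
  bumps.\<close>

lemma bump_antiderivative:
  obtains G where "\<And>t. (G has_real_derivative bump t) (at t)" "\<And>t. t \<le> -1 \<Longrightarrow> G t = 0"
    "\<And>t. 1 \<le> t \<Longrightarrow> G t = G 1" "\<And>k. Ck_line k G"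
proof -
  have "\<exists>F. \<forall>x::real. -\<infinity> < ereal x \<longrightarrow> ereal x < \<infinity> \<longrightarrow> (F has_vector_derivative bump x) (at x)"
    using Ck_line_continuous[OF Ck_line_bump[of 0]]
    by (intro einterval_antiderivative) (auto simp: continuous_on_eq_continuous_at)
  then obtain F where F: "\<And>x. (F has_real_derivative bump x) (at x)"
    by (auto simp: has_real_derivative_iff_has_vector_derivative)
  define G where "G t = F t - F (-1)" for t
  have G: "(G has_real_derivative bump t) (at t)" for t
    unfolding G_def[abs_def] using DERIV_diff[OF F DERIV_const] by simp
  have 0: "(G has_real_derivative 0) (at t within A)" if "1 \<le> \<bar>t\<bar>" for t A
    using has_field_derivative_at_within[OF G[of t], of A] bump_outside[OF that] by simp
  have left: "\<exists>c. \<forall>t\<in>{..-1}. G t = c"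
    by (rule has_field_derivative_zero_constant) (auto intro!: 0)
  have right: "\<exists>c. \<forall>t\<in>{1..}. G t = c"
    by (rule has_field_derivative_zero_constant) (auto intro!: 0)
  have "Ck_line k G" for k
  proof (cases k)
    case 0
    then show ?thesis using DERIV_continuous_on[OF has_field_derivative_at_within[OF G]] by simp
  qed (use G Ck_line_bump in auto)
  moreover have "G (-1) = 0" by (simp add: G_def)
  ultimately show ?thesis using that[OF G] left right by (metis atLeast_iff atMost_iff order_refl)
qed

section \<open>Weak derivatives\<close>

lemma compact_support_integrable:
  fixes h :: "real \<times> real \<Rightarrow> real"
  assumes "continuous_on UNIV h" "compact K" "\<And>p. p \<notin> K \<Longrightarrow> h p = 0"
  shows "integrable lborel h"
proof -
  have "integrable lborel (\<lambda>p. indicator K p *\<^sub>R h p)"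
    by (rule borel_integrable_compact[OF assms(2) continuous_on_subset[OF assms(1) subset_UNIV]])
  also have "(\<lambda>p. indicator K p *\<^sub>R h p) = h"
  proof
    show "indicator K p *\<^sub>R h p = h p" for p using assms(3)[of p] by (cases "p \<in> K") simp_all
  qed
  finally show ?thesis .
qed

lemma integral_slice_zero:
  fixes f f' :: "real \<Rightarrow> real"
  assumes d: "\<And>x. (f has_real_derivative f' x) (at x)" and c: "continuous_on UNIV f'"
    and R: "\<And>x. R \<le> \<bar>x\<bar> \<Longrightarrow> f x = 0" "\<And>x. R \<le> \<bar>x\<bar> \<Longrightarrow> f' x = 0" "0 < R"
  shows "(\<integral>x. f' x \<partial>lborel) = 0"
proof -
  have "(\<integral>x. f' x * indicator {-R..R} x \<partial>lborel) = f R - f (-R)"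
    by (rule integral_FTC_Icc_real) (use d c R in \<open>auto simp: continuous_on_eq_continuous_at\<close>)
  moreover have "(\<lambda>x. f' x * indicator {-R..R} x) = f'"
  proof
    show "f' x * indicator {-R..R} x = f' x" for x using R(2)[of x] by (cases "R \<le> \<bar>x\<bar>") (auto simp: indicator_def)
  qed
  ultimately show ?thesis using R by simp
qed

lemma integral_directional_derivative_zero:
  fixes f f' :: "real \<times> real \<Rightarrow> real"
  assumes e: "e = (1, 0) \<or> e = (0, 1)"
    and d: "\<And>p. ((\<lambda>t. f (p + t *\<^sub>R e)) has_real_derivative f' p) (at 0)"
    and c: "continuous_on UNIV f'" and K: "compact K"
    and z: "\<And>p. p \<notin> K \<Longrightarrow> f p = 0" "\<And>p. p \<notin> K \<Longrightarrow> f' p = 0"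
  shows "(\<integral>p. f' p \<partial>lborel) = 0"
proof -
  have int: "integrable lborel f'" by (rule compact_support_integrable[OF c K z(2)])
  obtain R where R: "0 < R" "\<And>p. p \<in> K \<Longrightarrow> norm p < R"
    using compact_imp_bounded[OF K] unfolding bounded_pos_less by blast
  have off: "(x, y) \<notin> K" if "R \<le> \<bar>x\<bar> \<or> R \<le> \<bar>y\<bar>" for x y
    using that R(2)[of "(x, y)"] norm_fst_le[of x y] norm_snd_le[of y x] by (auto simp: not_less)
  have cs: "continuous_on UNIV (\<lambda>x. f' (x, y))" "continuous_on UNIV (\<lambda>x. f' (y, x))" for y
    by (auto intro!: continuous_on_compose2[OF c] continuous_intros)
  from e show ?thesis
  proof
    assume e: "e = (1, 0)"
    have "((\<lambda>t. f (t, y)) has_real_derivative f' (x, y)) (at x)" for x y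
      using d[of "(x, y)"] DERIV_shift[of "\<lambda>t. f (t, y)" "f' (x, y)" 0 x] by (simp add: e add.commute)
    then have "(\<integral>x. f' (x, y) \<partial>lborel) = 0" for y
      by (rule integral_slice_zero[where R = R]) (use cs R off z in auto)
    then have "(\<integral>y. (\<integral>x. f' (x, y) \<partial>lborel) \<partial>lborel) = 0" by simp
    moreover have "integrable (lborel \<Otimes>\<^sub>M lborel) (case_prod (\<lambda>x y. f' (x, y)))"
      using int by (simp add: lborel_prod)
    ultimately show ?thesis using lborel_pair.integral_snd[of "\<lambda>x y. f' (x, y)"] by (simp add: lborel_prod)
  next
    assume e: "e = (0, 1)"
    have "((\<lambda>t. f (x, t)) has_real_derivative f' (x, y)) (at y)" for x y
      using d[of "(x, y)"] DERIV_shift[of "\<lambda>t. f (x, t)" "f' (x, y)" 0 y] by (simp add: e add.commute)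
    then have "(\<integral>y. f' (x, y) \<partial>lborel) = 0" for x
      by (rule integral_slice_zero[where R = R]) (use cs R off z in auto)
    then have "(\<integral>x. (\<integral>y. f' (x, y) \<partial>lborel) \<partial>lborel) = 0" by simp
    moreover have "integrable (lborel \<Otimes>\<^sub>M lborel) f'"
      using int by (simp add: lborel_prod)
    ultimately show ?thesis using lborel_pair.integral_fst'[of f'] by (simp add: lborel_prod)
  qed
qed

text \<open>\<open>f\<close> is controlled on \<open>D\<close> only. The product is continuous on
  the open sets \<open>D\<close> and \<open>- K\<close>, on the second because it vanishes there,
  and these cover the plane.\<close>

lemma continuous_extension_by_zero:
  fixes f \<theta> :: "real \<times> real \<Rightarrow> real"
  assumes D: "open D" and K: "compact K" "K \<subseteq> D" and f: "continuous_on D f"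
    and \<theta>: "continuous_on UNIV \<theta>" "\<And>p. p \<notin> K \<Longrightarrow> \<theta> p = 0"
  shows "continuous_on UNIV (\<lambda>p. indicator D p *\<^sub>R (f p * \<theta> p))"
proof -
  have "continuous_on D (\<lambda>p. indicator D p *\<^sub>R (f p * \<theta> p)) \<longleftrightarrow> continuous_on D (\<lambda>p. f p * \<theta> p)"
    by (rule continuous_on_cong) auto
  moreover have "continuous_on D (\<lambda>p. f p * \<theta> p)"
    by (intro continuous_on_mult f continuous_on_subset[OF \<theta>(1)]) simp
  moreover have "continuous_on (- K) (\<lambda>p. indicator D p *\<^sub>R (f p * \<theta> p)) \<longleftrightarrow> continuous_on (- K) (\<lambda>_. 0 :: real)"
  proof (rule continuous_on_cong[OF refl])
    show "indicator D p *\<^sub>R (f p * \<theta> p) = 0" if "p \<in> - K" for p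
      using \<theta>(2)[of p] that by simp
  qed
  ultimately have "continuous_on (D \<union> - K) (\<lambda>p. indicator D p *\<^sub>R (f p * \<theta> p))"
    using K(1) D by (intro continuous_on_open_Un) (auto simp: compact_imp_closed open_Compl)
  moreover have "D \<union> - K = UNIV" using K(2) by blast
  ultimately show ?thesis by simp
qed

lemma set_integrable_compact_support:
  fixes f \<theta> :: "real \<times> real \<Rightarrow> real"
  assumes D: "open D" and K: "compact K" "K \<subseteq> D" and f: "continuous_on D f"
    and \<theta>: "continuous_on UNIV \<theta>" "\<And>p. p \<notin> K \<Longrightarrow> \<theta> p = 0"
  shows "set_integrable lborel D (\<lambda>p. f p * \<theta> p)"
  unfolding set_integrable_def
proof (rule compact_support_integrable[OF continuous_extension_by_zero[OF D K f \<theta>] K(1)])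
  show "indicator D p *\<^sub>R (f p * \<theta> p) = 0" if "p \<notin> K" for p using \<theta>(2)[OF that] by simp
qed

lemma open_line_preimage:
  fixes D :: "(real \<times> real) set"
  assumes "open D"
  shows "open {t::real. p + t *\<^sub>R e \<in> D}"
  using open_vimage[OF assms, of "\<lambda>t. p + t *\<^sub>R e"] by (simp add: vimage_def continuous_intros)

lemma directional_derivative_outside_support:
  fixes \<theta> :: "real \<times> real \<Rightarrow> real"
  assumes K: "closed K" and z: "\<And>p. p \<notin> K \<Longrightarrow> \<theta> p = 0"
    and d: "((\<lambda>t. \<theta> (p + t *\<^sub>R e)) has_real_derivative y) (at 0)" and p: "p \<notin> K"
  shows "y = 0"
proof -
  have "((\<lambda>t. \<theta> (p + t *\<^sub>R e)) has_real_derivative 0) (at 0)"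
    by (rule has_field_derivative_transform_within_open[OF DERIV_const[of 0] open_line_preimage[of "- K" p e]])
       (use K p z in auto)
  with d show ?thesis by (rule DERIV_unique)
qed

text \<open>The product of \<open>f\<close> and \<open>\<theta>\<close>, extended by zero, has the
  derivative \<open>h'\<close> along \<open>e\<close>, whose integral vanishes. Derivatives are
  assumed along the one direction \<open>e\<close> only, which admits functions that are merely
  continuous in the other variable.\<close>

lemma integration_by_parts:
  fixes f f' \<theta> \<theta>' :: "real \<times> real \<Rightarrow> real"
  assumes e: "e = (1, 0) \<or> e = (0, 1)" and D: "open D" and K: "compact K" "K \<subseteq> D"
    and f: "\<And>p. p \<in> D \<Longrightarrow> ((\<lambda>t. f (p + t *\<^sub>R e)) has_real_derivative f' p) (at 0)"
      "continuous_on D f" "continuous_on D f'"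
    and \<theta>: "\<And>p. ((\<lambda>t. \<theta> (p + t *\<^sub>R e)) has_real_derivative \<theta>' p) (at 0)"
      "continuous_on UNIV \<theta>" "continuous_on UNIV \<theta>'" "\<And>p. p \<notin> K \<Longrightarrow> \<theta> p = 0"
  shows "(LINT p:D|lborel. f p * \<theta>' p) = - (LINT p:D|lborel. f' p * \<theta> p)"
proof -
  have \<theta>'0: "\<theta>' p = 0" if "p \<notin> K" for p
    using directional_derivative_outside_support[OF compact_imp_closed[OF K(1)] \<theta>(4) \<theta>(1) that] .
  define h where "h p = indicator D p *\<^sub>R (f p * \<theta> p)" for p
  define h' where "h' p = indicator D p *\<^sub>R (f p * \<theta>' p) + indicator D p *\<^sub>R (f' p * \<theta> p)" for p
  have "(\<integral>p. h' p \<partial>lborel) = 0"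
  proof (rule integral_directional_derivative_zero[OF e _ _ K(1)])
    show "continuous_on UNIV h'" unfolding h'_def
      by (intro continuous_on_add continuous_extension_by_zero[OF D K] f \<theta> \<theta>'0)
    show "h p = 0" "h' p = 0" if "p \<notin> K" for p using that by (simp_all add: h_def h'_def \<theta>(4) \<theta>'0)
    fix p
    show "((\<lambda>t. h (p + t *\<^sub>R e)) has_real_derivative h' p) (at 0)"
    proof (cases "p \<in> D")
      case True
      have "((\<lambda>t. f (p + t *\<^sub>R e) * \<theta> (p + t *\<^sub>R e)) has_real_derivative f (p + 0 *\<^sub>R e) * \<theta>' p + f' p * \<theta> (p + 0 *\<^sub>R e)) (at 0)"
        by (rule DERIV_mult'[OF f(1)[OF True] \<theta>(1)])
      then have d: "((\<lambda>t. f (p + t *\<^sub>R e) * \<theta> (p + t *\<^sub>R e)) has_real_derivative h' p) (at 0)"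
        using True by (simp add: h'_def)
      show ?thesis
        by (rule has_field_derivative_transform_within_open[OF d open_line_preimage[OF D, of p e]])
           (use True in \<open>auto simp: h_def\<close>)
    next
      case False
      then have p: "p \<notin> K" using K(2) by blast
      have "h' p = 0" using False by (simp add: h'_def)
      moreover have "((\<lambda>t. h (p + t *\<^sub>R e)) has_real_derivative 0) (at 0)"
        by (rule has_field_derivative_transform_within_open[OF DERIV_const[of 0] open_line_preimage[of "- K" p e]])
           (use compact_imp_closed[OF K(1)] p \<theta>(4) in \<open>auto simp: h_def\<close>)
      ultimately show ?thesis by simp
    qed
  qed
  moreover have "(\<integral>p. h' p \<partial>lborel) = (LINT p:D|lborel. f p * \<theta>' p) + (LINT p:D|lborel. f' p * \<theta> p)"
    unfolding h'_def set_lebesgue_integral_def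
    by (intro Bochner_Integration.integral_add)
       (use set_integrable_compact_support[OF D K f(2) \<theta>(3) \<theta>'0] set_integrable_compact_support[OF D K f(3) \<theta>(2,4)]
         in \<open>simp_all add: set_integrable_def\<close>)
  ultimately show ?thesis by simp
qed

lemma directional_partials:
  assumes "f differentiable (at p)"
  shows "((\<lambda>t. f (p + t *\<^sub>R (1, 0))) has_real_derivative partial_x f p) (at 0)"
    "((\<lambda>t. f (p + t *\<^sub>R (0, 1))) has_real_derivative partial_y f p) (at 0)"
proof -
  note d = has_derivative_partials[OF assms]
  have "((\<lambda>t. p + t *\<^sub>R e) has_derivative (\<lambda>h. h *\<^sub>R e)) (at 0)" for e :: "real \<times> real"
    by (auto intro!: derivative_eq_intros)
  have "((\<lambda>t. f (p + t *\<^sub>R e)) has_derivative (\<lambda>h. fst (h *\<^sub>R e) * partial_x f p + snd (h *\<^sub>R e) * partial_y f p)) (at 0)"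
    for e by (rule has_derivative_compose[OF \<open>\<And>e. ((\<lambda>t. p + t *\<^sub>R e) has_derivative (\<lambda>h. h *\<^sub>R e)) (at 0)\<close>[of e]]) (simp add: d)
  from this[of "(1, 0)"] this[of "(0, 1)"]
  have "((\<lambda>t. f (p + t *\<^sub>R (1, 0))) has_derivative (\<lambda>h. h * partial_x f p)) (at 0)"
    "((\<lambda>t. f (p + t *\<^sub>R (0, 1))) has_derivative (\<lambda>h. h * partial_y f p)) (at 0)" by simp_all
  moreover have "(\<lambda>h. h * c) = (*) c" for c :: real by auto
  ultimately show "((\<lambda>t. f (p + t *\<^sub>R (1, 0))) has_real_derivative partial_x f p) (at 0)"
    "((\<lambda>t. f (p + t *\<^sub>R (0, 1))) has_real_derivative partial_y f p) (at 0)"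
    unfolding has_field_derivative_def by (simp_all only:)
qed

lemma partials_outside_support:
  assumes "smooth \<theta>" "closed K" "\<And>p. p \<notin> K \<Longrightarrow> \<theta> p = 0" "p \<notin> K"
  shows "partial_x \<theta> p = 0" "partial_y \<theta> p = 0"
  by (rule directional_derivative_outside_support[OF assms(2) _ directional_partials(1)[OF smoothD(1)[OF assms(1)]] assms(4)];
      rule assms(3); assumption)
     (rule directional_derivative_outside_support[OF assms(2) _ directional_partials(2)[OF smoothD(1)[OF assms(1)]] assms(4)];
      rule assms(3); assumption)

lemma smooth_directional:
  assumes "smooth \<theta>"
  shows "((\<lambda>t. \<theta> (p + t *\<^sub>R (1, 0))) has_real_derivative partial_x \<theta> p) (at 0)"
    "((\<lambda>t. \<theta> (p + t *\<^sub>R (0, 1))) has_real_derivative partial_y \<theta> p) (at 0)"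
  by (rule directional_partials[OF smoothD(1)[OF assms]])+

lemma test_functionD:
  assumes "test_function D \<phi>"
  obtains K where "smooth \<phi>" "compact K" "K \<subseteq> D" "\<And>p. p \<notin> K \<Longrightarrow> \<phi> p = 0"
proof (rule that[of "closure {p. \<phi> p \<noteq> 0}"])
  show "\<phi> p = 0" if "p \<notin> closure {p. \<phi> p \<noteq> 0}" for p
    using that closure_subset[of "{p. \<phi> p \<noteq> 0}"] by blast
  show "smooth \<phi>" "compact (closure {p. \<phi> p \<noteq> 0})" "closure {p. \<phi> p \<noteq> 0} \<subseteq> D"
    using assms unfolding test_function_def smooth_def by blast+
qed

text \<open>Moving the first-order operator onto \<open>u\<close> leaves a function of
  \<open>x\<close> plus a function of \<open>y\<close>. The \<open>x\<close> derivative then removes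
  \<open>B\<close>, and the rest does not depend on \<open>y\<close>, so the \<open>y\<close>
  derivative removes it.\<close>

lemma weak_solution:
  fixes u ux uy :: "real \<times> real \<Rightarrow> real" and A A' B :: "real \<Rightarrow> real"
  assumes D: "open D"
    and u: "\<And>p. p \<in> D \<Longrightarrow> ((\<lambda>t. u (p + t *\<^sub>R (1, 0))) has_real_derivative ux p) (at 0)"
      "\<And>p. p \<in> D \<Longrightarrow> ((\<lambda>t. u (p + t *\<^sub>R (0, 1))) has_real_derivative uy p) (at 0)"
      "continuous_on D u" "continuous_on D ux" "continuous_on D uy"
    and eq: "\<And>p. p \<in> D \<Longrightarrow> m * ux p + n * uy p = A (fst p) + B (snd p)"
    and A: "\<And>p. p \<in> D \<Longrightarrow> (A has_real_derivative A' (fst p)) (at (fst p))"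
      "continuous_on D (\<lambda>p. A (fst p))" "continuous_on D (\<lambda>p. A' (fst p))" "continuous_on D (\<lambda>p. B (snd p))"
    and \<phi>: "test_function D \<phi>"
  shows "(LINT p:D|lborel. u p * diff_op m n \<phi> p) = 0"
proof -
  obtain K where s: "smooth \<phi>" and K: "compact K" "K \<subseteq> D" and z: "\<And>p. p \<notin> K \<Longrightarrow> \<phi> p = 0"
    using test_functionD[OF \<phi>] by metis
  note cK = compact_imp_closed[OF K(1)]
  define \<psi> where "\<psi> = partial_y \<phi>"
  define P where "P = partial_x \<psi>"
  have \<psi>: "smooth \<psi>" "\<And>p. p \<notin> K \<Longrightarrow> \<psi> p = 0"
    using smoothD(4)[OF s] partials_outside_support(2)[OF s cK z] unfolding \<psi>_def by auto
  have P: "smooth P" "\<And>p. p \<notin> K \<Longrightarrow> P p = 0"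
    using smoothD(3)[OF \<psi>(1)] partials_outside_support(1)[OF \<psi>(1) cK \<psi>(2)] unfolding P_def by auto
  have dP: "smooth (partial_x P)" "smooth (partial_y P)" "\<And>p. p \<notin> K \<Longrightarrow> partial_x P p = 0" "\<And>p. p \<notin> K \<Longrightarrow> partial_y P p = 0"
    using smoothD(3,4)[OF P(1)] partials_outside_support[OF P(1) cK P(2)] by auto
  note int = set_integrable_compact_support[OF D K]
  have "(LINT p:D|lborel. u p * diff_op m n \<phi> p) = (LINT p:D|lborel. m * (u p * partial_x P p) + n * (u p * partial_y P p))"
    by (simp add: diff_op_def P_def \<psi>_def algebra_simps)
  also have "\<dots> = m * (LINT p:D|lborel. u p * partial_x P p) + n * (LINT p:D|lborel. u p * partial_y P p)"
    by (subst set_integral_add)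
       (auto intro!: set_integrable_mult_right int u(3) smoothD(2)[OF dP(1)] smoothD(2)[OF dP(2)] dP(3,4))
  also have "(LINT p:D|lborel. u p * partial_x P p) = - (LINT p:D|lborel. ux p * P p)"
    by (rule integration_by_parts[OF _ D K u(1,3,4)])
       (simp, (rule smooth_directional[OF P(1)] smoothD(2)[OF P(1)] smoothD(2)[OF dP(1)] P(2) | assumption)+)
  also have "(LINT p:D|lborel. u p * partial_y P p) = - (LINT p:D|lborel. uy p * P p)"
    by (rule integration_by_parts[OF _ D K u(2,3,5)])
       (simp, (rule smooth_directional[OF P(1)] smoothD(2)[OF P(1)] smoothD(2)[OF dP(2)] P(2) | assumption)+)
  also have "m * - (LINT p:D|lborel. ux p * P p) + n * - (LINT p:D|lborel. uy p * P p) =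
      - (LINT p:D|lborel. m * (ux p * P p) + n * (uy p * P p))"
    by (subst set_integral_add)
       (auto intro!: set_integrable_mult_right int u(4,5) smoothD(2)[OF P(1)] P(2))
  also have "(LINT p:D|lborel. m * (ux p * P p) + n * (uy p * P p)) = (LINT p:D|lborel. (A (fst p) + B (snd p)) * P p)"
  proof (rule set_lebesgue_integral_cong)
    show "D \<in> sets lborel" using D by simp
    show "\<forall>p. p \<in> D \<longrightarrow> m * (ux p * P p) + n * (uy p * P p) = (A (fst p) + B (snd p)) * P p"
      using eq by (auto simp flip: eq simp: algebra_simps)
  qed
  also have "\<dots> = - (LINT p:D|lborel. A' (fst p) * \<psi> p)"
    unfolding P_def
  proof (rule integration_by_parts[OF _ D K])
    fix p assume p: "p \<in> D"
    have "((\<lambda>t. A (t + fst p)) has_real_derivative A' (fst p)) (at 0)"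
      using A(1)[OF p] DERIV_shift[of A "A' (fst p)" 0 "fst p"] by simp
    from DERIV_add[OF this DERIV_const[of "B (snd p)"]]
    show "((\<lambda>t. A (fst (p + t *\<^sub>R (1, 0))) + B (snd (p + t *\<^sub>R (1, 0)))) has_real_derivative A' (fst p)) (at 0)"
      by (simp add: add.commute)
  qed (simp, (rule continuous_on_add A(2-4) \<psi>(2) smoothD(2)[OF \<psi>(1)] smoothD(2)[OF P(1)[unfolded P_def]]
      smooth_directional[OF \<psi>(1)] | assumption)+)
  \<comment> \<open>Nothing beyond continuity is known of \<open>A'\<close>; the direction
    \<open>(0, 1)\<close> suffices, along which \<open>A' (fst p)\<close> is constant.\<close>
  also have "(LINT p:D|lborel. A' (fst p) * \<psi> p) = - (LINT p:D|lborel. 0 * \<phi> p)"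
    unfolding \<psi>_def
    by (rule integration_by_parts[where e = "(0, 1)", OF _ D K])
       (simp, simp, (rule A(3) z smoothD(2)[OF s] smoothD(2)[OF \<psi>(1)[unfolded \<psi>_def]] smooth_directional[OF s]
          continuous_on_const | assumption)+)
  finally show ?thesis by simp
qed

lemma mixed_derivative_by_parts:
  assumes D: "open D" and K: "compact K" "K \<subseteq> D"
    and v: "\<And>p. p \<in> D \<Longrightarrow> v differentiable (at p)" "continuous_on D v"
    and vx: "\<And>p. p \<in> D \<Longrightarrow> vx p = partial_x v p" "\<And>p. p \<in> D \<Longrightarrow> vx differentiable (at p)" "continuous_on D vx"
    and w: "\<And>p. p \<in> D \<Longrightarrow> w p = partial_y vx p" "continuous_on D w"
    and \<theta>: "smooth \<theta>" "\<And>p. p \<notin> K \<Longrightarrow> \<theta> p = 0"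
  shows "(LINT p:D|lborel. v p * partial_x (partial_y \<theta>) p) = (LINT p:D|lborel. w p * \<theta> p)"
proof -
  have \<psi>: "smooth (partial_y \<theta>)" "\<And>p. p \<notin> K \<Longrightarrow> partial_y \<theta> p = 0"
    using smoothD(4)[OF \<theta>(1)] partials_outside_support(2)[OF \<theta>(1) compact_imp_closed[OF K(1)] \<theta>(2)] by auto
  have "(LINT p:D|lborel. v p * partial_x (partial_y \<theta>) p) = - (LINT p:D|lborel. vx p * partial_y \<theta> p)"
  proof (rule integration_by_parts[OF _ D K])
    show "((\<lambda>t. v (p + t *\<^sub>R (1, 0))) has_real_derivative vx p) (at 0)" if "p \<in> D" for p
      using directional_partials(1)[OF v(1)[OF that]] vx(1)[OF that] by simp
  qed (simp, (rule v(2) vx(3) \<psi>(2) smoothD(2)[OF \<psi>(1)] smoothD(2)[OF smoothD(3)[OF \<psi>(1)]]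
      smooth_directional[OF \<psi>(1)] | assumption)+)
  also have "(LINT p:D|lborel. vx p * partial_y \<theta> p) = - (LINT p:D|lborel. w p * \<theta> p)"
  proof (rule integration_by_parts[OF _ D K])
    show "((\<lambda>t. vx (p + t *\<^sub>R (0, 1))) has_real_derivative w p) (at 0)" if "p \<in> D" for p
      using directional_partials(2)[OF vx(2)[OF that]] w(1)[OF that] by simp
  qed (simp, (rule vx(3) w(2) \<theta>(2) smoothD(2)[OF \<theta>(1)] smoothD(2)[OF \<psi>(1)]
      smooth_directional[OF \<theta>(1)] | assumption)+)
  finally show ?thesis by simp
qed

section \<open>Transport along characteristics by adapted test functions\<close>

lemma ridge_product_has_derivative:
  assumes l: "bounded_linear l1" "bounded_linear l2"
    and A: "\<And>t. (A has_real_derivative A' t) (at t)" and B: "\<And>t. (B has_real_derivative B' t) (at t)"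
  shows "((\<lambda>p. A (l1 p) * B (l2 p)) has_derivative
     (\<lambda>v. l1 v * (A' (l1 p) * B (l2 p)) + l2 v * (A (l1 p) * B' (l2 p)))) (at p)"
  using has_derivative_mult[OF ridge_has_derivative[OF l(1) A] ridge_has_derivative[OF l(2) B], of p]
  by (simp add: algebra_simps)

text \<open>The first-order operator annihilates \<open>l1\<close> and maps \<open>l2\<close> to 1,
  so it turns \<open>A (l1 p) * B (l2 p)\<close> into \<open>A (l1 p) * B' (l2 p)\<close>. Both
  sides are expanded explicitly, which avoids interchanging derivatives.\<close>

lemma diff_op_ridge_product:
  assumes l: "bounded_linear l1" "bounded_linear l2"
    and L: "m * l1 (1, 0) + n * l1 (0, 1) = 0" "m * l2 (1, 0) + n * l2 (0, 1) = 1"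
    and A: "\<And>k. Ck_line k A" and B: "\<And>t. (B has_real_derivative B' t) (at t)" and B': "\<And>k. Ck_line k B'"
  shows "diff_op m n (\<lambda>p. A (l1 p) * B (l2 p)) p = partial_x (partial_y (\<lambda>p. A (l1 p) * B' (l2 p))) p"
proof -
  obtain A1 A2 A3 where A: "\<And>t. (A has_real_derivative A1 t) (at t)" "\<And>t. (A1 has_real_derivative A2 t) (at t)"
    "\<And>t. (A2 has_real_derivative A3 t) (at t)"
    using A[of "Suc (Suc (Suc 0))"] unfolding Ck_line.simps by blast
  obtain B2 B3 where B': "\<And>t. (B' has_real_derivative B2 t) (at t)" "\<And>t. (B2 has_real_derivative B3 t) (at t)"
    using B'[of "Suc (Suc 0)"] unfolding Ck_line.simps by blast
  note R = ridge_product_has_derivative[OF l]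
  have y: "partial_y (\<lambda>p. f (l1 p) * h (l2 p)) =
      (\<lambda>p. l1 (0, 1) * (f1 (l1 p) * h (l2 p)) + l2 (0, 1) * (f (l1 p) * h1 (l2 p)))"
    if "\<And>t. (f has_real_derivative f1 t) (at t)" "\<And>t. (h has_real_derivative h1 t) (at t)" for f f1 h h1
    using partial_eqI(2)[OF R[OF that]] by auto
  have xy: "partial_x (partial_y (\<lambda>p. f (l1 p) * h (l2 p))) =
      (\<lambda>p. l1 (0, 1) * (l1 (1, 0) * (f2 (l1 p) * h (l2 p)) + l2 (1, 0) * (f1 (l1 p) * h1 (l2 p)))
         + l2 (0, 1) * (l1 (1, 0) * (f1 (l1 p) * h1 (l2 p)) + l2 (1, 0) * (f (l1 p) * h2 (l2 p))))"
    if "\<And>t. (f has_real_derivative f1 t) (at t)" "\<And>t. (f1 has_real_derivative f2 t) (at t)"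
      "\<And>t. (h has_real_derivative h1 t) (at t)" "\<And>t. (h1 has_real_derivative h2 t) (at t)" for f f1 f2 h h1 h2
    unfolding y[OF that(1,3)]
    using partial_eqI(1)[OF has_derivative_add[OF has_derivative_mult_right[OF R[OF that(2,3)], of "l1 (0, 1)"]
        has_derivative_mult_right[OF R[OF that(1,4)], of "l2 (0, 1)"]]] by auto
  have d: "((\<lambda>p. l1 (0, 1) * (l1 (1, 0) * (A2 (l1 p) * B (l2 p)) + l2 (1, 0) * (A1 (l1 p) * B' (l2 p)))
         + l2 (0, 1) * (l1 (1, 0) * (A1 (l1 p) * B' (l2 p)) + l2 (1, 0) * (A (l1 p) * B2 (l2 p)))) has_derivative
      (\<lambda>v. l1 (0, 1) * (l1 (1, 0) * (l1 v * (A3 (l1 p) * B (l2 p)) + l2 v * (A2 (l1 p) * B' (l2 p)))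
            + l2 (1, 0) * (l1 v * (A2 (l1 p) * B' (l2 p)) + l2 v * (A1 (l1 p) * B2 (l2 p))))
         + l2 (0, 1) * (l1 (1, 0) * (l1 v * (A2 (l1 p) * B' (l2 p)) + l2 v * (A1 (l1 p) * B2 (l2 p)))
            + l2 (1, 0) * (l1 v * (A1 (l1 p) * B2 (l2 p)) + l2 v * (A (l1 p) * B3 (l2 p)))))) (at p)"
    by (intro has_derivative_add has_derivative_mult_right R A B B')
  show ?thesis
    unfolding diff_op_def xy[OF A(1,2) B B'(1)] xy[OF A(1,2) B'] partial_eqI[OF d]
    using L by algebra
qed

text \<open>A du Bois-Reymond argument in the coordinates \<open>l1\<close>, constant along
  \<open>(m, n)\<close>, and \<open>l2\<close>, which grows there at unit speed. The test is a bump
  in \<open>l1\<close> times a difference of two bumps in \<open>l2\<close>, centred at the two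
  points. It equates two local averages of \<open>w\<close>, and shrinking supports equate the
  values.\<close>

lemma constant_along_characteristic:
  fixes m n :: real and D :: "(real \<times> real) set" and w :: "real \<times> real \<Rightarrow> real"
  defines "l1 \<equiv> \<lambda>p. n * fst p - m * snd p" and "l2 \<equiv> \<lambda>p. fst p / (2 * m) + snd p / (2 * n)"
  assumes m: "0 < m" and n: "0 < n" and D: "open D" and w: "continuous_on D w"
    and orth: "\<And>A B B' K. (\<And>k. Ck_line k A) \<Longrightarrow> (\<And>k. Ck_line k B) \<Longrightarrow> (\<And>k. Ck_line k B') \<Longrightarrow>
        (\<And>t. (B has_real_derivative B' t) (at t)) \<Longrightarrow> compact K \<Longrightarrow> K \<subseteq> D \<Longrightarrow>
        (\<And>p. p \<notin> K \<Longrightarrow> A (l1 p) * B (l2 p) = 0) \<Longrightarrow> (\<And>p. p \<notin> K \<Longrightarrow> A (l1 p) * B' (l2 p) = 0) \<Longrightarrow>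
        (LINT p:D|lborel. w p * (A (l1 p) * B' (l2 p))) = 0"
    and \<tau>: "0 < \<tau>" and seg: "\<And>t. 0 \<le> t \<Longrightarrow> t \<le> \<tau> \<Longrightarrow> p0 + t *\<^sub>R (m, n) \<in> D"
  shows "w (p0 + \<tau> *\<^sub>R (m, n)) = w p0"
proof -
  define p1 where "p1 = p0 + \<tau> *\<^sub>R (m, n)"
  define s0 where "s0 = l1 p0"
  define r0 where "r0 = l2 p0"
  define r1 where "r1 = r0 + \<tau>"
  \<comment> \<open>The inverse of the change of coordinates \<open>(l1, l2)\<close>; the constant
    \<open>C\<close> below is a Lipschitz bound for it.\<close>
  define Mp where "Mp z = (fst z / (2 * n) + m * snd z, - fst z / (2 * m) + n * snd z)" for z :: "real \<times> real"
  have inv: "p = Mp (l1 p, l2 p)" "l1 (Mp z) = fst z" "l2 (Mp z) = snd z" for p z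
    using m n by (auto simp: Mp_def l1_def l2_def prod_eq_iff field_simps)
  have l1lin: "l1 (p + t *\<^sub>R (m, n)) = l1 p" and l2lin: "l2 (p + t *\<^sub>R (m, n)) = l2 p + t" for p t
    using m n by (auto simp: l1_def l2_def field_simps)
  have p1: "l1 p1 = s0" "l2 p1 = r1"
    unfolding p1_def l1lin l2lin s0_def r0_def r1_def by (rule refl)+
  have pD: "p0 \<in> D" "p1 \<in> D" using seg[of 0] seg[of \<tau>] \<tau> by (simp_all add: p1_def flip: zero_prod_def)
  define C where "C = 1 / (2 * n) + 1 / (2 * m) + m + n"
  have C: "0 < C" using m n by (simp add: C_def add_pos_pos)
  have dist_le: "dist p p' \<le> C * \<delta>" if "\<bar>l1 p - l1 p'\<bar> \<le> \<delta>" "\<bar>l2 p - l2 p'\<bar> \<le> \<delta>" for p p' \<delta>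
  proof -
    let ?s = "l1 p - l1 p'" and ?r = "l2 p - l2 p'"
    have "p - p' = Mp (?s, ?r)"
      by (subst inv(1)[of p], subst inv(1)[of p']) (simp add: Mp_def algebra_simps diff_divide_distrib)
    then have "dist p p' \<le> \<bar>?s / (2 * n) + m * ?r\<bar> + \<bar>- ?s / (2 * m) + n * ?r\<bar>"
      using norm_Pair_le[of "?s / (2 * n) + m * ?r" "- ?s / (2 * m) + n * ?r"] by (simp add: dist_norm Mp_def)
    also have "\<dots> \<le> (\<bar>?s\<bar> / (2 * n) + m * \<bar>?r\<bar>) + (\<bar>?s\<bar> / (2 * m) + n * \<bar>?r\<bar>)"
      using m n abs_triangle_ineq[of "?s / (2 * n)" "m * ?r"] abs_triangle_ineq[of "- ?s / (2 * m)" "n * ?r"]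
      by (simp add: abs_mult abs_minus_commute[of "l1 p'" "l1 p"])
    also have "\<dots> \<le> (\<delta> / (2 * n) + m * \<delta>) + (\<delta> / (2 * m) + n * \<delta>)"
      using that m n by (intro add_mono divide_right_mono mult_left_mono) auto
    also have "\<dots> = C * \<delta>" by (simp add: C_def algebra_simps)
    finally show ?thesis .
  qed
  obtain G where G: "\<And>t. (G has_real_derivative bump t) (at t)" "\<And>t. t \<le> -1 \<Longrightarrow> G t = 0"
    "\<And>t. 1 \<le> t \<Longrightarrow> G t = G 1" "\<And>k. Ck_line k G" using bump_antiderivative by metis
  have "\<bar>w p0 - w p1\<bar> \<le> 2 * \<epsilon>" if \<epsilon>: "0 < \<epsilon>" for \<epsilon>
  proof -
    let ?seg = "(\<lambda>t. p0 + t *\<^sub>R (m, n)) ` {0..\<tau>}"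
    have "compact ?seg" by (intro compact_continuous_image continuous_intros) simp
    moreover have "?seg \<subseteq> D" using seg by auto
    ultimately obtain e where e: "0 < e" "(\<Union>x\<in>?seg. ball x e) \<subseteq> D"
      using compact_subset_open_imp_ball_epsilon_subset[OF _ D] by metis
    obtain d0 where d0: "0 < d0" "\<And>p. p \<in> D \<Longrightarrow> dist p p0 < d0 \<Longrightarrow> dist (w p) (w p0) < \<epsilon>"
      using w pD(1) \<epsilon> unfolding continuous_on_iff by metis
    obtain d1 where d1: "0 < d1" "\<And>p. p \<in> D \<Longrightarrow> dist p p1 < d1 \<Longrightarrow> dist (w p) (w p1) < \<epsilon>"
      using w pD(2) \<epsilon> unfolding continuous_on_iff by metis
    \<comment> \<open>Half of the admissible radius after division by \<open>C\<close>, so that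
      points within \<open>\<delta>\<close> in both coordinates stay in \<open>D\<close> and in both
      neighbourhoods of continuity.\<close>
    define \<delta> where "\<delta> = min e (min d0 d1) / (2 * C)"
    have "0 < min e (min d0 d1)" using e d0 d1 by simp
    then have \<delta>: "0 < \<delta>" "C * \<delta> < min e (min d0 d1)" using C by (auto simp: \<delta>_def)
    define K where "K = Mp ` ({s0 - \<delta>..s0 + \<delta>} \<times> {r0 - \<delta>..r1 + \<delta>})"
    have K: "compact K" unfolding K_def Mp_def
      by (intro compact_continuous_image continuous_intros compact_Times) (use m n in auto)
    have K_iff: "p \<in> K \<longleftrightarrow> \<bar>l1 p - s0\<bar> \<le> \<delta> \<and> r0 - \<delta> \<le> l2 p \<and> l2 p \<le> r1 + \<delta>" for p
    proof
      assume "p \<in> K"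
      then show "\<bar>l1 p - s0\<bar> \<le> \<delta> \<and> r0 - \<delta> \<le> l2 p \<and> l2 p \<le> r1 + \<delta>"
        unfolding K_def by (auto simp: inv abs_le_iff)
    next
      assume "\<bar>l1 p - s0\<bar> \<le> \<delta> \<and> r0 - \<delta> \<le> l2 p \<and> l2 p \<le> r1 + \<delta>"
      then show "p \<in> K" unfolding K_def
        by (intro image_eqI[where x = "(l1 p, l2 p)"] inv(1)) auto
    qed
    have KD: "K \<subseteq> D"
    proof
      fix p assume p: "p \<in> K"
      \<comment> \<open>Truncation to \<open>[0, \<tau>]\<close> selects a point of the segment
        whose \<open>l2\<close> coordinate is within \<open>\<delta>\<close> of that of
        \<open>p\<close>, also near the two ends of \<open>K\<close>.\<close>
      define t where "t = max 0 (min \<tau> (l2 p - r0))"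
      let ?p = "p0 + t *\<^sub>R (m, n)"
      have t: "0 \<le> t" "t \<le> \<tau>" using \<tau> by (auto simp: t_def)
      have "\<bar>l2 p - (r0 + t)\<bar> \<le> \<delta>" using p \<tau> \<delta>(1) unfolding K_iff r1_def t_def by auto
      then have "dist p ?p \<le> C * \<delta>"
        using p unfolding K_iff
          by (intro dist_le) (simp_all del: scaleR_Pair add: l1lin l2lin flip: s0_def r0_def)
      then have "p \<in> ball ?p e" using \<delta>(2) by (simp add: dist_commute)
      moreover have "?p \<in> ?seg" using t by (intro imageI) simp
      ultimately have "p \<in> (\<Union>x\<in>?seg. ball x e)" by blast
      then show "p \<in> D" using e(2) by blast
    qed
    define A where "A s = bump (1 / \<delta> * s + (- s0 / \<delta>))" for s
    define b where "b r' r = bump (1 / \<delta> * r + (- r' / \<delta>))" for r' r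
    \<comment> \<open>Both terms vanish to the left of \<open>r0 - \<delta>\<close> and both equal
      \<open>G 1\<close> to the right of \<open>r1 + \<delta>\<close>, so \<open>B\<close> has
      bounded support. The factor \<open>\<delta>\<close> compensates the inner derivative
      \<open>1 / \<delta>\<close>.\<close>
    define B where "B r = \<delta> * (G (1 / \<delta> * r + (- r0 / \<delta>)) - G (1 / \<delta> * r + (- r1 / \<delta>)))" for r
    have arg: "1 / \<delta> * s + (- r / \<delta>) = (s - r) / \<delta>" for s r by (simp add: diff_divide_distrib)
    have CA: "Ck_line k A" and Cb: "Ck_line k (b r')" and CB: "Ck_line k B" for k r'
      unfolding A_def[abs_def] b_def[abs_def] B_def[abs_def]
      by (rule Ck_line_affine[OF Ck_line_bump], rule Ck_line_affine[OF Ck_line_bump],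
          rule Ck_line_mult[OF Ck_line_const Ck_line_diff[OF Ck_line_affine[OF G(4)] Ck_line_affine[OF G(4)]]])
    have zero: "bump ((s - r) / \<delta>) = 0" if "\<delta> < \<bar>s - r\<bar>" for s r
      using that \<delta>(1) by (intro bump_outside) (simp add: abs_divide field_simps)
    have nonneg: "0 \<le> A s" "0 \<le> b r' r" for s r' r by (simp_all add: A_def b_def bump_nonneg)
    have b01: "p \<in> K \<and> \<bar>l1 p - s0\<bar> \<le> \<delta> \<and> \<bar>l2 p - r'\<bar> \<le> \<delta>" if "A (l1 p) * b r' (l2 p) \<noteq> 0" "r' = r0 \<or> r' = r1" for p r'
    proof -
      have "\<bar>l1 p - s0\<bar> \<le> \<delta>" "\<bar>l2 p - r'\<bar> \<le> \<delta>"
        using that(1) zero[of "l1 p" s0] zero[of "l2 p" r'] unfolding A_def b_def arg by force+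
      then show ?thesis using that(2) \<tau> unfolding K_iff r1_def by auto
    qed
    have "(LINT p:D|lborel. w p * (A (l1 p) * (b r0 (l2 p) - b r1 (l2 p)))) = 0"
    proof (rule orth[OF CA CB Ck_line_diff[OF Cb Cb] _ K KD])
      fix t
      have "((\<lambda>r. G (1 / \<delta> * r + (- c / \<delta>))) has_real_derivative b c t * (1 / \<delta>)) (at t)" for c
        unfolding b_def
        using \<delta>(1) by (intro DERIV_chain2[OF G(1)]) (auto intro!: derivative_eq_intros)
      from DERIV_cmult[OF DERIV_diff[OF this[of r0] this[of r1]], of \<delta>]
      show "(B has_real_derivative b r0 t - b r1 t) (at t)"
        unfolding B_def[abs_def] by (rule DERIV_cong) (use \<delta>(1) in \<open>simp add: field_simps\<close>)
    next
      fix p assume p: "p \<notin> K"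
      show "A (l1 p) * (b r0 (l2 p) - b r1 (l2 p)) = 0"
      proof -
        have "A (l1 p) * b r0 (l2 p) = 0" "A (l1 p) * b r1 (l2 p) = 0"
          using b01[of p r0] b01[of p r1] p by blast+
        then show ?thesis by auto
      qed
      show "A (l1 p) * B (l2 p) = 0"
      proof (cases "\<bar>l1 p - s0\<bar> \<le> \<delta>")
        case True
        with p consider "l2 p < r0 - \<delta>" | "r1 + \<delta> < l2 p" unfolding K_iff by linarith
        then have "B (l2 p) = 0"
        proof cases
          case 1
          then have "(l2 p - r0) / \<delta> \<le> -1" "(l2 p - r1) / \<delta> \<le> -1"
            using \<tau> \<delta>(1) by (auto simp: r1_def field_simps)
          then show ?thesis unfolding B_def arg by (simp add: G(2))
        next
          case 2
          then have "1 \<le> (l2 p - r0) / \<delta>" "1 \<le> (l2 p - r1) / \<delta>"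
            using \<tau> \<delta>(1) by (auto simp: r1_def field_simps)
          then show ?thesis unfolding B_def arg by (simp add: G(3)[of "(l2 p - r0) / \<delta>"] G(3)[of "(l2 p - r1) / \<delta>"])
        qed
        then show ?thesis by simp
      next
        case False
        then show ?thesis using zero[of "l1 p" s0] unfolding A_def arg by simp
      qed
    qed
    define \<theta> where "\<theta> r' p = A (l1 p) * b r' (l2 p)" for r' p
    have bl: "bounded_linear l1" "bounded_linear l2" unfolding l1_def l2_def
      by (intro bounded_linear_sub bounded_linear_add bounded_linear_const_mult bounded_linear_divide
          bounded_linear_compose[OF bounded_linear_divide] bounded_linear_fst bounded_linear_snd)+
    have c\<theta>: "continuous_on UNIV (\<theta> r')" for r'
      unfolding \<theta>_def[abs_def]
      by (intro smoothD(2)[OF smooth_ridge_product[OF bl CA Cb]])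
    have \<theta>0: "\<theta> r' p = 0" if "p \<notin> K" "r' = r0 \<or> r' = r1" for r' p
      using b01[of p r'] that unfolding \<theta>_def by blast
    have \<theta>nn: "0 \<le> \<theta> r' p" for r' p unfolding \<theta>_def using nonneg by simp
    have i\<theta>: "integrable lborel (\<theta> r')" if "r' = r0 \<or> r' = r1" for r'
      using compact_support_integrable[OF c\<theta> K \<theta>0[OF _ that]] .
    have iw: "set_integrable lborel D (\<lambda>p. w p * \<theta> r' p)" if "r' = r0 \<or> r' = r1" for r'
      using set_integrable_compact_support[OF D K KD w c\<theta> \<theta>0[OF _ that]] .
    have eq: "(LINT p:D|lborel. w p * \<theta> r0 p) = (LINT p:D|lborel. w p * \<theta> r1 p)"
    proof -
      have "(LINT p:D|lborel. w p * \<theta> r0 p - w p * \<theta> r1 p) = (LINT p:D|lborel. w p * \<theta> r0 p) - (LINT p:D|lborel. w p * \<theta> r1 p)"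
        by (rule set_integral_diff(2)) (auto intro: iw)
      moreover have "(\<lambda>p. w p * \<theta> r0 p - w p * \<theta> r1 p) = (\<lambda>p. w p * (A (l1 p) * (b r0 (l2 p) - b r1 (l2 p))))"
        by (auto simp: \<theta>_def algebra_simps)
      ultimately show ?thesis
        using \<open>(LINT p:D|lborel. w p * (A (l1 p) * (b r0 (l2 p) - b r1 (l2 p)))) = 0\<close> by simp
    qed
    \<comment> \<open>The mass common to both weights: \<open>\<theta> r1\<close> is
      \<open>\<theta> r0\<close> translated by \<open>\<tau> *\<^sub>R (m, n)\<close>, and Lebesgue
      measure is translation invariant. It is positive because \<open>\<theta> r0\<close> is
      continuous, nonnegative and positive at \<open>p0\<close>.\<close>
    define c where "c = (\<integral>p. \<theta> r0 p \<partial>lborel)"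
    have c1: "(\<integral>p. \<theta> r1 p \<partial>lborel) = c"
    proof -
      have "\<theta> r1 (\<tau> *\<^sub>R (m, n) + p) = \<theta> r0 p" for p
        unfolding \<theta>_def b_def arg add.commute[of _ p] l1lin l2lin r1_def by (simp add: algebra_simps)
      moreover have "(\<integral>p. \<theta> r1 p \<partial>distr lborel borel ((+) (\<tau> *\<^sub>R (m, n)))) = (\<integral>p. \<theta> r1 (\<tau> *\<^sub>R (m, n) + p) \<partial>lborel)"
        by (rule integral_distr) (use borel_measurable_continuous_onI[OF c\<theta>] in auto)
      ultimately show ?thesis unfolding lborel_distr_plus c_def by simp
    qed
    have "c \<noteq> 0"
    proof
      assume "c = 0"
      then have "AE p in lborel. \<theta> r0 p = 0"
        using integral_nonneg_eq_0_iff_AE[OF i\<theta>[of r0]] \<theta>nn unfolding c_def by auto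
      moreover have op: "open {p. \<theta> r0 p \<noteq> 0}"
        by (intro open_Collect_neq c\<theta> continuous_intros)
      ultimately have "{p. \<theta> r0 p \<noteq> 0} \<in> null_sets lborel"
        using AE_iff_null[of lborel "\<lambda>p. \<theta> r0 p = 0"] by simp
      then have "negligible {p. \<theta> r0 p \<noteq> 0}"
        unfolding negligible_iff_null_sets by (rule null_sets_completionI)
      moreover have "p0 \<in> {p. \<theta> r0 p \<noteq> 0}"
        using bump_0 by (simp add: \<theta>_def A_def b_def s0_def r0_def)
      ultimately show False using open_not_negligible[OF op] by blast
    qed
    moreover have "0 \<le> c" unfolding c_def by (rule Bochner_Integration.integral_nonneg) (rule \<theta>nn)
    ultimately have c0: "0 < c" by simp
    \<comment> \<open>On the support of either weight, \<open>w\<close> is within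
      \<open>\<epsilon>\<close> of its value at the centre of that support.\<close>
    have bound: "(w p' - \<epsilon>) * c \<le> (LINT p:D|lborel. w p * \<theta> r' p) \<and> (LINT p:D|lborel. w p * \<theta> r' p) \<le> (w p' + \<epsilon>) * c"
      if p': "p' = p0 \<and> r' = r0 \<or> p' = p1 \<and> r' = r1" for p' r'
    proof -
      have r': "r' = r0 \<or> r' = r1" using p' by blast
      have near: "\<bar>w p - w p'\<bar> \<le> \<epsilon> \<and> p \<in> D" if "\<theta> r' p \<noteq> 0" for p
      proof -
        have k: "p \<in> K" "\<bar>l1 p - s0\<bar> \<le> \<delta>" "\<bar>l2 p - r'\<bar> \<le> \<delta>" using b01[of p r'] that r' unfolding \<theta>_def by blast+
        have "l1 p' = s0" "l2 p' = r'" using p' p1 by (auto simp: s0_def r0_def)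
        then have "dist p p' < min e (min d0 d1)" using dist_le[of p p' \<delta>] k \<delta>(2) by simp
        moreover have "p \<in> D" using k KD by blast
        ultimately show ?thesis using p' d0(2)[of p] d1(2)[of p] by (auto simp: dist_real_def)
      qed
      have pw: "(w p' - \<epsilon>) * \<theta> r' p \<le> indicator D p *\<^sub>R (w p * \<theta> r' p) \<and> indicator D p *\<^sub>R (w p * \<theta> r' p) \<le> (w p' + \<epsilon>) * \<theta> r' p" for p
      proof (cases "\<theta> r' p = 0")
        case False
        with near[OF False] \<theta>nn[of r' p] show ?thesis
          by (auto intro!: mult_right_mono simp: abs_le_iff)
      qed simp
      have i: "integrable lborel (\<lambda>p. indicator D p *\<^sub>R (w p * \<theta> r' p))"
        using iw[OF r'] unfolding set_integrable_def .
      have "(\<integral>p. \<theta> r' p \<partial>lborel) = c" using r' c1 c_def by auto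
      then show ?thesis unfolding set_lebesgue_integral_def
        using integral_mono[OF integrable_mult_right[OF i\<theta>[OF r'], of "w p' - \<epsilon>"] i] pw
          integral_mono[OF i integrable_mult_right[OF i\<theta>[OF r'], of "w p' + \<epsilon>"]] by simp
    qed
    have "(w p0 - \<epsilon>) * c \<le> (w p1 + \<epsilon>) * c" "(w p1 - \<epsilon>) * c \<le> (w p0 + \<epsilon>) * c"
      using bound[of p0 r0] bound[of p1 r1] eq by auto
    then show ?thesis using c0 by (simp add: abs_le_iff)
  qed
  then have "\<bar>w p0 - w p1\<bar> \<le> \<epsilon>" if "0 < \<epsilon>" for \<epsilon> using that[THEN half_gt_zero] by fastforce
  then have "\<bar>w p0 - w p1\<bar> \<le> 0" by (rule field_le_epsilon) simp
  then show ?thesis by (simp add: p1_def)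
qed

section \<open>The Dirichlet problem\<close>

context characteristic_curve begin

section \<open>The explicit solution: boundary values, regularity and weak equation\<close>

lemma D_interior:
  assumes "p \<in> D"
  shows "fst p \<in> {0<..<1}" "snd p \<in> {0<..<1}" "lev p \<in> {-m<..<n}"
    "n * fst p \<in> {-m<..<n}" "- m * snd p \<in> {-m<..<n}"
proof -
  have p: "0 < fst p" "0 < snd p" "fst p < fst (q (lev p))" "snd p < snd (q (lev p))"
    using assms by (auto simp: D_def)
  then have x: "0 < fst p" "fst p < 1" and y: "0 < snd p" "snd p < 1"
    using q_bounds[of "lev p"] by auto
  then show "fst p \<in> {0<..<1}" "snd p \<in> {0<..<1}" by auto
  have *: "0 < n * fst p" "n * fst p < n" "0 < m * snd p" "m * snd p < m"
    using m n x y by auto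
  show "lev p \<in> {-m<..<n}" "n * fst p \<in> {-m<..<n}" "- m * snd p \<in> {-m<..<n}"
    using * m n unfolding lev_def greaterThanLessThan_iff mult_minus_left by linarith+
qed

lemma at_within_Icc_interior:
  fixes t :: real
  assumes "t \<in> {c<..<d}"
  shows "at t within {c..d} = at t" "t \<in> {c..d}"
  using assms by (auto intro!: at_within_interior)

text \<open>The contribution of the unknown \<open>F\<close>, with its traces on the axes removed:
  it vanishes on both axes when \<open>F 0 = 0\<close>, it is the left side of the functional
  equation on \<Gamma>, and it is zero for linear \<open>F\<close> because \<open>lev p\<close> is
  the sum of the other two arguments.\<close>

definition profile :: "(real \<Rightarrow> real) \<Rightarrow> real \<times> real \<Rightarrow> real" where
  "profile F p = F (lev p) - F (n * fst p) - F (- m * snd p)"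

definition axes_part :: "(real \<times> real \<Rightarrow> real) \<Rightarrow> real \<times> real \<Rightarrow> real" where
  "axes_part g p = g (fst p, 0) + g (0, snd p) - g (0, 0)"

text \<open>What the data on \<Gamma> leave over once the axes are served: the right side
  \<open>H\<close> of the functional equation.\<close>

definition jump :: "(real \<times> real \<Rightarrow> real) \<Rightarrow> real \<Rightarrow> real" where
  "jump g s = g (q s) - axes_part g (q s)"

lemma profile_q: "s \<in> I \<Longrightarrow> profile F (q s) = F s - F (a s) - F (s - a s)"
  using snd_q[of s] by (simp add: profile_def lev_q clamp_id a_def)

lemma frontier_cases:
  assumes "p \<in> Dbar - D"
  obtains x where "0 \<le> x" "x \<le> 1" "p = (x, 0)" | y where "0 \<le> y" "y \<le> 1" "p = (0, y)"
    | s where "s \<in> I" "p = q s"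
proof -
  have "p \<in> closed_segment (0, 0) (1, 0) \<or> p \<in> closed_segment (0, 0) (0, 1) \<or> p \<in> q ` I"
    using assms unfolding Dbar_minus_D curve_q by blast
  then show ?thesis
  proof (elim disjE)
    assume "p \<in> closed_segment (0, 0) (1, 0)"
    then show ?thesis using that(1) by (auto simp: in_segment)
  next
    assume "p \<in> closed_segment (0, 0) (0, 1)"
    then show ?thesis using that(2) by (auto simp: in_segment)
  qed (use that(3) in blast)
qed

lemma frontier_value:
  assumes eq: "\<And>s. s \<in> I \<Longrightarrow> F s - F (a s) - F (s - a s) = jump g s" and F0: "F 0 = 0"
    and p: "p \<in> Dbar - D"
  shows "axes_part g p + profile F p = g p"
  using p
proof (cases rule: frontier_cases)
  case (1 x)
  then show ?thesis using F0 by (simp add: axes_part_def profile_def lev_def)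
next
  case (2 y)
  then show ?thesis using F0 by (simp add: axes_part_def profile_def lev_def)
next
  case (3 s)
  then show ?thesis using eq[of s] by (simp add: profile_q jump_def)
qed

lemma jump_C2:
  assumes "C2_boundary \<gamma> g"
  shows "C2_interval (-m) n (jump g)"
proof -
  have g: "C2_interval 0 1 (\<lambda>x. g (x, 0))" "C2_interval 0 1 (\<lambda>y. g (0, y))" "C2_interval (-1) 1 (g \<circ> \<gamma>)"
    using assms by (auto simp: C2_boundary_def)
  have "C2_interval (-m) n (\<lambda>s. g (q s))"
    using C2_along_curve[OF g(3)] by (simp add: q_def comp_def)
  moreover have "C2_interval (-m) n (\<lambda>s. g (fst (q s), 0))"
    by (rule C2_interval_compose[OF g(1)])
       (use C2_along_curve[OF linear_image_C2[OF bounded_linear_fst]] q_bounds in \<open>auto simp: q_def\<close>)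
  moreover have "C2_interval (-m) n (\<lambda>s. g (0, snd (q s)))"
    by (rule C2_interval_compose[OF g(2)])
       (use C2_along_curve[OF linear_image_C2[OF bounded_linear_snd]] q_bounds in \<open>auto simp: q_def\<close>)
  ultimately show ?thesis unfolding jump_def[abs_def] axes_part_def
    by (intro C2_interval_diff C2_interval_add C2_interval_const)
qed

lemma jump_ends: "jump g (-m) = 0" "jump g n = 0"
  by (simp_all add: jump_def axes_part_def q_ends)

lemma C2_side_profile:
  fixes h F :: "real \<Rightarrow> real"
  assumes g: "C2_interval 0 1 h" and F: "C2_interval (-m) n F" and c: "c = n \<or> c = -m"
  shows "C2_interval 0 1 (\<lambda>x. h x - F (c * x))"
proof (intro C2_interval_diff g C2_interval_compose[OF F] C2_interval_cmult C2_interval_ident)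
  have "c * x \<in> I" if "x \<in> {0..1}" for x
  proof -
    have "0 \<le> n * x" "n * x \<le> n" "0 \<le> m * x" "m * x \<le> m" using that m n by (auto simp: mult_left_le)
    then show ?thesis using c m n by auto
  qed
  then show "(*) c ` {0..1} \<subseteq> I" by blast
qed

text \<open>Grouped so that each nonconstant summand depends on a single linear form and is
  \<open>C\<^sup>2\<close> on the closed interval of its values.\<close>

lemma solution_split:
  "axes_part g p + profile F p =
     (g (fst p, 0) - F (n * fst p)) + (g (0, snd p) - F (- m * snd p)) + F (lev p) + - g (0, 0)"
  by (simp add: axes_part_def profile_def)

lemma solution_C2:
  assumes g: "C2_boundary \<gamma> g" and F: "C2_interval (-m) n F"
  shows "Ck_closure 2 D (\<lambda>p. axes_part g p + profile F p)"
proof -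
  have g: "C2_interval 0 1 (\<lambda>x. g (x, 0))" "C2_interval 0 1 (\<lambda>y. g (0, y))"
    using g by (auto simp: C2_boundary_def)
  have "Ck_closure 2 D (\<lambda>p. g (fst p, 0) - F (n * fst p))"
    by (rule Ck_closure_2_ridge[OF bounded_linear_fst C2_side_profile[OF g(1) F]])
       (use D_interior(1) Dbar_bounds(1,2) closure_D in auto)
  moreover have "Ck_closure 2 D (\<lambda>p. g (0, snd p) - F (- m * snd p))"
    by (rule Ck_closure_2_ridge[OF bounded_linear_snd C2_side_profile[OF g(2) F]])
       (use D_interior(2) Dbar_bounds(3,4) closure_D in auto)
  moreover have "Ck_closure 2 D (\<lambda>p. F (lev p))"
    by (rule Ck_closure_2_ridge[OF bounded_linear_lev F])
       (use D_interior(3) Dbar_bounds(5) closure_D in auto)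
  ultimately show ?thesis unfolding solution_split
    by (intro Ck_closure_add Ck_closure_const)
qed

text \<open>The first-order operator annihilates \<open>F (lev p)\<close>, since the contributions
  \<open>m n F'\<close> and \<open>- n m F'\<close> cancel. What remains is a function of
  \<open>x\<close> plus a function of \<open>y\<close>, as \<open>weak_solution\<close>
  requires.\<close>

lemma solution_weak:
  assumes g: "C2_boundary \<gamma> g" and F: "C2_interval (-m) n F" and \<phi>: "test_function D \<phi>"
  shows "(LINT p:D|lborel. (axes_part g p + profile F p) * diff_op m n \<phi> p) = 0"
proof -
  have g: "C2_interval 0 1 (\<lambda>x. g (x, 0))" "C2_interval 0 1 (\<lambda>y. g (0, y))"
    using g by (auto simp: C2_boundary_def)
  define X where "X x = g (x, 0) - F (n * x)" for x
  define Y where "Y y = g (0, y) - F (- m * y)" for y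
  have CX: "C2_interval 0 1 X" and CY: "C2_interval 0 1 Y"
    using C2_side_profile[OF g(1) F, of n] C2_side_profile[OF g(2) F, of "-m"]
    unfolding X_def[abs_def] Y_def[abs_def] by auto
  obtain X1 X2 where X: "\<And>t. t \<in> {0..1} \<Longrightarrow> (X has_real_derivative X1 t) (at t within {0..1})"
    "\<And>t. t \<in> {0..1} \<Longrightarrow> (X1 has_real_derivative X2 t) (at t within {0..1})" "continuous_on {0..1} X2"
    using CX by (elim C2_intervalE) blast
  obtain Y1 Y2 where Y: "\<And>t. t \<in> {0..1} \<Longrightarrow> (Y has_real_derivative Y1 t) (at t within {0..1})"
    "\<And>t. t \<in> {0..1} \<Longrightarrow> (Y1 has_real_derivative Y2 t) (at t within {0..1})" "continuous_on {0..1} Y2"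
    using CY by (elim C2_intervalE) blast
  obtain F1 F2 where F: "\<And>t. t \<in> I \<Longrightarrow> (F has_real_derivative F1 t) (at t within I)"
    "\<And>t. t \<in> I \<Longrightarrow> (F1 has_real_derivative F2 t) (at t within I)" "continuous_on I F2"
    using F by (elim C2_intervalE) blast
  have cont: "continuous_on {0..1} X" "continuous_on {0..1} X1" "continuous_on {0..1} Y" "continuous_on {0..1} Y1"
    "continuous_on I F" "continuous_on I F1"
    by (rule DERIV_continuous_on, erule X Y F)+
  have sub: "fst ` D \<subseteq> {0..1}" "snd ` D \<subseteq> {0..1}" "lev ` D \<subseteq> I"
    using Dbar_bounds D_subset_Dbar by auto
  have c: "continuous_on D (\<lambda>p. h (fst p))" "continuous_on D (\<lambda>p. h (snd p))" if "continuous_on {0..1} h" for h :: "real \<Rightarrow> real"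
    by (rule continuous_on_compose2[OF that continuous_on_fst[OF continuous_on_id] sub(1)])
       (rule continuous_on_compose2[OF that continuous_on_snd[OF continuous_on_id] sub(2)])
  have cl: "continuous_on D (\<lambda>p. h (lev p))" if "continuous_on I h" for h :: "real \<Rightarrow> real"
    by (rule continuous_on_compose2[OF that continuous_lev sub(3)])
  have u: "axes_part g p + profile F p = X (fst p) + Y (snd p) + F (lev p) + - g (0, 0)" for p
    unfolding solution_split X_def Y_def ..
  have dX: "(X has_real_derivative X1 (fst p)) (at (fst p))" "(X1 has_real_derivative X2 (fst p)) (at (fst p))"
    and dY: "(Y has_real_derivative Y1 (snd p)) (at (snd p))"
    and dF: "(F has_real_derivative F1 (lev p)) (at (lev p))" if "p \<in> D" for p
    using X(1,2)[OF at_within_Icc_interior(2)[OF D_interior(1)[OF that]]] at_within_Icc_interior(1)[OF D_interior(1)[OF that]]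
      Y(1)[OF at_within_Icc_interior(2)[OF D_interior(2)[OF that]]] at_within_Icc_interior(1)[OF D_interior(2)[OF that]]
      F(1)[OF at_within_Icc_interior(2)[OF D_interior(3)[OF that]]] at_within_Icc_interior(1)[OF D_interior(3)[OF that]]
    by simp_all
  show ?thesis
  proof (rule weak_solution[OF open_D _ _ _ _ _ _ _ _ _ _ \<phi>])
    fix p assume p: "p \<in> D"
    have d: "((\<lambda>p. axes_part g p + profile F p) has_derivative
        (\<lambda>v. X1 (fst p) * fst v + Y1 (snd p) * snd v + F1 (lev p) * lev v + 0)) (at p)"
      unfolding u
      by (intro has_derivative_add has_derivative_const ridge_has_derivative bounded_linear_fst bounded_linear_snd
          bounded_linear_lev dX dY dF p)
    then have diff: "(\<lambda>p. axes_part g p + profile F p) differentiable (at p)" by (rule differentiableI)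
    show "((\<lambda>t. axes_part g (p + t *\<^sub>R (1, 0)) + profile F (p + t *\<^sub>R (1, 0))) has_real_derivative
        X1 (fst p) + n * F1 (lev p)) (at 0)"
      using directional_partials(1)[OF diff] partial_eqI(1)[OF d] by (simp del: scaleR_Pair add: lev_def mult.commute)
    show "((\<lambda>t. axes_part g (p + t *\<^sub>R (0, 1)) + profile F (p + t *\<^sub>R (0, 1))) has_real_derivative
        Y1 (snd p) - m * F1 (lev p)) (at 0)"
      using directional_partials(2)[OF diff] partial_eqI(2)[OF d] by (simp del: scaleR_Pair add: lev_def mult.commute)
    show "m * (X1 (fst p) + n * F1 (lev p)) + n * (Y1 (snd p) - m * F1 (lev p)) = m * X1 (fst p) + n * Y1 (snd p)"
      by (simp add: algebra_simps)
    show "((\<lambda>x. m * X1 x) has_real_derivative m * X2 (fst p)) (at (fst p))"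
      by (rule DERIV_cmult[OF dX(2)[OF p]])
  next
    show "continuous_on D (\<lambda>p. axes_part g p + profile F p)" unfolding u
      by (intro continuous_on_add continuous_on_const c(1) c(2) cl cont)
    show "continuous_on D (\<lambda>p. X1 (fst p) + n * F1 (lev p))"
      by (intro continuous_on_add continuous_on_mult continuous_on_const c(1)[OF cont(2)] cl[OF cont(6)])
    show "continuous_on D (\<lambda>p. Y1 (snd p) - m * F1 (lev p))"
      by (intro continuous_on_diff continuous_on_mult continuous_on_const c(2)[OF cont(4)] cl[OF cont(6)])
    show "continuous_on D (\<lambda>p. m * X1 (fst p))"
      by (intro continuous_on_mult continuous_on_const c(1)[OF cont(2)])
    show "continuous_on D (\<lambda>p. m * X2 (fst p))"
      by (intro continuous_on_mult continuous_on_const c(1)[OF X(3)])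
    show "continuous_on D (\<lambda>p. n * Y1 (snd p))"
      by (intro continuous_on_mult continuous_on_const c(2)[OF cont(4)])
  qed
qed

lemma generalized_solution_iff:
  "generalized_solution m n \<gamma> g u \<longleftrightarrow> continuous_on Dbar u \<and> (\<forall>p\<in>Dbar - D. u p = g p) \<and>
     (\<forall>\<phi>. test_function D \<phi> \<longrightarrow> (LINT p:D|lborel. u p * diff_op m n \<phi> p) = 0)"
  unfolding generalized_solution_def curv_triangle_eq closure_D frontier_D by simp

section \<open>Representation of an arbitrary \<open>C\<^sup>2\<close> solution, and
  uniqueness\<close>

lemma characteristic_segment:
  assumes p: "p \<in> D"
  obtains T where "0 < T" "q (lev p) = p + T *\<^sub>R (m, n)" "\<And>t. 0 \<le> t \<Longrightarrow> t < T \<Longrightarrow> p + t *\<^sub>R (m, n) \<in> D"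
proof -
  define T where "T = (fst (q (lev p)) - fst p) / m"
  have lp: "lev p \<in> I" using Dbar_bounds(5) p D_subset_Dbar by blast
  have "lev (q (lev p)) = lev p" using lp by (simp only: lev_q clamp_id)
  then have "n * (fst (q (lev p)) - fst p) = m * (snd (q (lev p)) - snd p)"
    by (simp add: lev_def algebra_simps)
  then have q: "q (lev p) = p + T *\<^sub>R (m, n)" using m by (simp add: T_def prod_eq_iff field_simps)
  have T: "0 < T" using p m by (simp add: T_def D_def)
  have "p + t *\<^sub>R (m, n) \<in> D" if t: "0 \<le> t" "t < T" for t
  proof (rule D_I(1))
    have l: "lev (p + t *\<^sub>R (m, n)) = lev p" by (simp add: lev_def algebra_simps)
    show "lev (p + t *\<^sub>R (m, n)) \<in> I" using lp l by simp
    have "0 \<le> t * m" "0 \<le> t * n" using t m n by auto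
    then show "0 < fst (p + t *\<^sub>R (m, n))" "0 < snd (p + t *\<^sub>R (m, n))" using p by (auto simp: D_def)
    have "fst (p + t *\<^sub>R (m, n)) < fst (p + T *\<^sub>R (m, n))" using t m by simp
    then show "fst (p + t *\<^sub>R (m, n)) < fst (q (lev (p + t *\<^sub>R (m, n))))" unfolding l q .
  qed
  with that T q show ?thesis by blast
qed

text \<open>Transport of \<open>w = \<partial>\<^sub>x\<partial>\<^sub>y v\<close> along characteristics, tested against products of a function of the level
  and a function of a complementary coordinate along which \<open>m \<partial>\<^sub>x + n \<partial>\<^sub>y\<close> acts as \<open>d/dr\<close>.\<close>

lemma mixed_derivative_is_level_function:
  assumes v: "\<And>p. p \<in> D \<Longrightarrow> v differentiable (at p)" "continuous_on D v"
    and vx: "\<And>p. p \<in> D \<Longrightarrow> vx p = partial_x v p" "\<And>p. p \<in> D \<Longrightarrow> vx differentiable (at p)" "continuous_on D vx"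
    and w: "\<And>p. p \<in> D \<Longrightarrow> w p = partial_y vx p" "continuous_on Dbar w"
    and weak: "\<And>\<phi>. test_function D \<phi> \<Longrightarrow> (LINT p:D|lborel. v p * diff_op m n \<phi> p) = 0"
    and p: "p \<in> D"
  shows "w p = w (q (lev p))"
proof -
  let ?l2 = "\<lambda>p::real \<times> real. fst p / (2 * m) + snd p / (2 * n)"
  have lev': "lev = (\<lambda>p. n * fst p - m * snd p)" by (auto simp: lev_def)
  have l2: "bounded_linear ?l2"
    by (intro bounded_linear_add bounded_linear_compose[OF bounded_linear_divide] bounded_linear_fst bounded_linear_snd)
  have wD: "continuous_on D w" by (rule continuous_on_subset[OF w(2) D_subset_Dbar])
  obtain T where T: "0 < T" "q (lev p) = p + T *\<^sub>R (m, n)" "\<And>t. 0 \<le> t \<Longrightarrow> t < T \<Longrightarrow> p + t *\<^sub>R (m, n) \<in> D"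
    using characteristic_segment[OF p] by metis
  \<comment> \<open>Only the part of the characteristic before \<Gamma> lies in \<open>D\<close>.
    The end point on \<Gamma> is reached afterwards, by continuity of \<open>w\<close> on
    \<open>Dbar\<close>.\<close>
  have const: "w (p + t *\<^sub>R (m, n)) = w p" if t: "0 < t" "t < T" for t
  proof (rule constant_along_characteristic[OF m n open_D wD _ t(1)])
    show "p + u *\<^sub>R (m, n) \<in> D" if "0 \<le> u" "u \<le> t" for u using T(3) that t by simp
  next
    fix A B B' K
    assume A: "\<And>k. Ck_line k A" and B: "\<And>k. Ck_line k B" and B': "\<And>k. Ck_line k B'"
      and d: "\<And>t. (B has_real_derivative B' t) (at t)" and K: "compact K" "K \<subseteq> D"
      and z: "\<And>p. p \<notin> K \<Longrightarrow> A (n * fst p - m * snd p) * B (?l2 p) = 0"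
      and z': "\<And>p. p \<notin> K \<Longrightarrow> A (n * fst p - m * snd p) * B' (?l2 p) = 0"
    let ?\<phi> = "\<lambda>p. A (lev p) * B (?l2 p)" and ?\<theta> = "\<lambda>p. A (lev p) * B' (?l2 p)"
    have z: "?\<phi> p = 0" "?\<theta> p = 0" if "p \<notin> K" for p using z[OF that] z'[OF that] unfolding lev' by auto
    have sm: "smooth ?\<phi>" "smooth ?\<theta>"
      by (intro smooth_ridge_product bounded_linear_lev l2 A B B')+
    have "{p. ?\<phi> p \<noteq> 0} \<subseteq> K" using z(1) by blast
    then have cl: "closure {p. ?\<phi> p \<noteq> 0} \<subseteq> K"
      by (rule closure_minimal[OF _ compact_imp_closed[OF K(1)]])
    have "compact (closure {p. ?\<phi> p \<noteq> 0})"
      using compact_Int_closed[OF K(1) closed_closure, of "{p. ?\<phi> p \<noteq> 0}"] cl by (simp add: Int_absorb1)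
    then have "test_function D ?\<phi>"
      using cl K(2) sm(1) unfolding test_function_def smooth_def by blast
    from weak[OF this] have "(LINT p:D|lborel. v p * diff_op m n ?\<phi> p) = 0" .
    moreover have "diff_op m n ?\<phi> p = partial_x (partial_y ?\<theta>) p" for p
      by (rule diff_op_ridge_product[OF bounded_linear_lev l2 _ _ A d B'])
         (use m n in \<open>auto simp: lev_def field_simps\<close>)
    ultimately have "(LINT p:D|lborel. v p * partial_x (partial_y ?\<theta>) p) = 0" by simp
    moreover have "(LINT p:D|lborel. v p * partial_x (partial_y ?\<theta>) p) = (LINT p:D|lborel. w p * ?\<theta> p)"
      by (rule mixed_derivative_by_parts[OF open_D K v vx w(1) wD sm(2) z(2)])
    ultimately show "(LINT p:D|lborel. w p * (A (n * fst p - m * snd p) * B' (?l2 p))) = 0"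
      unfolding lev' by simp
  qed
  have path: "((\<lambda>t. p + t *\<^sub>R (m, n)) \<longlongrightarrow> q (lev p)) (at_left T)"
    unfolding T(2) by (intro tendsto_intros)
  have ev: "\<forall>\<^sub>F t in at_left T. 0 < t \<and> t < T"
    using T(1) by (auto simp: eventually_at_left_field)
  have "((\<lambda>t. w (p + t *\<^sub>R (m, n))) \<longlongrightarrow> w (q (lev p))) (at_left T)"
  proof (rule continuous_on_tendsto_compose[OF w(2) path q_Dbar])
    show "\<forall>\<^sub>F t in at_left T. p + t *\<^sub>R (m, n) \<in> Dbar"
      using ev by eventually_elim (use T(3) D_subset_Dbar in \<open>auto simp del: scaleR_Pair\<close>)
  qed
  moreover have "((\<lambda>t. w (p + t *\<^sub>R (m, n))) \<longlongrightarrow> w p) (at_left T)"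
    by (rule tendsto_eventually) (use ev in eventually_elim, use const in blast)
  ultimately show ?thesis using tendsto_unique[OF trivial_limit_at_left_real] by blast
qed

text \<open>Integration over a rectangle, in \<open>y\<close> and then in \<open>x\<close>, shows
  that the alternating sum of \<open>z\<close> over its corners is 0. Letting the lower left corner
  \<open>(t * x, t * y)\<close> tend to the origin moves the other corners to the axes, and
  continuity extends the identity from \<open>D\<close> to \<open>Dbar\<close>.\<close>

lemma vanishing_mixed_derivative:
  assumes z: "\<And>p. p \<in> D \<Longrightarrow> z differentiable (at p)" "continuous_on Dbar z"
    and zx: "\<And>p. p \<in> D \<Longrightarrow> zx p = partial_x z p" "\<And>p. p \<in> D \<Longrightarrow> zx differentiable (at p)"
    and zero: "\<And>p. p \<in> D \<Longrightarrow> partial_y zx p = 0" and p: "p \<in> Dbar"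
  shows "z p = z (fst p, 0) + z (0, snd p) - z (0, 0)"
proof -
  have const: "f u = f v" if "\<And>t. t \<in> {u..v} \<Longrightarrow> (f has_real_derivative 0) (at t)" "u \<le> v" for f u v
  proof -
    have "\<exists>c. \<forall>t\<in>{u..v}. f t = c"
      by (rule has_field_derivative_zero_constant) (auto intro!: has_field_derivative_at_within that(1))
    with that(2) show ?thesis by force
  qed
  have rect: "z (x, y) - z (x, y') = z (x', y) - z (x', y')"
    if xy: "(x, y) \<in> D" and x': "0 < x'" "x' \<le> x" and y': "0 < y'" "y' \<le> y" for x y x' y'
  proof -
    have zx_const: "zx (t, y') = zx (t, y)" if t: "t \<in> {x'..x}" for t
    proof (rule const[of y' y "\<lambda>r. zx (t, r)"])
      fix r assume "r \<in> {y'..y}"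
      then have "(t, r) \<in> D" using D_rectangle[OF xy, of t r] t x' y' by simp
      then show "((\<lambda>r. zx (t, r)) has_real_derivative 0) (at r)"
        using slice_derivs(2)[OF zx(2)] zero by metis
    qed (use y' in simp)
    have "z (x', y) - z (x', y') = z (x, y) - z (x, y')"
    proof (rule const[of x' x "\<lambda>t. z (t, y) - z (t, y')"])
      fix t assume t: "t \<in> {x'..x}"
      then have "(t, y) \<in> D" "(t, y') \<in> D"
        using D_rectangle[OF xy, of t y] D_rectangle[OF xy, of t y'] x' y' by simp_all
      then have "((\<lambda>t. z (t, y) - z (t, y')) has_real_derivative zx (t, y) - zx (t, y')) (at t)"
        using slice_derivs(1)[OF z(1)] zx(1) by (intro DERIV_diff) simp_all
      then show "((\<lambda>t. z (t, y) - z (t, y')) has_real_derivative 0) (at t)" using zx_const[OF t] by simp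
    qed (use x' in simp)
    then show ?thesis by simp
  qed
  have inD: "z p - z (fst p, 0) = z (0, snd p) - z (0, 0)" if p: "p \<in> D" for p
  proof -
    obtain x y where xy: "p = (x, y)" by (cases p)
    have pos: "0 < x" "x \<le> 1" "0 < y" "y \<le> 1" using D_interior(1,2)[OF p] xy by auto
    have ev: "\<forall>\<^sub>F t in at_right (0::real). 0 < t \<and> t < 1"
      by (auto simp: eventually_at_right_field intro: exI[of _ 1])
    have lim: "((\<lambda>t. z (f t)) \<longlongrightarrow> z pt) (at_right 0)"
      if "(f \<longlongrightarrow> pt) (at_right 0)" "pt \<in> Dbar" "\<And>t. 0 < t \<Longrightarrow> t < 1 \<Longrightarrow> f t \<in> D" for f :: "real \<Rightarrow> real \<times> real" and pt
    proof (rule continuous_on_tendsto_compose[OF z(2) that(1,2)])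
      show "\<forall>\<^sub>F t in at_right 0. f t \<in> Dbar"
        using ev by eventually_elim (use that(3) D_subset_Dbar in blast)
    qed
    have mem: "(c * x, d * y) \<in> D" if "0 < c" "c \<le> 1" "0 < d" "d \<le> 1" for c d
      using D_rectangle[of x y "c * x" "d * y"] p xy pos that by (simp add: mult_left_le_one_le)
    have t: "((\<lambda>t::real. (x, t * y)) \<longlongrightarrow> (x, 0 * y)) (at_right 0)"
      "((\<lambda>t::real. (t * x, y)) \<longlongrightarrow> (0 * x, y)) (at_right 0)"
      "((\<lambda>t::real. (t * x, t * y)) \<longlongrightarrow> (0 * x, 0 * y)) (at_right 0)"
      by (intro tendsto_intros)+
    have "((\<lambda>t. z (x, t * y)) \<longlongrightarrow> z (x, 0 * y)) (at_right 0)"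
      by (rule lim[OF t(1)]) (use mem[of 1] x_axis_Dbar pos in auto)
    moreover have "((\<lambda>t. z (t * x, y)) \<longlongrightarrow> z (0 * x, y)) (at_right 0)"
      by (rule lim[OF t(2)]) (use mem[of _ 1] y_axis_Dbar pos in auto)
    moreover have "((\<lambda>t. z (t * x, t * y)) \<longlongrightarrow> z (0 * x, 0 * y)) (at_right 0)"
      by (rule lim[OF t(3)]) (use mem x_axis_Dbar[of 0] in auto)
    ultimately have "((\<lambda>t. z (x, y) - z (x, t * y) - (z (t * x, y) - z (t * x, t * y))) \<longlongrightarrow>
        z (x, y) - z (x, 0 * y) - (z (0 * x, y) - z (0 * x, 0 * y))) (at_right 0)"
      by (intro tendsto_diff tendsto_const)
    moreover have "((\<lambda>t. z (x, y) - z (x, t * y) - (z (t * x, y) - z (t * x, t * y))) \<longlongrightarrow> 0) (at_right 0)"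
    proof (rule tendsto_eventually, use ev in eventually_elim)
      fix t :: real assume "0 < t \<and> t < 1"
      then show "z (x, y) - z (x, t * y) - (z (t * x, y) - z (t * x, t * y)) = 0"
        using rect[of x y "t * x" "t * y"] p xy pos by (simp add: mult_left_le_one_le)
    qed
    ultimately have "z (x, y) - z (x, 0 * y) - (z (0 * x, y) - z (0 * x, 0 * y)) = 0"
      using tendsto_unique[OF trivial_limit_at_right_real] by blast
    then show ?thesis by (simp add: xy)
  qed
  have "continuous_on Dbar (\<lambda>p. z p - z (fst p, 0) - (z (0, snd p) - z (0, 0)))"
  proof (intro continuous_on_diff z(2) continuous_on_const)
    show "continuous_on Dbar (\<lambda>p. z (fst p, 0))"
      by (rule continuous_on_compose2[OF z(2)])
         (auto intro!: continuous_intros x_axis_Dbar dest: Dbar_bounds(1,2))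
    show "continuous_on Dbar (\<lambda>p. z (0, snd p))"
      by (rule continuous_on_compose2[OF z(2)])
         (auto intro!: continuous_intros y_axis_Dbar dest: Dbar_bounds(3,4))
  qed
  then have "z p - z (fst p, 0) - (z (0, snd p) - z (0, 0)) = 0"
    using continuous_constant_on_closure[of D "\<lambda>p. z p - z (fst p, 0) - (z (0, snd p) - z (0, 0))" 0 p] inD p
    unfolding closure_D by simp
  then show ?thesis by simp
qed

text \<open>The mixed derivative \<open>w\<close> of \<open>v\<close> depends on the level alone,
  and that of \<open>profile F\<close> is \<open>- m n F''\<close>, evaluated at the level. With
  \<open>F2\<close> chosen accordingly, \<open>v - profile F\<close> has vanishing mixed derivative
  and is determined by its values on the axes. These are the data, because \<open>profile F\<close>
  vanishes there.\<close>

lemma solution_representation: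
  assumes gen: "generalized_solution m n \<gamma> g v" and C2: "Ck_closure 2 D v"
  obtains F F1 F2 where "\<And>s. s \<in> I \<Longrightarrow> (F has_real_derivative F1 s) (at s within I)"
    "\<And>s. s \<in> I \<Longrightarrow> (F1 has_real_derivative F2 s) (at s within I)" "continuous_on I F2"
    "F 0 = 0" "F1 0 = 0" "\<And>p. p \<in> Dbar \<Longrightarrow> v p = axes_part g p + profile F p"
proof -
  obtain vx where v: "continuous_on Dbar v" "\<And>p. p \<in> D \<Longrightarrow> v differentiable (at p)"
    and vx: "\<And>p. p \<in> D \<Longrightarrow> vx p = partial_x v p" "Ck_closure (Suc 0) D vx"
    using C2 unfolding numeral_2_eq_2 Ck_closure.simps(2)[of "Suc 0"] closure_D by blast
  obtain w where vx': "continuous_on Dbar vx" "\<And>p. p \<in> D \<Longrightarrow> vx differentiable (at p)"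
    and w: "\<And>p. p \<in> D \<Longrightarrow> w p = partial_y vx p" "continuous_on Dbar w"
    using vx(2) unfolding Ck_closure.simps closure_D by blast
  note sub = continuous_on_subset[OF _ D_subset_Dbar]
  have bdry: "\<And>p. p \<in> Dbar - D \<Longrightarrow> v p = g p"
    and weak: "\<And>\<phi>. test_function D \<phi> \<Longrightarrow> (LINT p:D|lborel. v p * diff_op m n \<phi> p) = 0"
    using gen unfolding generalized_solution_iff by blast+
  have wq: "w p = w (q (lev p))" if "p \<in> D" for p
    by (rule mixed_derivative_is_level_function[OF v(2) sub[OF v(1)] vx(1) vx'(2) sub[OF vx'(1)] w weak that])
  define F2 where "F2 s = - w (q s) / (m * n)" for s
  have F2: "continuous_on I F2" unfolding F2_def[abs_def]
    by (intro continuous_on_divide continuous_on_minus continuous_on_const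
        continuous_on_compose2[OF w(2) continuous_q]) (use q_Dbar m n in auto)
  have anti: "\<exists>G. \<forall>s\<in>I. (G has_real_derivative f s) (at s within I)" if "continuous_on I f" for f
    using antiderivative_continuous[OF that] unfolding has_real_derivative_iff_has_vector_derivative by metis
  obtain G1 where G1: "\<forall>s\<in>I. (G1 has_real_derivative F2 s) (at s within I)" using anti[OF F2] by blast
  \<comment> \<open>Both constants of integration are fixed at level 0: \<open>F1 0 = 0\<close>
    excludes linear functions, which the profile cannot detect, and \<open>F 0 = 0\<close> makes the
    profile vanish on the axes.\<close>
  define F1 where "F1 s = G1 s - G1 0" for s
  have F1: "(F1 has_real_derivative F2 s) (at s within I)" if "s \<in> I" for s
    unfolding F1_def[abs_def] using DERIV_diff[OF G1[rule_format, OF that] DERIV_const] by simp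
  obtain G where G: "\<forall>s\<in>I. (G has_real_derivative F1 s) (at s within I)"
    using anti[OF DERIV_continuous_on[OF F1]] by blast
  define F where "F s = G s - G 0" for s
  have F: "(F has_real_derivative F1 s) (at s within I)" if "s \<in> I" for s
    unfolding F_def[abs_def] using DERIV_diff[OF G[rule_format, OF that] DERIV_const] by simp
  have F0: "F 0 = 0" "F1 0 = 0" by (simp_all add: F_def F1_def)
  have cF: "continuous_on I F" by (rule DERIV_continuous_on[OF F])
  have lin: "bounded_linear (\<lambda>p::real \<times> real. n * fst p)" "bounded_linear (\<lambda>p::real \<times> real. - m * snd p)"
    by (intro bounded_linear_const_mult bounded_linear_fst bounded_linear_snd)+
  define z where "z p = v p - profile F p" for p
  define zx where "zx p = vx p - (n * F1 (lev p) - n * F1 (n * fst p))" for p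
  have int: "(f has_real_derivative f' t) (at t)"
    if "\<And>s. s \<in> I \<Longrightarrow> (f has_real_derivative f' s) (at s within I)" "t \<in> {-m<..<n}" for f f' t
    using that(1)[OF at_within_Icc_interior(2)[OF that(2)]] unfolding at_within_Icc_interior(1)[OF that(2)] .
  have dz: "(z has_derivative (\<lambda>e. (fst e * partial_x v p + snd e * partial_y v p) -
      (F1 (lev p) * lev e - F1 (n * fst p) * (n * fst e) - F1 (- m * snd p) * (- m * snd e)))) (at p)"
    if p: "p \<in> D" for p
    unfolding z_def[abs_def] profile_def
    by (intro has_derivative_diff has_derivative_partials v(2) p ridge_has_derivative[of lev F] ridge_has_derivative[OF lin(1)]
        ridge_has_derivative[OF lin(2)] bounded_linear_lev int[OF F] D_interior)
  have dzx: "(zx has_derivative (\<lambda>e. (fst e * partial_x vx p + snd e * partial_y vx p) -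
      (n * (F2 (lev p) * lev e) - n * (F2 (n * fst p) * (n * fst e))))) (at p)"
    if p: "p \<in> D" for p
    unfolding zx_def[abs_def]
    by (intro has_derivative_diff has_derivative_mult_right has_derivative_partials vx'(2) p ridge_has_derivative[of lev F1]
        ridge_has_derivative[OF lin(1)] bounded_linear_lev int[OF F1] D_interior)
  have cz: "continuous_on Dbar z"
    unfolding z_def[abs_def] profile_def
    by (intro continuous_on_diff v(1) continuous_on_compose2[OF cF] continuous_lev linear_continuous_on[OF lin(1)]
        linear_continuous_on[OF lin(2)]) (use Dbar_bounds in blast)+
  have split: "z p = z (fst p, 0) + z (0, snd p) - z (0, 0)" if "p \<in> Dbar" for p
  proof (rule vanishing_mixed_derivative[OF _ cz _ _ _ that])
    fix p assume p: "p \<in> D"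
    show "z differentiable (at p)" using dz[OF p] by (rule differentiableI)
    show "zx differentiable (at p)" using dzx[OF p] by (rule differentiableI)
    show "zx p = partial_x z p"
      unfolding partial_eqI(1)[OF dz[OF p]] zx_def vx(1)[OF p] by (simp add: lev_def mult.commute)
    have "m * n * F2 (lev p) = - w p" using wq[OF p] m n by (simp add: F2_def)
    then show "partial_y zx p = 0"
      unfolding partial_eqI(2)[OF dzx[OF p]] using w(1)[OF p] by (simp add: lev_def algebra_simps)
  qed
  have "v p = axes_part g p + profile F p" if p: "p \<in> Dbar" for p
  proof -
    have ax: "z (x, 0) = g (x, 0)" if "0 \<le> x" "x \<le> 1" for x
      using bdry[of "(x, 0)"] x_axis_Dbar[OF that] F0 by (simp add: z_def profile_def lev_def D_def)
    have ay: "z (0, y) = g (0, y)" if "0 \<le> y" "y \<le> 1" for y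
      using bdry[of "(0, y)"] y_axis_Dbar[OF that] F0 by (simp add: z_def profile_def lev_def D_def)
    have "z p = axes_part g p"
      using split[OF p] ax[OF Dbar_bounds(1,2)[OF p]] ay[OF Dbar_bounds(3,4)[OF p]] ax[of 0]
      by (simp add: axes_part_def)
    then show ?thesis by (simp add: z_def)
  qed
  then show ?thesis using that F F1 F2 F0 by blast
qed

theorem dirichlet_problem:
  assumes A1: "(1, 0) \<notin> Omega \<gamma>"
    and orbits: "\<forall>p\<in>Omega1 \<gamma>. \<exists>ps. proper_orbit m n \<gamma> (p # ps) \<and>
           (\<forall>k. (zeta1 m n \<gamma> ^^ k) (last (p # ps)) \<notin> Omega1 \<gamma>)"
    and g: "C2_boundary \<gamma> g"
  shows "\<exists>u. generalized_solution m n \<gamma> g u \<and> Ck_closure 2 D u \<and>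
           (\<forall>v. generalized_solution m n \<gamma> g v \<and> Ck_closure 2 D v \<longrightarrow> (\<forall>p\<in>Dbar. v p = u p))"
proof -
  obtain dda where "functional_equation (-m) n a da dda"
    using functional_equation_from_orbits[OF A1 orbits] by blast
  then interpret fe: functional_equation "-m" n a da dda .
  obtain h0 h1 where h: "\<And>s. s \<in> I \<Longrightarrow> (jump g has_real_derivative h0 s) (at s within I)"
    "\<And>s. s \<in> I \<Longrightarrow> (h0 has_real_derivative h1 s) (at s within I)" "continuous_on I h1"
    using jump_C2[OF g] by (elim C2_intervalE) blast
  obtain F F1 F2 where F: "\<And>s. s \<in> I \<Longrightarrow> (F has_real_derivative F1 s) (at s within I)"
    "\<And>s. s \<in> I \<Longrightarrow> (F1 has_real_derivative F2 s) (at s within I)" "continuous_on I F2" "F 0 = 0"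
    and Feq: "\<And>s. s \<in> I \<Longrightarrow> F s - F (a s) - F (fe.b s) = jump g s"
    using fe.solution_exists[OF h jump_ends] by metis
  define u where "u p = axes_part g p + profile F p" for p
  have CF: "C2_interval (-m) n F" by (rule C2_intervalI[OF F(1-3)])
  have uC2: "Ck_closure 2 D u" unfolding u_def[abs_def] by (rule solution_C2[OF g CF])
  have ugen: "generalized_solution m n \<gamma> g u"
    unfolding generalized_solution_iff
  proof (intro conjI ballI allI impI)
    show "continuous_on Dbar u"
      using uC2 unfolding numeral_2_eq_2 Ck_closure.simps closure_D by blast
    show "u p = g p" if "p \<in> Dbar - D" for p
      unfolding u_def
    proof (rule frontier_value[where F = F])
      show "F s - F (a s) - F (s - a s) = jump g s" if "s \<in> I" for s
        using Feq[OF that] unfolding fe.b_def .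
    qed (rule F(4), rule that)
    show "(LINT p:D|lborel. u p * diff_op m n \<phi> p) = 0" if "test_function D \<phi>" for \<phi>
      unfolding u_def by (rule solution_weak[OF g CF that])
  qed
  have unique: "v p = u p" if v: "generalized_solution m n \<gamma> g v" "Ck_closure 2 D v" and p: "p \<in> Dbar" for v p
  proof -
    \<comment> \<open>\<open>u\<close> is represented anew because the \<open>F\<close> that defines
      it need not satisfy \<open>F1 0 = 0\<close>, and the comparison needs the same normalization
      for both profiles.\<close>
    obtain P P1 P2 where P: "\<And>s. s \<in> I \<Longrightarrow> (P has_real_derivative P1 s) (at s within I)"
      "\<And>s. s \<in> I \<Longrightarrow> (P1 has_real_derivative P2 s) (at s within I)" "continuous_on I P2"
      "P 0 = 0" "P1 0 = 0" "\<And>p. p \<in> Dbar \<Longrightarrow> u p = axes_part g p + profile P p"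
      using solution_representation[OF ugen uC2] by metis
    obtain Q Q1 Q2 where Q: "\<And>s. s \<in> I \<Longrightarrow> (Q has_real_derivative Q1 s) (at s within I)"
      "\<And>s. s \<in> I \<Longrightarrow> (Q1 has_real_derivative Q2 s) (at s within I)" "continuous_on I Q2"
      "Q 0 = 0" "Q1 0 = 0" "\<And>p. p \<in> Dbar \<Longrightarrow> v p = axes_part g p + profile Q p"
      using solution_representation[OF v] by metis
    have PQ2: "Q2 s - P2 s = 0" if "s \<in> I" for s
    proof (rule fe.homogeneous_solution_affine[OF DERIV_diff[OF Q(1) P(1)] DERIV_diff[OF Q(2) P(2)] _ _ that])
      show "continuous_on I (\<lambda>s. Q2 s - P2 s)" by (intro continuous_on_diff P(3) Q(3))
      show "Q s - P s = (Q (a s) - P (a s)) + (Q (fe.b s) - P (fe.b s))" if s: "s \<in> I" for s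
      proof -
        have fr: "q s \<in> Dbar - D" using q_Dbar s by (auto simp: D_def lev_q clamp_id)
        then have "u (q s) = g (q s)" "v (q s) = g (q s)"
          using ugen v(1) unfolding generalized_solution_iff by blast+
        then have "profile Q (q s) = profile P (q s)" using P(6)[OF q_Dbar] Q(6)[OF q_Dbar] by simp
        then show ?thesis unfolding profile_q[OF s] fe.b_def by simp
      qed
    qed
    have zeroI: "0 \<in> I" using m n by simp
    have const: "f s = f 0" if "\<And>t. t \<in> I \<Longrightarrow> (f has_real_derivative 0) (at t within I)" "s \<in> I"
      for f :: "real \<Rightarrow> real" and s
    proof -
      have "\<exists>c. \<forall>s\<in>I. f s = c"
        by (rule has_field_derivative_zero_constant[OF _ that(1)]) simp_all
      with that(2) zeroI show ?thesis by metis
    qed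
    have "Q1 s - P1 s = 0" if "s \<in> I" for s
      using const[of "\<lambda>s. Q1 s - P1 s" s] DERIV_diff[OF Q(2) P(2)] PQ2 P(5) Q(5) that by simp
    then have "Q s = P s" if "s \<in> I" for s
      using const[of "\<lambda>s. Q s - P s" s] DERIV_diff[OF Q(1) P(1)] P(4) Q(4) that by simp
    then have "profile Q p = profile P p"
      using Dbar_bounds(5-7)[OF p] unfolding profile_def by simp
    then show ?thesis using P(6)[OF p] Q(6)[OF p] by simp
  qed
  show ?thesis using ugen uC2 unique by blast
qed

end

theorem proposition4p2p2:
  fixes m n :: real and \<gamma> :: "real \<Rightarrow> real \<times> real"
  assumes "m > 0" and "n > 0"
    and "admissible_curve \<gamma>"
    and "(1, 0) \<notin> Omega \<gamma>"
    and "\<forall>p\<in>Omega1 \<gamma>. \<exists>ps. proper_orbit m n \<gamma> (p # ps) \<and>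
           (\<forall>k. (zeta1 m n \<gamma> ^^ k) (last (p # ps)) \<notin> Omega1 \<gamma>)"
  shows "\<forall>g. C2_boundary \<gamma> g \<longrightarrow>
           (\<exists>u. generalized_solution m n \<gamma> g u \<and> Ck_closure 2 (curv_triangle \<gamma>) u \<and>
                (\<forall>v. generalized_solution m n \<gamma> g v \<and> Ck_closure 2 (curv_triangle \<gamma>) v \<longrightarrow>
                     (\<forall>p\<in>closure (curv_triangle \<gamma>). v p = u p)))"
proof (intro allI impI)
  fix g assume g: "C2_boundary \<gamma> g"
  interpret characteristic_curve m n \<gamma>
    by unfold_locales (rule assms)+
  show "\<exists>u. generalized_solution m n \<gamma> g u \<and> Ck_closure 2 (curv_triangle \<gamma>) u \<and>
          (\<forall>v. generalized_solution m n \<gamma> g v \<and> Ck_closure 2 (curv_triangle \<gamma>) v \<longrightarrow>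
               (\<forall>p\<in>closure (curv_triangle \<gamma>). v p = u p))"
    unfolding curv_triangle_eq closure_D by (rule dirichlet_problem[OF assms(4,5) g])
qed

end
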